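(* Let $(M,g,f)$ be a compact gradient Ricci soliton, i.e. $(M,g)$ is a compact $n$-dimensional Riemannian manifold and $f$ is a smooth real-valued function on $M$ such that $\nabla^2 f+\mathrm{Ric}=\lambda g$ for some real constant $\lambda$ (of any sign). If the second invariant $S_2(f)$ of the Hessian $\nabla^2 f$ is constant on $M$, then the soliton is trivial; that is, there does not exist any non-trivial compact gradient Ricci soliton with constant $S_2(f)$.
   Context: All Riemannian manifolds are assumed complete, connected, orientable and without boundary. $\nabla^2 f$ denotes the Hessian of $f$ and $\mathrm{Ric}$ the Ricci tensor of $g$. The invariants $S_m(f)$, $0\le m\le n$, of the Hessian (viewed as an endomorphism of the tangent bundle via $g$) are the functions on $M$ defined by $\det(I+\alpha\nabla^2 f)=S_0(f)+\alpha S_1(f)+\cdots+\alpha^n S_n(f)$ for every scalar $\alpha$; thus $S_2(f)$ is the coefficient of $\alpha^2$. A gradient Ricci soliton is called trivial if $\nabla f$ is a Killing vector field or $f$ is constant. *)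

theory Defs
  imports "HOL-Analysis.Analysis" "HOL-Computational_Algebra.Polynomial"
begin

section \<open>Smooth functions on open subsets of Euclidean space\<close>

definition partial_deriv :: "'n::finite \<Rightarrow> (real^'n \<Rightarrow> real) \<Rightarrow> real^'n \<Rightarrow> real" where
  "partial_deriv i h x = frechet_derivative h (at x) (axis i 1)"

text \<open>Only meaningful for open \<open>U\<close>.\<close>

primrec C_k_on :: "nat \<Rightarrow> (real^'n::finite) set \<Rightarrow> (real^'n \<Rightarrow> real) \<Rightarrow> bool" where
  "C_k_on 0 U h \<longleftrightarrow> continuous_on U h"
| "C_k_on (Suc k) U h \<longleftrightarrow>
     (\<forall>x\<in>U. h differentiable (at x)) \<and> (\<forall>i. C_k_on k U (partial_deriv i h))"

definition smooth_on :: "(real^'n::finite) set \<Rightarrow> (real^'n \<Rightarrow> real) \<Rightarrow> bool" where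
  "smooth_on U h \<longleftrightarrow> (\<forall>k. C_k_on k U h)"


section \<open>Smooth manifolds\<close>

text \<open>
  The underlying space of the manifold is a whole type \<open>'m\<close>, Hausdorff and second countable by its
  type class; the dimension is \<open>CARD('n)\<close>. A chart is a pair of an open domain and a coordinate
  map, whose values outside the domain are irrelevant.
\<close>

type_synonym ('m, 'n) chart = "'m set \<times> ('m \<Rightarrow> real^'n)"

abbreviation chart_dom :: "('m, 'n) chart \<Rightarrow> 'm set" where
  "chart_dom c \<equiv> fst c"

abbreviation chart_map :: "('m, 'n) chart \<Rightarrow> 'm \<Rightarrow> real^'n" where
  "chart_map c \<equiv> snd c"

definition chart_img :: "('m, 'n) chart \<Rightarrow> (real^'n) set" where
  "chart_img c = chart_map c ` chart_dom c"

definition chart_inv :: "('m, 'n) chart \<Rightarrow> real^'n \<Rightarrow> 'm" where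
  "chart_inv c = inv_into (chart_dom c) (chart_map c)"

definition is_chart :: "('m::topological_space, 'n::finite) chart \<Rightarrow> bool" where
  "is_chart c \<longleftrightarrow> open (chart_dom c) \<and> open (chart_img c) \<and>
     homeomorphism (chart_dom c) (chart_img c) (chart_map c) (chart_inv c)"

text \<open>The change of coordinates from \<open>c\<close> to \<open>d\<close>, and the open set on which it is defined.\<close>

definition transition :: "('m, 'n) chart \<Rightarrow> ('m, 'n) chart \<Rightarrow> real^'n \<Rightarrow> real^'n" where
  "transition c d = chart_map d \<circ> chart_inv c"

definition overlap :: "('m, 'n) chart \<Rightarrow> ('m, 'n) chart \<Rightarrow> (real^'n) set" where
  "overlap c d = chart_map c ` (chart_dom c \<inter> chart_dom d)"

definition smooth_atlas :: "('m::topological_space, 'n::finite) chart set \<Rightarrow> bool" where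
  "smooth_atlas A \<longleftrightarrow>
     (\<forall>c\<in>A. is_chart c) \<and>
     (\<Union>c\<in>A. chart_dom c) = UNIV \<and>
     (\<forall>c\<in>A. \<forall>d\<in>A. \<forall>i. smooth_on (overlap c d) (\<lambda>x. transition c d x $ i))"

text \<open>\<open>B\<close> is an oriented atlas of the smooth structure generated by \<open>A\<close>.\<close>

definition orientable_manifold :: "('m::topological_space, 'n::finite) chart set \<Rightarrow> bool" where
  "orientable_manifold A \<longleftrightarrow>
     (\<exists>B. smooth_atlas B \<and> smooth_atlas (A \<union> B) \<and>
          (\<forall>c\<in>B. \<forall>d\<in>B. \<forall>x\<in>overlap c d. det (jacobian (transition c d) (at x)) > 0))"

definition local_rep :: "('m \<Rightarrow> real) \<Rightarrow> ('m, 'n) chart \<Rightarrow> real^'n \<Rightarrow> real" where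
  "local_rep f c = f \<circ> chart_inv c"

definition smooth_function :: "('m, 'n::finite) chart set \<Rightarrow> ('m \<Rightarrow> real) \<Rightarrow> bool" where
  "smooth_function A f \<longleftrightarrow> (\<forall>c\<in>A. smooth_on (chart_img c) (local_rep f c))"


section \<open>Riemannian metrics\<close>

text \<open>
  Tensor fields are given classically by their components in each chart, as functions of the
  coordinates; only charts of the atlas and points of their images matter.
\<close>

type_synonym ('m, 'n) vector_field = "('m, 'n) chart \<Rightarrow> real^'n \<Rightarrow> real^'n"
type_synonym ('m, 'n) tensor2 = "('m, 'n) chart \<Rightarrow> real^'n \<Rightarrow> real^'n^'n"

definition riemannian_metric ::
  "('m, 'n::finite) chart set \<Rightarrow> ('m, 'n) tensor2 \<Rightarrow> bool" where
  "riemannian_metric A g \<longleftrightarrow>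
     (\<forall>c\<in>A. \<forall>i j. smooth_on (chart_img c) (\<lambda>x. g c x $ i $ j)) \<and>
     (\<forall>c\<in>A. \<forall>x\<in>chart_img c. transpose (g c x) = g c x \<and> (\<forall>v. v \<noteq> 0 \<longrightarrow> v \<bullet> (g c x *v v) > 0)) \<and>
     (\<forall>c\<in>A. \<forall>d\<in>A. \<forall>x\<in>overlap c d.
        let J = jacobian (transition c d) (at x)
        in g c x = transpose J ** g d (transition c d x) ** J)"

definition riemannian_manifold ::
  "('m::topological_space, 'n::finite) chart set \<Rightarrow> ('m, 'n) tensor2 \<Rightarrow> bool" where
  "riemannian_manifold A g \<longleftrightarrow> smooth_atlas A \<and> riemannian_metric A g"


section \<open>Levi-Civita connection, Ricci tensor and Hessian in coordinates\<close>

text \<open>\<open>christoffel G k i j\<close> is $\Gamma^k_{ij}$ for the metric with components \<open>G\<close>.\<close>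

definition christoffel ::
  "(real^'n \<Rightarrow> real^'n^'n) \<Rightarrow> 'n \<Rightarrow> 'n \<Rightarrow> 'n \<Rightarrow> real^'n \<Rightarrow> real" where
  "christoffel G k i j x =
     (\<Sum>l\<in>UNIV. matrix_inv (G x) $ k $ l *
        (partial_deriv i (\<lambda>y. G y $ j $ l) x + partial_deriv j (\<lambda>y. G y $ i $ l) x
          - partial_deriv l (\<lambda>y. G y $ i $ j) x)) / 2"

text \<open>
  \<open>riemann G l k i j\<close> is the coefficient of $\partial_l$ in $R(\partial_i,\partial_j)\partial_k$, where
  $R(X,Y)Z = \nabla_X\nabla_Y Z - \nabla_Y\nabla_X Z - \nabla_{[X,Y]}Z$. The Ricci tensor is
  $\mathrm{Ric}(Y,Z) = \mathrm{tr}(X \mapsto R(X,Y)Z)$, which is positive on round spheres.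
\<close>

definition riemann ::
  "(real^'n \<Rightarrow> real^'n^'n) \<Rightarrow> 'n \<Rightarrow> 'n \<Rightarrow> 'n \<Rightarrow> 'n \<Rightarrow> real^'n \<Rightarrow> real" where
  "riemann G l k i j x =
     partial_deriv i (christoffel G l j k) x - partial_deriv j (christoffel G l i k) x
     + (\<Sum>p\<in>UNIV. christoffel G l i p x * christoffel G p j k x)
     - (\<Sum>p\<in>UNIV. christoffel G l j p x * christoffel G p i k x)"

definition ricci :: "('m, 'n::finite) tensor2 \<Rightarrow> ('m, 'n) tensor2" where
  "ricci g c x = (\<chi> j k. \<Sum>i\<in>UNIV. riemann (g c) i k i j x)"

definition gradient :: "('m, 'n::finite) tensor2 \<Rightarrow> ('m \<Rightarrow> real) \<Rightarrow> ('m, 'n) vector_field" where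
  "gradient g f c x = matrix_inv (g c x) *v (\<chi> l. partial_deriv l (local_rep f c) x)"

definition hessian :: "('m, 'n::finite) tensor2 \<Rightarrow> ('m \<Rightarrow> real) \<Rightarrow> ('m, 'n) tensor2" where
  "hessian g f c x =
     (\<chi> i j. partial_deriv i (partial_deriv j (local_rep f c)) x
        - (\<Sum>k\<in>UNIV. christoffel (g c) k i j x * partial_deriv k (local_rep f c) x))"

text \<open>The Hessian as an endomorphism, i.e. with its first index raised by \<open>g\<close>.\<close>

definition hessian_endo :: "('m, 'n::finite) tensor2 \<Rightarrow> ('m \<Rightarrow> real) \<Rightarrow> ('m, 'n) tensor2" where
  "hessian_endo g f c x = matrix_inv (g c x) ** hessian g f c x"


section \<open>Geodesic completeness\<close>

text \<open>
  The second clause is the geodesic equation in coordinates. By continuity of \<open>\<gamma>\<close>, derivatives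
  at \<open>t\<close> of \<open>chart_map c \<circ> \<gamma>\<close> only involve values of the coordinate map inside its domain.
\<close>

definition geodesic ::
  "('m::topological_space, 'n::finite) chart set \<Rightarrow> ('m, 'n) tensor2 \<Rightarrow> (real \<Rightarrow> 'm) \<Rightarrow> bool" where
  "geodesic A g \<gamma> \<longleftrightarrow> continuous_on UNIV \<gamma> \<and>
     (\<forall>c\<in>A. \<forall>t. \<gamma> t \<in> chart_dom c \<longrightarrow>
        (let u = chart_map c \<circ> \<gamma>; u' = (\<lambda>s. vector_derivative u (at s))
         in u differentiable (at t) \<and>
            (u' has_vector_derivative
              (\<chi> k. - (\<Sum>i\<in>UNIV. \<Sum>j\<in>UNIV. christoffel (g c) k i j (u t) * u' t $ i * u' t $ j))) (at t)))"

definition geodesically_complete ::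
  "('m::topological_space, 'n::finite) chart set \<Rightarrow> ('m, 'n) tensor2 \<Rightarrow> bool" where
  "geodesically_complete A g \<longleftrightarrow>
     (\<forall>c\<in>A. \<forall>p\<in>chart_dom c. \<forall>v. \<exists>\<gamma>. geodesic A g \<gamma> \<and> \<gamma> 0 = p \<and>
        ((chart_map c \<circ> \<gamma>) has_vector_derivative v) (at 0))"


section \<open>Invariants of the Hessian\<close>

text \<open>The coefficients of the polynomial $\det(I+\alpha H)$ in $\alpha$.\<close>

definition matrix_invariant :: "nat \<Rightarrow> real^'n^'n \<Rightarrow> real" where
  "matrix_invariant m H =
     coeff (det (\<chi> i j. [:if i = j then 1 else 0, H $ i $ j:] :: real poly^'n^'n)) m"

lemma det_one_plus_eq_sum_invariants:
  fixes H :: "real^'n^'n"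
  shows "det (mat 1 + \<alpha> *\<^sub>R H) = (\<Sum>m\<le>CARD('n). matrix_invariant m H * \<alpha> ^ m)"
proof -
  define P where "P = (\<chi> i j. [:if i = j then 1 else 0, H $ i $ j:] :: real poly^'n^'n)"
  have ent: "poly (P $ i $ j) \<alpha> = (mat 1 + \<alpha> *\<^sub>R H) $ i $ j" for i j
    by (simp add: P_def mat_def)
  have "poly (det P) \<alpha> = det (mat 1 + \<alpha> *\<^sub>R H)"
    unfolding det_def by (simp add: poly_sum poly_prod ent)
  moreover have deg: "degree (det P) \<le> CARD('n)"
    unfolding det_def
  proof (rule degree_sum_le)
    fix p :: "'n \<Rightarrow> 'n"
    have "degree (\<Prod>i\<in>UNIV. P $ i $ p i) \<le> (\<Sum>i\<in>UNIV. degree (P $ i $ p i))"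
      using degree_prod_sum_le[of UNIV "\<lambda>i. P $ i $ p i"] by (simp add: o_def)
    also have "\<dots> \<le> (\<Sum>i\<in>(UNIV::'n set). 1)"
      by (intro sum_mono) (auto simp: P_def intro: order_trans[OF degree_pCons_le])
    finally have d: "degree (\<Prod>i\<in>UNIV. P $ i $ p i) \<le> CARD('n)" by simp
    have "degree (of_int (sign p) :: real poly) = 0" by simp
    then show "degree (of_int (sign p) * (\<Prod>i\<in>UNIV. P $ i $ p i)) \<le> CARD('n)"
      using degree_mult_le[of "of_int (sign p)" "\<Prod>i\<in>UNIV. P $ i $ p i"] d by linarith
  qed (simp add: finite_permutations)
  moreover have "poly (det P) \<alpha> = (\<Sum>m\<le>CARD('n). coeff (det P) m * \<alpha> ^ m)"
    unfolding poly_altdef using deg by (intro sum.mono_neutral_left) (auto intro: coeff_eq_0)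
  ultimately show ?thesis
    by (simp add: matrix_invariant_def P_def)
qed

text \<open>
  \<open>S_inv A g f m p\<close> is the value at \<open>p\<close> of the \<open>m\<close>-th invariant of the Hessian of \<open>f\<close>. The
  matrices of an endomorphism in different charts are similar, so the chart chosen at \<open>p\<close> is
  immaterial.
\<close>

definition S_inv ::
  "('m, 'n::finite) chart set \<Rightarrow> ('m, 'n) tensor2 \<Rightarrow> ('m \<Rightarrow> real) \<Rightarrow> nat \<Rightarrow> 'm \<Rightarrow> real" where
  "S_inv A g f m p =
     (let c = (SOME c. c \<in> A \<and> p \<in> chart_dom c)
      in matrix_invariant m (hessian_endo g f c (chart_map c p)))"


section \<open>Gradient Ricci solitons\<close>

definition gradient_ricci_soliton ::
  "('m, 'n::finite) chart set \<Rightarrow> ('m, 'n) tensor2 \<Rightarrow> ('m \<Rightarrow> real) \<Rightarrow> bool" where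
  "gradient_ricci_soliton A g f \<longleftrightarrow>
     smooth_function A f \<and>
     (\<exists>lam. \<forall>c\<in>A. \<forall>x\<in>chart_img c. hessian g f c x + ricci g c x = lam *\<^sub>R g c x)"

text \<open>The equation $\mathcal{L}_X g = 0$ in coordinates.\<close>

definition killing_field ::
  "('m, 'n::finite) chart set \<Rightarrow> ('m, 'n) tensor2 \<Rightarrow> ('m, 'n) vector_field \<Rightarrow> bool" where
  "killing_field A g X \<longleftrightarrow>
     (\<forall>c\<in>A. \<forall>x\<in>chart_img c. \<forall>i j.
        (\<Sum>k\<in>UNIV. X c x $ k * partial_deriv k (\<lambda>y. g c y $ i $ j) x
           + g c x $ k $ j * partial_deriv i (\<lambda>y. X c y $ k) x
           + g c x $ i $ k * partial_deriv j (\<lambda>y. X c y $ k) x) = 0)"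

definition trivial_soliton ::
  "('m, 'n::finite) chart set \<Rightarrow> ('m, 'n) tensor2 \<Rightarrow> ('m \<Rightarrow> real) \<Rightarrow> bool" where
  "trivial_soliton A g f \<longleftrightarrow> killing_field A g (gradient g f) \<or> f constant_on UNIV"

end

theory Submission
  imports Defs
begin

text \<open>
  Write \<open>V = \<nabla> f\<close>, let \<open>H\<close> be the Hessian endomorphism of \<open>f\<close> and \<open>h = tr H = \<Delta> f\<close>. Contracting the
  second Bianchi identity, the soliton equation gives \<open>div H = \<nabla> h / 2\<close> and \<open>\<nabla> h = 2 H V - 2 \<lambda> V\<close>, and
  hence, for \<open>E = (h - 2 \<lambda>) exp (- f)\<close>,
  \<open>\<Delta> E + \<langle>\<nabla> f, \<nabla> E\<rangle> = exp (- f) (2 tr H\<^sup>2 - h\<^sup>2) = exp (- f) (h\<^sup>2 - 4 S\<^sub>2)\<close>, because \<open>2 S\<^sub>2 = h\<^sup>2 - tr H\<^sup>2\<close>.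
  If \<open>S\<^sub>2 > 0\<close>, then \<open>h\<close> has no zero, so \<open>f\<close> is sub- or superharmonic and therefore constant. If
  \<open>S\<^sub>2 \<le> 0\<close>, the strong maximum principle shows that \<open>E\<close> is constant, whence \<open>h\<^sup>2 = 4 S\<^sub>2\<close>, \<open>h = 0\<close>, and \<open>f\<close> is
  a harmonic function on a compact manifold. This replaces the integral identity
  \<open>\<integral> (h\<^sup>2 - 4 S\<^sub>2) = 0\<close>, so that no integration on manifolds is needed.
\<close>

section \<open>Calculus of partial derivatives\<close>

text \<open>The origin of \<open>E\<close> is the vector field \<open>X = 2 H V - h V\<close>. Its
  divergence is \<open>2 tr H\<^sup>2 - h\<^sup>2\<close>, because the two pairings of \<nabla> h
  with \<open>V\<close> cancel; and by the formula for \<nabla> h it equals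
  \<open>\<nabla> h - (h - 2 \<lambda>) V\<close>. The factor \<open>exp (- f)\<close> is the
  integrating factor of this expression: \<open>\<nabla> E = exp (- f) X\<close>. So a field with a
  useful divergence is a weighted gradient, and the divergence identity becomes an elliptic equation
  for a scalar. The case distinction is forced: for positive \<open>S\<^sub>2\<close> the right-hand
  side of that equation has no evident sign, but there
  \<open>h\<^sup>2 = 2 S\<^sub>2 + tr H\<^sup>2\<close> is positive, since \<open>H\<close> is
  self-adjoint for the metric. The obstacle is the passage between charts. The invariants are
  evaluated in a chart selected at each point, whereas the maximum principle needs smooth functions
  on the whole manifold. Hence the Hessian endomorphisms in different charts are shown to be
  conjugate, which makes \<open>h\<close>, read as the first invariant, a global smooth function.
  All curvature identities are computed with matrices inside one chart.\<close>

lemma partial_deriv_eqI: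
  "(h has_derivative D) (at x) \<Longrightarrow> partial_deriv i h x = D (axis i 1)"
  unfolding partial_deriv_def by (metis frechet_derivative_at)

lemma has_derivative_partial_deriv:
  fixes h :: "real^'n::finite \<Rightarrow> real"
  assumes "h differentiable (at x)"
  shows "(h has_derivative (\<lambda>v. \<Sum>i\<in>UNIV. v $ i * partial_deriv i h x)) (at x)"
proof -
  let ?D = "frechet_derivative h (at x)"
  have D: "(h has_derivative ?D) (at x)"
    using assms by (simp add: frechet_derivative_works)
  then have lin: "linear ?D" by (rule has_derivative_linear)
  have "?D v = (\<Sum>i\<in>UNIV. v $ i * partial_deriv i h x)" for v
  proof -
    have "?D v = ?D (\<Sum>i\<in>UNIV. (v $ i) *\<^sub>R axis i 1)"
      using basis_expansion[of v] by (simp add: scalar_mult_eq_scaleR)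
    also have "\<dots> = (\<Sum>i\<in>UNIV. v $ i * partial_deriv i h x)"
      using lin by (simp add: linear_sum linear_scale partial_deriv_def)
    finally show ?thesis .
  qed
  then have "?D = (\<lambda>v. \<Sum>i\<in>UNIV. v $ i * partial_deriv i h x)" by (rule ext)
  with D show ?thesis by simp
qed

lemma partial_deriv_const [simp]: "partial_deriv i (\<lambda>x. c) = (\<lambda>x. 0)"
  by (rule ext, rule partial_deriv_eqI[THEN trans]) (auto intro!: derivative_eq_intros)

lemma partial_deriv_nth: "partial_deriv i (\<lambda>y::real^'n::finite. y $ j) x = (if i = j then 1 else 0)"
proof -
  have "((\<lambda>y::real^'n. y $ j) has_derivative (\<lambda>v. v $ j)) (at x)"
    by (intro bounded_linear_imp_has_derivative bounded_linear_vec_nth)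
  then show ?thesis by (simp add: partial_deriv_eqI axis_def)
qed

text \<open>\<open>frechet_derivative\<close> is a choice among all derivatives, and both functions
  have the same ones at \<open>x\<close>; so the equality holds even where neither is
  differentiable.\<close>

lemma partial_deriv_cong:
  assumes "open U" "x \<in> U" "\<And>y. y \<in> U \<Longrightarrow> f y = g y"
  shows "partial_deriv i f x = partial_deriv i g x"
proof -
  have "(f has_derivative D) (at x) \<longleftrightarrow> (g has_derivative D) (at x)" for D
    using assms by (metis has_derivative_transform_within_open)
  then show ?thesis by (simp add: partial_deriv_def frechet_derivative_def)
qed

context
  fixes f g :: "real^'n::finite \<Rightarrow> real" and x :: "real^'n"
  assumes f: "f differentiable (at x)" and g: "g differentiable (at x)"
begin

lemma partial_deriv_add:
  "partial_deriv i (\<lambda>y. f y + g y) x = partial_deriv i f x + partial_deriv i g x"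
  using has_derivative_add[OF f[unfolded frechet_derivative_works] g[unfolded frechet_derivative_works]]
  by (simp add: partial_deriv_eqI) (simp add: partial_deriv_def)

lemma partial_deriv_diff:
  "partial_deriv i (\<lambda>y. f y - g y) x = partial_deriv i f x - partial_deriv i g x"
  using has_derivative_diff[OF f[unfolded frechet_derivative_works] g[unfolded frechet_derivative_works]]
  by (simp add: partial_deriv_eqI) (simp add: partial_deriv_def)

lemma partial_deriv_mult:
  "partial_deriv i (\<lambda>y. f y * g y) x = f x * partial_deriv i g x + partial_deriv i f x * g x"
  using has_derivative_mult[OF f[unfolded frechet_derivative_works] g[unfolded frechet_derivative_works]]
  by (simp add: partial_deriv_eqI) (simp add: partial_deriv_def)

end

context
  fixes f :: "real^'n::finite \<Rightarrow> real" and x :: "real^'n"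
  assumes f: "f differentiable (at x)"
begin

lemma partial_deriv_cmult: "partial_deriv i (\<lambda>y. c * f y) x = c * partial_deriv i f x"
  using has_derivative_mult_right[OF f[unfolded frechet_derivative_works], of c]
  by (simp add: partial_deriv_eqI) (simp add: partial_deriv_def)

lemma partial_deriv_minus: "partial_deriv i (\<lambda>y. - f y) x = - partial_deriv i f x"
  using has_derivative_minus[OF f[unfolded frechet_derivative_works]]
  by (simp add: partial_deriv_eqI) (simp add: partial_deriv_def)

lemma partial_deriv_exp: "partial_deriv i (\<lambda>y. exp (f y)) x = partial_deriv i f x * exp (f x)"
  using has_derivative_exp[OF f[unfolded frechet_derivative_works]]
  by (simp add: partial_deriv_eqI) (simp add: partial_deriv_def)

lemma partial_deriv_inverse:
  "f x \<noteq> 0 \<Longrightarrow> partial_deriv i (\<lambda>y. inverse (f y)) x = - partial_deriv i f x * (inverse (f x) * inverse (f x))"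
  using Deriv.has_derivative_inverse[OF _ f[unfolded frechet_derivative_works]]
  by (simp add: partial_deriv_eqI) (simp add: partial_deriv_def algebra_simps)

end

lemma partial_deriv_sum:
  assumes "\<And>a. a \<in> I \<Longrightarrow> F a differentiable (at x)"
  shows "partial_deriv i (\<lambda>y. \<Sum>a\<in>I. F a y) x = (\<Sum>a\<in>I. partial_deriv i (F a) x)"
proof -
  have "((\<lambda>y. \<Sum>a\<in>I. F a y) has_derivative (\<lambda>v. \<Sum>a\<in>I. frechet_derivative (F a) (at x) v)) (at x)"
    using assms by (intro has_derivative_sum) (simp add: frechet_derivative_works)
  then show ?thesis by (simp add: partial_deriv_eqI) (simp add: partial_deriv_def)
qed

text \<open>\<open>C_k_on\<close> refers to partial derivatives as total functions, while the rules
  of differentiation compute them only on \<open>U\<close>. The closure proofs below identify the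
  derivative on \<open>U\<close> and then pass through this lemma.\<close>

lemma C_k_on_cong:
  assumes "open U" "\<And>y. y \<in> U \<Longrightarrow> f y = g y" "C_k_on k U f"
  shows "C_k_on k U g"
  using assms(2,3)
proof (induction k arbitrary: f g)
  case 0
  then show ?case by (metis C_k_on.simps(1) continuous_on_cong)
next
  case (Suc k)
  have "g differentiable (at x)" if "x \<in> U" for x
    using Suc.prems that assms(1)
    unfolding C_k_on.simps differentiable_def by (metis has_derivative_transform_within_open)
  moreover have "C_k_on k U (partial_deriv i g)" for i
    using Suc.IH[of "partial_deriv i f" "partial_deriv i g"] Suc.prems
      partial_deriv_cong[OF assms(1), of _ f g i] by auto
  ultimately show ?case by simp
qed

lemma C_k_on_Suc_imp: "C_k_on (Suc k) U f \<Longrightarrow> C_k_on k U f"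
proof (induction k arbitrary: f)
  case 0
  then show ?case
    by (auto intro!: continuous_at_imp_continuous_on differentiable_imp_continuous_within)
next
  case (Suc k)
  then show ?case by (metis C_k_on.simps(2))
qed

lemma C_k_on_subset: "C_k_on k U f \<Longrightarrow> V \<subseteq> U \<Longrightarrow> C_k_on k V f"
  by (induction k arbitrary: f) (auto intro: continuous_on_subset)

lemma smooth_on_subset: "smooth_on U f \<Longrightarrow> V \<subseteq> U \<Longrightarrow> smooth_on V f"
  unfolding smooth_on_def by (blast intro: C_k_on_subset)

lemma smooth_on_cong:
  "open U \<Longrightarrow> (\<And>y. y \<in> U \<Longrightarrow> f y = g y) \<Longrightarrow> smooth_on U f \<Longrightarrow> smooth_on U g"
  unfolding smooth_on_def by (blast intro: C_k_on_cong)

lemma smooth_on_differentiable: "smooth_on U f \<Longrightarrow> x \<in> U \<Longrightarrow> f differentiable (at x)"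
  unfolding smooth_on_def by (metis C_k_on.simps(2))

lemma smooth_on_partial_deriv: "smooth_on U f \<Longrightarrow> smooth_on U (partial_deriv i f)"
  unfolding smooth_on_def by (metis C_k_on.simps(2))

lemma smooth_on_continuous_on: "smooth_on U f \<Longrightarrow> continuous_on U f"
  unfolding smooth_on_def by (metis C_k_on.simps(1))

lemma smooth_on_const: "smooth_on U (\<lambda>x. c)"
proof -
  have "C_k_on k U (\<lambda>x. c)" for k c
    by (induction k arbitrary: c) auto
  then show ?thesis by (simp add: smooth_on_def)
qed

lemma smooth_on_nth: "smooth_on U (\<lambda>x. x $ j)"
proof -
  have "C_k_on k U (\<lambda>x. x $ j)" for k
  proof (cases k)
    case 0
    then show ?thesis by (auto intro: continuous_intros)
  next
    case (Suc l)
    have "(\<lambda>x::real^'a. x $ j) differentiable (at x)" for x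
      by (metis bounded_linear_imp_differentiable bounded_linear_vec_nth)
    moreover have "C_k_on l U (partial_deriv i (\<lambda>x. x $ j))" for i
      using smooth_on_const[of U] by (simp add: partial_deriv_nth[abs_def] smooth_on_def)
    ultimately show ?thesis by (simp add: Suc)
  qed
  then show ?thesis by (simp add: smooth_on_def)
qed

section \<open>Closure of smooth functions under algebraic operations, inverse and
  exponential\<close>

lemma C_k_on_add:
  assumes "open U"
  shows "C_k_on k U f \<Longrightarrow> C_k_on k U g \<Longrightarrow> C_k_on k U (\<lambda>x. f x + g x)"
proof (induction k arbitrary: f g)
  case 0
  then show ?case by (auto intro: continuous_intros)
next
  case (Suc k)
  have "C_k_on k U (partial_deriv i (\<lambda>x. f x + g x))" for i
    by (rule C_k_on_cong[OF assms _ Suc.IH[of "partial_deriv i f" "partial_deriv i g"]])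
      (use Suc.prems in \<open>auto simp: partial_deriv_add\<close>)
  with Suc.prems show ?case by (auto intro: differentiable_add)
qed

lemma C_k_on_mult:
  assumes "open U"
  shows "C_k_on k U f \<Longrightarrow> C_k_on k U g \<Longrightarrow> C_k_on k U (\<lambda>x. f x * g x)"
proof (induction k arbitrary: f g)
  case 0
  then show ?case by (auto intro: continuous_intros)
next
  case (Suc k)
  \<comment> \<open>The product rule leaves one factor undifferentiated, so the induction hypothesis
    needs the factors themselves at the lower order too.\<close>
  have lower: "C_k_on k U f" "C_k_on k U g"
    using Suc.prems by (blast intro: C_k_on_Suc_imp)+
  have "C_k_on k U (partial_deriv i (\<lambda>x. f x * g x))" for i
    by (rule C_k_on_cong[OF assms _ C_k_on_add[OF assms
            Suc.IH[OF lower(1), of "partial_deriv i g"] Suc.IH[OF _ lower(2), of "partial_deriv i f"]]])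
      (use Suc.prems in \<open>auto simp: partial_deriv_mult\<close>)
  with Suc.prems show ?case by (auto intro: differentiable_mult)
qed

context
  fixes U :: "(real^'n::finite) set"
  assumes U: "open U"
begin

lemma smooth_on_add: "smooth_on U f \<Longrightarrow> smooth_on U g \<Longrightarrow> smooth_on U (\<lambda>x. f x + g x)"
  unfolding smooth_on_def by (blast intro: C_k_on_add[OF U])

lemma smooth_on_mult: "smooth_on U f \<Longrightarrow> smooth_on U g \<Longrightarrow> smooth_on U (\<lambda>x. f x * g x)"
  unfolding smooth_on_def by (blast intro: C_k_on_mult[OF U])

lemma smooth_on_minus: "smooth_on U f \<Longrightarrow> smooth_on U (\<lambda>x. - f x)"
  using smooth_on_mult[OF smooth_on_const[of U "-1"], of f] by simp

lemma smooth_on_diff: "smooth_on U f \<Longrightarrow> smooth_on U g \<Longrightarrow> smooth_on U (\<lambda>x. f x - g x)"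
  using smooth_on_add[OF _ smooth_on_minus, of f g] by simp

lemma smooth_on_sum: "(\<And>a. a \<in> I \<Longrightarrow> smooth_on U (F a)) \<Longrightarrow> smooth_on U (\<lambda>x. \<Sum>a\<in>I. F a x)"
  by (induction I rule: infinite_finite_induct) (auto intro: smooth_on_const smooth_on_add)

lemma smooth_on_prod: "(\<And>a. a \<in> I \<Longrightarrow> smooth_on U (F a)) \<Longrightarrow> smooth_on U (\<lambda>x. \<Prod>a\<in>I. F a x)"
  by (induction I rule: infinite_finite_induct) (auto intro: smooth_on_const smooth_on_mult)

text \<open>The derivative contains the inverse itself, but only to the order already reached, so
  induction on \<open>k\<close> with \<open>f\<close> fixed bootstraps. \<open>smooth_on_exp\<close>
  works in the same way.\<close>

lemma smooth_on_inverse: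
  assumes f: "smooth_on U f" and nz: "\<And>x. x \<in> U \<Longrightarrow> f x \<noteq> 0"
  shows "smooth_on U (\<lambda>x. inverse (f x))"
proof -
  have "C_k_on k U (\<lambda>x. inverse (f x))" for k
  proof (induction k)
    case 0
    then show ?case using f nz by (auto intro: continuous_intros smooth_on_continuous_on)
  next
    case (Suc k)
    have "C_k_on k U (partial_deriv i (\<lambda>x. inverse (f x)))" for i
    proof (rule C_k_on_cong[OF U])
      show "C_k_on k U (\<lambda>x. - partial_deriv i f x * (inverse (f x) * inverse (f x)))"
        using Suc smooth_on_minus[OF smooth_on_partial_deriv[OF f]]
        by (intro C_k_on_mult[OF U]) (auto simp: smooth_on_def)
    qed (simp add: partial_deriv_inverse[OF smooth_on_differentiable[OF f]] nz)
    moreover have "(\<lambda>x. inverse (f x)) differentiable (at x)" if "x \<in> U" for x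
      using f nz that by (intro differentiable_inverse) (auto intro: smooth_on_differentiable)
    ultimately show ?case by simp
  qed
  then show ?thesis by (simp add: smooth_on_def)
qed

lemma smooth_on_exp:
  assumes f: "smooth_on U f"
  shows "smooth_on U (\<lambda>x. exp (f x))"
proof -
  have "C_k_on k U (\<lambda>x. exp (f x))" for k
  proof (induction k)
    case 0
    then show ?case using f by (auto intro: continuous_intros smooth_on_continuous_on)
  next
    case (Suc k)
    have "C_k_on k U (partial_deriv i (\<lambda>x. exp (f x)))" for i
    proof (rule C_k_on_cong[OF U])
      show "C_k_on k U (\<lambda>x. partial_deriv i f x * exp (f x))"
        using Suc smooth_on_partial_deriv[OF f]
        by (auto intro!: C_k_on_mult[OF U] simp: smooth_on_def)
    qed (simp add: partial_deriv_exp[OF smooth_on_differentiable[OF f]])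
    moreover have "(\<lambda>x. exp (f x)) differentiable (at x)" if "x \<in> U" for x
      using has_derivative_exp smooth_on_differentiable[OF f that] unfolding differentiable_def by blast
    ultimately show ?case by simp
  qed
  then show ?thesis by (simp add: smooth_on_def)
qed

end

section \<open>Derivatives along lines and symmetry of second partial derivatives\<close>

lemma has_real_derivative_along_line:
  fixes h :: "real^'n::finite \<Rightarrow> real"
  assumes "h differentiable (at (y + s *\<^sub>R w))"
  shows "((\<lambda>s. h (y + s *\<^sub>R w)) has_real_derivative (\<Sum>i\<in>UNIV. w $ i * partial_deriv i h (y + s *\<^sub>R w))) (at s)"
proof -
  have "((\<lambda>s. y + s *\<^sub>R w) has_derivative (\<lambda>t. t *\<^sub>R w)) (at s)"
    by (auto intro!: derivative_eq_intros)
  from diff_chain_at[OF this has_derivative_partial_deriv[OF assms]]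
  show ?thesis
    unfolding has_field_derivative_def o_def
    by (rule has_derivative_eq_rhs) (simp add: fun_eq_iff sum_distrib_left sum_distrib_right mult_ac)
qed

lemma has_real_derivative_along_axis:
  fixes h :: "real^'n::finite \<Rightarrow> real"
  assumes "h differentiable (at (y + s *\<^sub>R axis i 1))"
  shows "((\<lambda>s. h (y + s *\<^sub>R axis i 1)) has_real_derivative partial_deriv i h (y + s *\<^sub>R axis i 1)) (at s)"
  using has_real_derivative_along_line[OF assms]
  by (simp add: axis_def if_distrib[where f="\<lambda>t. t * _"] cong: if_cong)

text \<open>The mean value theorem is applied twice, first in direction \<open>i\<close> to a
  difference in direction \<open>j\<close>, then in direction \<open>j\<close>. The left side is
  symmetric in \<open>i\<close> and \<open>j\<close> and the right side is not, which is the source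
  of \<open>partial_deriv_commute\<close>.\<close>

lemma second_difference:
  fixes h :: "real^'n::finite \<Rightarrow> real"
  assumes sub: "ball x (2 * t) \<subseteq> U" and t: "0 < t"
    and h: "\<And>y. y \<in> U \<Longrightarrow> h differentiable (at y)"
    and hi: "\<And>y. y \<in> U \<Longrightarrow> partial_deriv i h differentiable (at y)"
  shows "\<exists>z\<in>ball x (2 * t). h (x + (t/2) *\<^sub>R axis i 1 + (t/2) *\<^sub>R axis j 1) - h (x + (t/2) *\<^sub>R axis i 1)
      - h (x + (t/2) *\<^sub>R axis j 1) + h x = (t/2) * (t/2) * partial_deriv j (partial_deriv i h) z"
proof -
  have in_ball: "x + a *\<^sub>R axis i 1 + b *\<^sub>R axis j 1 \<in> ball x (2 * t)"
    if "0 \<le> a" "a \<le> t/2" "0 \<le> b" "b \<le> t/2" for a b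
  proof -
    have "norm (a *\<^sub>R axis i (1::real) + b *\<^sub>R axis j 1) \<le> a + b"
      using that by (intro order_trans[OF norm_triangle_ineq]) (simp add: norm_axis_1)
    then have "norm (a *\<^sub>R axis i (1::real) + b *\<^sub>R axis j 1) < 2 * t" using that t by linarith
    moreover have "dist x (x + v) = norm v" for v by (simp add: dist_norm)
    ultimately show ?thesis by (simp only: mem_ball add.assoc)
  qed
  define \<phi> where "\<phi> a = h (x + (t/2) *\<^sub>R axis j 1 + a *\<^sub>R axis i 1) - h (x + a *\<^sub>R axis i 1)" for a
  have \<phi>': "(\<phi> has_real_derivative partial_deriv i h (x + (t/2) *\<^sub>R axis j 1 + a *\<^sub>R axis i 1)
      - partial_deriv i h (x + a *\<^sub>R axis i 1)) (at a)" if "0 \<le> a" "a \<le> t/2" for a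
    unfolding \<phi>_def
    using in_ball[of a "t/2"] in_ball[of a 0] that sub t
    by (intro DERIV_diff has_real_derivative_along_axis h) (auto simp: add_ac subset_iff)
  have "\<exists>a>0. a < t/2 \<and> \<phi> (t/2) - \<phi> 0 = (t/2 - 0) *
      (partial_deriv i h (x + (t/2) *\<^sub>R axis j 1 + a *\<^sub>R axis i 1) - partial_deriv i h (x + a *\<^sub>R axis i 1))"
    by (rule MVT2) (simp add: t, rule \<phi>')
  then obtain a where a: "0 < a" "a < t/2" "\<phi> (t/2) - \<phi> 0 = (t/2 - 0) *
      (partial_deriv i h (x + (t/2) *\<^sub>R axis j 1 + a *\<^sub>R axis i 1) - partial_deriv i h (x + a *\<^sub>R axis i 1))"
    by blast
  have b': "((\<lambda>b. partial_deriv i h (x + a *\<^sub>R axis i 1 + b *\<^sub>R axis j 1)) has_real_derivative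
      partial_deriv j (partial_deriv i h) (x + a *\<^sub>R axis i 1 + b *\<^sub>R axis j 1)) (at b)"
    if "0 \<le> b" "b \<le> t/2" for b
    using in_ball[of a b] that a sub t
    by (intro has_real_derivative_along_axis hi) auto
  have "\<exists>b>0. b < t/2 \<and>
    partial_deriv i h (x + a *\<^sub>R axis i 1 + (t/2) *\<^sub>R axis j 1) - partial_deriv i h (x + a *\<^sub>R axis i 1 + 0 *\<^sub>R axis j 1)
     = (t/2 - 0) * partial_deriv j (partial_deriv i h) (x + a *\<^sub>R axis i 1 + b *\<^sub>R axis j 1)"
    by (rule MVT2) (simp add: t, rule b')
  then obtain b where b: "0 < b" "b < t/2"
    "partial_deriv i h (x + a *\<^sub>R axis i 1 + (t/2) *\<^sub>R axis j 1) - partial_deriv i h (x + a *\<^sub>R axis i 1 + 0 *\<^sub>R axis j 1)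
     = (t/2 - 0) * partial_deriv j (partial_deriv i h) (x + a *\<^sub>R axis i 1 + b *\<^sub>R axis j 1)"
    by blast
  have "x + (t/2) *\<^sub>R axis j 1 + c *\<^sub>R axis i 1 = x + c *\<^sub>R axis i 1 + (t/2) *\<^sub>R axis j 1" for c
    by (simp add: add_ac)
  with a(3) b(3) have "\<phi> (t/2) - \<phi> 0
      = (t/2) * (t/2) * partial_deriv j (partial_deriv i h) (x + a *\<^sub>R axis i 1 + b *\<^sub>R axis j 1)"
    by (simp only: diff_zero scaleR_zero_left add_0_right mult.assoc)
  moreover have "\<phi> (t/2) - \<phi> 0 = h (x + (t/2) *\<^sub>R axis i 1 + (t/2) *\<^sub>R axis j 1)
      - h (x + (t/2) *\<^sub>R axis i 1) - h (x + (t/2) *\<^sub>R axis j 1) + h x"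
    by (simp add: \<phi>_def add_ac)
  ultimately show ?thesis
    using a b in_ball[of a b] by auto
qed

text \<open>If the two orders differed at \<open>x\<close>, continuity would keep them apart near
  \<open>x\<close>; yet both equal the same second difference quotient at suitable nearby
  points.\<close>

lemma partial_deriv_commute:
  fixes h :: "real^'n::finite \<Rightarrow> real"
  assumes U: "open U" "x \<in> U" and h: "smooth_on U h"
  shows "partial_deriv i (partial_deriv j h) x = partial_deriv j (partial_deriv i h) x"
proof (rule ccontr)
  let ?a = "partial_deriv i (partial_deriv j h)" and ?b = "partial_deriv j (partial_deriv i h)"
  assume ne: "?a x \<noteq> ?b x"
  \<comment> \<open>Half of the gap: two errors below \<open>e\<close> cannot bridge it.\<close>
  define e where "e = \<bar>?a x - ?b x\<bar> / 2"
  have e: "e > 0" using ne by (simp add: e_def)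
  have cont: "isCont ?a x" "isCont ?b x"
    using U h continuous_on_eq_continuous_at smooth_on_continuous_on smooth_on_partial_deriv by metis+
  obtain d1 where d1: "d1 > 0" "\<And>y. dist y x < d1 \<Longrightarrow> dist (?a y) (?a x) < e"
    using cont(1) e unfolding continuous_at_eps_delta by metis
  obtain d2 where d2: "d2 > 0" "\<And>y. dist y x < d2 \<Longrightarrow> dist (?b y) (?b x) < e"
    using cont(2) e unfolding continuous_at_eps_delta by metis
  obtain r where r: "r > 0" "ball x r \<subseteq> U" using U open_contains_ball by metis
  define t where "t = min r (min d1 d2) / 2"
  have t: "0 < t" "2 * t \<le> r" "2 * t \<le> d1" "2 * t \<le> d2" using r d1 d2 by (auto simp: t_def)
  have sub: "ball x (2 * t) \<subseteq> U" using r t by (meson order_trans subset_ball)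
  have diff: "h differentiable (at y)" "partial_deriv k h differentiable (at y)" if "y \<in> U" for y k
    using that h by (auto intro: smooth_on_differentiable smooth_on_partial_deriv)
  obtain z where z: "z \<in> ball x (2 * t)"
    "h (x + (t/2) *\<^sub>R axis i 1 + (t/2) *\<^sub>R axis j 1) - h (x + (t/2) *\<^sub>R axis i 1)
      - h (x + (t/2) *\<^sub>R axis j 1) + h x = (t/2) * (t/2) * ?b z"
    using second_difference[OF sub t(1) diff] by blast
  obtain w where w: "w \<in> ball x (2 * t)"
    "h (x + (t/2) *\<^sub>R axis j 1 + (t/2) *\<^sub>R axis i 1) - h (x + (t/2) *\<^sub>R axis j 1)
      - h (x + (t/2) *\<^sub>R axis i 1) + h x = (t/2) * (t/2) * ?a w"
    using second_difference[OF sub t(1) diff] by blast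
  have "(t/2) * (t/2) * ?b z = (t/2) * (t/2) * ?a w"
    using z(2) w(2)
    unfolding add.assoc[of x] add.commute[of "(t/2) *\<^sub>R axis j 1" "(t/2) *\<^sub>R axis i 1"] by linarith
  then have "?b z = ?a w" using t by simp
  moreover have "dist w x < d1" "dist z x < d2"
    using w(1) z(1) t unfolding mem_ball dist_commute[of x] by linarith+
  then have "dist (?a w) (?a x) < e" "dist (?b z) (?b x) < e"
    using d1(2) d2(2) by blast+
  ultimately have "\<bar>?a x - ?b x\<bar> < 2 * e"
    by (auto simp: dist_real_def)
  then show False by (simp add: e_def)
qed

section \<open>Linear algebra\<close>

lemma matrix_diff_ldistrib: "(A::real^'n::finite^'m) ** (B - C) = A ** B - A ** C"
  by (vector matrix_matrix_mult_def sum_subtractf right_diff_distrib)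

lemma matrix_diff_rdistrib: "((A::real^'n::finite^'m) - B) ** C = A ** C - B ** C"
  by (vector matrix_matrix_mult_def sum_subtractf left_diff_distrib)

lemma matrix_add_rdistrib: "((A::real^'n::finite^'m) + B) ** C = A ** C + B ** C"
  by (vector matrix_matrix_mult_def sum.distrib distrib_right)

lemma matrix_minus_left: "(- (A::real^'n::finite^'m)) ** B = - (A ** B)"
  by (vector matrix_matrix_mult_def sum_negf)

lemma matrix_minus_right: "(A::real^'n::finite^'m) ** (- B) = - (A ** B)"
  by (vector matrix_matrix_mult_def sum_negf)

lemma matrix_minus_vector: "(- (A::real^'n::finite^'m)) *v x = - (A *v x)"
  by (vector matrix_vector_mult_def sum_negf)

lemma symmetric_matrix_nth: "transpose A = A \<Longrightarrow> A $ i $ j = A $ j $ i"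
  by (drule arg_cong[where f = "\<lambda>M. M $ j $ i"]) (simp add: transpose_def)

lemma inner_matrix_symmetric:
  fixes A :: "real^'n::finite^'n"
  assumes "transpose A = A"
  shows "u \<bullet> (A *v v) = (A *v u) \<bullet> v"
  using assms by (metis dot_lmul_matrix transpose_matrix_vector)

lemma matrix_inv_inverse:
  fixes A :: "real^'n::finite^'n"
  assumes "invertible A"
  shows "A ** matrix_inv A = mat 1" "matrix_inv A ** A = mat 1"
  using someI_ex[OF assms[unfolded invertible_def]] by (auto simp: matrix_inv_def)

text \<open>Cramer's rule for the columns of the inverse. Entries become quotients of determinants,
  which is how \<open>smooth_on_matrix_inv\<close> obtains a smooth inverse metric.\<close>

lemma matrix_inv_entry:
  fixes A :: "real^'n::finite^'n"
  assumes "invertible A"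
  shows "matrix_inv A $ k $ j = det (\<chi> i l. if l = k then (if i = j then 1 else 0) else A $ i $ l) * inverse (det A)"
proof -
  have "A *v (matrix_inv A *v axis j 1) = axis j 1"
    using matrix_inv_inverse[OF assms] by (simp add: matrix_vector_mul_assoc)
  then have "matrix_inv A *v axis j 1 = (\<chi> k. det (\<chi> i l. if l = k then axis j 1 $ i else A $ i $ l) / det A)"
    using assms by (subst (asm) cramer) (auto simp: invertible_det_nz)
  moreover have "(matrix_inv A *v axis j 1) $ k = matrix_inv A $ k $ j"
    by (simp add: matrix_vector_mult_basis column_def)
  moreover have "axis j (1::real) $ i = (if i = j then 1 else 0)" for i by (simp add: axis_def)
  ultimately show ?thesis by (simp only: divide_inverse vec_lambda_beta)
qed

lemma smooth_on_det:
  fixes M :: "real^'m::finite \<Rightarrow> real^'n::finite^'n"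
  assumes "open U" "\<And>i j. smooth_on U (\<lambda>x. M x $ i $ j)"
  shows "smooth_on U (\<lambda>x. det (M x))"
  unfolding det_def
  by (intro smooth_on_sum smooth_on_mult smooth_on_prod smooth_on_const assms)

lemma smooth_on_matrix_inv:
  fixes M :: "real^'m::finite \<Rightarrow> real^'n::finite^'n"
  assumes U: "open U" and M: "\<And>i j. smooth_on U (\<lambda>x. M x $ i $ j)"
    and inv: "\<And>x. x \<in> U \<Longrightarrow> invertible (M x)"
  shows "smooth_on U (\<lambda>x. matrix_inv (M x) $ k $ j)"
proof (rule smooth_on_cong[OF U])
  have "smooth_on U (\<lambda>x. (\<chi> i l. if l = k then (if i = j then 1 else 0) else M x $ i $ l) $ a $ b)" for a b
    using M[of a b] smooth_on_const[of U] by (cases "b = k") auto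
  then show "smooth_on U (\<lambda>x. det (\<chi> i l. if l = k then (if i = j then 1 else 0) else M x $ i $ l) * inverse (det (M x)))"
    using inv by (intro smooth_on_mult smooth_on_det smooth_on_inverse U M)
      (auto simp: invertible_det_nz)
qed (simp add: matrix_inv_entry inv)

text \<open>Symmetry is part of the definition, since a quadratic form does not see the skew part of
  its matrix.\<close>

definition positive_semidefinite :: "real^'n::finite^'n \<Rightarrow> bool" where
  "positive_semidefinite A \<longleftrightarrow> transpose A = A \<and> (\<forall>v. 0 \<le> v \<bullet> (A *v v))"

lemma inner_axis_matrix_axis:
  fixes A :: "real^'n::finite^'n"
  shows "axis i 1 \<bullet> (A *v axis j 1) = A $ i $ j"
  by (simp add: inner_axis' matrix_vector_mult_basis column_def)

text \<open>When the diagonal entry at \<open>i\<close> vanishes, the form is affine in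
  \<open>t\<close> along \<open>t e_i + e_j\<close>, so a nonzero slope would make it negative
  somewhere.\<close>

lemma positive_semidefinite_zero_diag:
  fixes A :: "real^'n::finite^'n"
  assumes A: "positive_semidefinite A" and "A $ i $ i = 0"
  shows "A $ i $ j = 0"
proof (rule ccontr)
  assume ne: "A $ i $ j \<noteq> 0"
  \<comment> \<open>Solves \<open>2 t A_ij + A_jj = -1\<close>.\<close>
  define t where "t = - (A $ j $ j + 1) / (2 * A $ i $ j)"
  have "A $ j $ i = A $ i $ j"
    using A by (auto simp: positive_semidefinite_def intro: symmetric_matrix_nth)
  then have "(t *\<^sub>R axis i 1 + axis j 1) \<bullet> (A *v (t *\<^sub>R axis i 1 + axis j 1)) = 2 * t * A $ i $ j + A $ j $ j"
    using assms(2)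
    by (simp add: matrix_vector_right_distrib matrix_vector_mult_scaleR inner_add_left inner_add_right
        inner_axis_matrix_axis algebra_simps)
  also have "\<dots> = - 1"
  proof -
    have "2 * t * A $ i $ j = - (A $ j $ j + 1)" using ne by (simp add: t_def field_simps)
    then show ?thesis by simp
  qed
  finally show False using A unfolding positive_semidefinite_def by (metis neg_0_le_iff_le not_one_le_zero)
qed

text \<open>Symmetric Gaussian elimination: subtracting \<open>a a^T / A_ii\<close> clears row and
  column \<open>i\<close> and preserves semidefiniteness, so the number of nonzero diagonal entries
  drops. The rank one terms do the work of an eigenbasis in the later trace and maximum
  arguments.\<close>

lemma positive_semidefinite_decomposition:
  fixes A :: "real^'n::finite^'n"
  assumes "positive_semidefinite A"
  shows "\<exists>(m::nat) w. \<forall>i j. A $ i $ j = (\<Sum>k<m. w k $ i * (w k :: real^'n) $ j)"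
  using assms
proof (induction "card {i. A $ i $ i \<noteq> 0}" arbitrary: A rule: less_induct)
  case less
  note A = less.prems
  show ?case
  proof (cases "\<exists>i. A $ i $ i \<noteq> 0")
    case False
    then show ?thesis
      using positive_semidefinite_zero_diag[OF A] by (intro exI[of _ 0]) auto
  next
    case True
    then obtain i where i: "A $ i $ i \<noteq> 0" by blast
    have sym: "A $ j $ k = A $ k $ j" for j k
      using A by (auto simp: positive_semidefinite_def intro: symmetric_matrix_nth)
    have pos: "A $ i $ i > 0"
      using A i inner_axis_matrix_axis[of i A i] unfolding positive_semidefinite_def
      by (metis order_less_le)
    define a where "a = A *v axis i 1"
    have a: "a $ j = A $ j $ i" for j by (simp add: a_def matrix_vector_mult_basis column_def)
    define A' where "A' = (\<chi> j k. A $ j $ k - a $ j * a $ k / A $ i $ i)"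
    have form: "v \<bullet> (A' *v v) = v \<bullet> (A *v v) - (a \<bullet> v)\<^sup>2 / A $ i $ i" for v
    proof -
      have "A' *v v = A *v v - ((a \<bullet> v) / A $ i $ i) *\<^sub>R a"
        by (simp add: A'_def vec_eq_iff matrix_vector_mult_def inner_vec_def left_diff_distrib right_diff_distrib
            sum_subtractf sum_distrib_right sum_distrib_left sum_divide_distrib mult_ac)
      then show ?thesis by (simp add: inner_diff_right power2_eq_square inner_commute)
    qed
    have "positive_semidefinite A'"
      unfolding positive_semidefinite_def
    proof (intro conjI allI)
      show "transpose A' = A'"
        using sym by (simp add: A'_def transpose_def vec_eq_iff mult.commute)
      fix v
      \<comment> \<open>The parameter minimising the form of \<open>A\<close> along
        \<open>v - s e_i\<close>; the minimum is the form of \<open>A'\<close> at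
        \<open>v\<close>.\<close>
      define s where "s = (a \<bullet> v) / A $ i $ i"
      have eq: "v \<bullet> (A *v axis i 1) = a \<bullet> v" "axis i 1 \<bullet> (A *v v) = a \<bullet> v" "axis i 1 \<bullet> (A *v axis i 1) = A $ i $ i"
        using A inner_matrix_symmetric[of A "axis i 1" v]
        by (auto simp: a_def inner_commute inner_axis_matrix_axis positive_semidefinite_def)
      have "0 \<le> (v - s *\<^sub>R axis i 1) \<bullet> (A *v (v - s *\<^sub>R axis i 1))"
        using A unfolding positive_semidefinite_def by blast
      also have "\<dots> = v \<bullet> (A *v v) - 2 * s * (a \<bullet> v) + s * s * A $ i $ i"
        by (simp add: matrix_vector_mult_diff_distrib matrix_vector_mult_scaleR inner_diff_left
            inner_diff_right eq algebra_simps)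
      also have "\<dots> = v \<bullet> (A' *v v)"
        using i by (simp add: form s_def power2_eq_square field_simps)
      finally show "0 \<le> v \<bullet> (A' *v v)" .
    qed
    \<comment> \<open>Index \<open>i\<close> leaves the set and none enters: a zero diagonal entry
      forces its whole row to vanish, so nothing is subtracted there.\<close>
    moreover have "card {j. A' $ j $ j \<noteq> 0} < card {j. A $ j $ j \<noteq> 0}"
    proof (rule psubset_card_mono)
      have "A' $ i $ i = 0" using i by (simp add: A'_def a)
      moreover have "A' $ j $ j = 0" if "A $ j $ j = 0" for j
        using that positive_semidefinite_zero_diag[OF A that, of i] by (simp add: A'_def a)
      ultimately show "{j. A' $ j $ j \<noteq> 0} \<subset> {j. A $ j $ j \<noteq> 0}"
        using i by blast
    qed simp
    ultimately have "\<exists>(m::nat) w. \<forall>j k. A' $ j $ k = (\<Sum>l<m. w l $ j * (w l :: real^'n) $ k)"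
      by (intro less.hyps)
    then obtain m :: nat and w where w: "\<forall>j k. A' $ j $ k = (\<Sum>l<m. w l $ j * (w l :: real^'n) $ k)"
      by (elim exE)
    define w' where "w' = w(m := (1 / sqrt (A $ i $ i)) *\<^sub>R a)"
    have "A $ j $ k = (\<Sum>l<Suc m. w' l $ j * w' l $ k)" for j k
    proof -
      have "(\<Sum>l<Suc m. w' l $ j * w' l $ k) = A' $ j $ k + a $ j * a $ k / A $ i $ i"
        using pos by (simp add: w'_def w)
      then show ?thesis by (simp add: A'_def)
    qed
    then show ?thesis by blast
  qed
qed

text \<open>With \<open>A\<close> a sum of terms \<open>w w^T\<close>, the trace is the sum of the
  values of the form of \<open>B\<close> at the vectors \<open>w\<close>.\<close>

lemma trace_mult_nonneg:
  fixes A B :: "real^'n::finite^'n"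
  assumes A: "positive_semidefinite A" and B: "\<And>v. 0 \<le> v \<bullet> (B *v v)"
  shows "0 \<le> trace (A ** B)"
proof -
  obtain m and w :: "nat \<Rightarrow> real^'n" where w: "\<And>i j. A $ i $ j = (\<Sum>k<m. w k $ i * w k $ j)"
    using positive_semidefinite_decomposition[OF A] by blast
  have "trace (A ** B) = (\<Sum>i\<in>UNIV. \<Sum>j\<in>UNIV. \<Sum>k<m. w k $ i * w k $ j * B $ j $ i)"
    by (simp add: trace_def matrix_matrix_mult_def w sum_distrib_right)
  also have "\<dots> = (\<Sum>k<m. \<Sum>j\<in>UNIV. \<Sum>i\<in>UNIV. w k $ i * w k $ j * B $ j $ i)"
    by (subst sum.swap, subst (2) sum.swap, rule sum.swap)
  also have "\<dots> = (\<Sum>k<m. w k \<bullet> (B *v w k))"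
    by (simp add: inner_vec_def matrix_vector_mult_def sum_distrib_left mult_ac)
  finally show ?thesis using B by (simp add: sum_nonneg)
qed

text \<open>For \<open>Q\<close> the inverse metric and \<open>K\<close> a Hessian,
  \<open>Q ** K\<close> is the Hessian endomorphism, self-adjoint although its matrix is in general
  not symmetric. Regrouped, the trace pairs \<open>Q\<close> with \<open>K ** Q ** K\<close>, whose
  form at \<open>v\<close> is that of \<open>Q\<close> at \<open>K v\<close>.\<close>

lemma trace_square_nonneg:
  fixes Q K :: "real^'n::finite^'n"
  assumes Q: "positive_semidefinite Q" and K: "transpose K = K"
  shows "0 \<le> trace ((Q ** K) ** (Q ** K))"
proof -
  have "0 \<le> v \<bullet> ((K ** Q ** K) *v v)" for v
    using Q inner_matrix_symmetric[OF K, of v "Q *v (K *v v)"]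
    by (simp add: positive_semidefinite_def flip: matrix_vector_mul_assoc)
  then show ?thesis
    using trace_mult_nonneg[OF Q, of "K ** Q ** K"] by (simp add: matrix_mul_assoc)
qed

lemma positive_semidefinite_matrix_inv:
  fixes G :: "real^'n::finite^'n"
  assumes sym: "transpose G = G" and pos: "\<And>v. v \<noteq> 0 \<Longrightarrow> 0 < v \<bullet> (G *v v)"
  shows "invertible G" "transpose (matrix_inv G) = matrix_inv G"
    "\<And>v. v \<noteq> 0 \<Longrightarrow> 0 < v \<bullet> (matrix_inv G *v v)" "positive_semidefinite (matrix_inv G)"
proof -
  have "\<forall>x. G *v x = 0 \<longrightarrow> x = 0" using pos by fastforce
  then have "\<exists>B. B ** G = mat 1" by (simp add: matrix_left_invertible_ker)
  then show inv: "invertible G" by (simp add: invertible_left_inverse)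
  note Q = matrix_inv_inverse[OF inv]
  have "transpose (matrix_inv G) ** G = mat 1"
    using Q(1) sym by (metis matrix_transpose_mul transpose_mat)
  then show sym': "transpose (matrix_inv G) = matrix_inv G"
    using Q by (metis matrix_mul_assoc matrix_mul_lid matrix_mul_rid)
  show pos': "0 < v \<bullet> (matrix_inv G *v v)" if "v \<noteq> 0" for v
  proof -
    \<comment> \<open>The form of the inverse at \<open>v\<close> is the form of \<open>G\<close> at
      \<open>u\<close>.\<close>
    define u where "u = matrix_inv G *v v"
    have v: "v = G *v u" using Q by (simp add: u_def matrix_vector_mul_assoc)
    then have "u \<noteq> 0" using that by auto
    then show ?thesis using pos[of u] unfolding u_def[symmetric] by (subst v) (simp add: inner_commute)
  qed
  show "positive_semidefinite (matrix_inv G)"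
    unfolding positive_semidefinite_def using sym' pos'
    by (metis inner_zero_left order_less_imp_le order_refl)
qed

section \<open>Invariants of an endomorphism as coefficients of a determinant\<close>

definition characteristic_det :: "real^'n::finite^'n \<Rightarrow> real poly" where
  "characteristic_det H = det (\<chi> i j. [:if i = j then 1 else 0, H $ i $ j:])"

lemma matrix_invariant_eq_coeff: "matrix_invariant m H = coeff (characteristic_det H) m"
  by (simp add: matrix_invariant_def characteristic_det_def)

lemma poly_characteristic_det: "poly (characteristic_det H) \<alpha> = det (mat 1 + \<alpha> *\<^sub>R H)"
proof -
  have "poly [:if i = j then 1 else 0, H $ i $ j:] \<alpha> = (mat 1 + \<alpha> *\<^sub>R H) $ i $ j" for i j
    by (simp add: mat_def)
  then show ?thesis
    unfolding characteristic_det_def det_def by (simp add: poly_sum poly_prod)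
qed

text \<open>The polynomials are compared by their values: at each real \<alpha> the matrix
  \<open>1 + \<alpha> H\<close> is conjugated, which preserves its determinant. This is what makes
  \<open>S_inv\<close> independent of the chart.\<close>

lemma matrix_invariant_similar:
  fixes H P P' :: "real^'n::finite^'n"
  assumes P: "P' ** P = mat 1"
  shows "matrix_invariant m (P' ** H ** P) = matrix_invariant m H"
proof -
  have "poly (characteristic_det (P' ** H ** P)) \<alpha> = poly (characteristic_det H) \<alpha>" for \<alpha>
  proof -
    have "mat 1 + \<alpha> *\<^sub>R (P' ** H ** P) = P' ** (mat 1 + \<alpha> *\<^sub>R H) ** P"
      using P by (simp add: matrix_add_ldistrib matrix_add_rdistrib matrix_scalar_ac scalar_matrix_assoc)
    moreover have "det P' * det P = 1"
      using P by (metis det_I det_mul)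
    ultimately show ?thesis
      by (simp add: poly_characteristic_det det_mul mult.assoc mult.left_commute[of "det P'"])
  qed
  then have "characteristic_det (P' ** H ** P) = characteristic_det H"
    by (intro poly_eq_poly_eq_iff[THEN iffD1] ext)
  then show ?thesis by (simp add: matrix_invariant_eq_coeff)
qed

lemma coeff_prod_one_plus:
  fixes a :: "'i \<Rightarrow> real"
  assumes "finite I"
  shows "coeff (\<Prod>i\<in>I. [:1, a i:]) 0 = 1 \<and> coeff (\<Prod>i\<in>I. [:1, a i:]) (Suc 0) = (\<Sum>i\<in>I. a i)"
  using assms by (induction I rule: finite_induct) (auto simp: coeff_pCons)

lemma matrix_invariant_0: "matrix_invariant 0 H = 1"
  using poly_characteristic_det[of H 0]
  by (simp add: matrix_invariant_eq_coeff poly_0_coeff_0)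

text \<open>A permutation other than the identity moves at least two indices, and each moved index
  contributes a factor without constant term. So only the diagonal product reaches degree
  one.\<close>

lemma matrix_invariant_1:
  fixes H :: "real^'n::finite^'n"
  shows "matrix_invariant 1 H = trace H"
proof -
  let ?P = "\<lambda>i j. [:if i = j then 1 else 0, H $ i $ j:]"
  have other: "coeff (of_int (sign p) * (\<Prod>i\<in>UNIV. ?P i (p i))) 1 = 0"
    if p: "p permutes UNIV" "p \<noteq> id" for p
  proof -
    obtain i where i: "p i \<noteq> i" using p(2) by (auto simp: fun_eq_iff)
    define j where "j = p i"
    \<comment> \<open>The image of a moved index is moved as well, by injectivity.\<close>
    have j: "p j \<noteq> j" "j \<noteq> i" using i p(1) by (auto simp: j_def) (metis permutes_inj injD)
    have "(\<Prod>i\<in>UNIV. ?P i (p i)) = ?P i (p i) * (?P j (p j) * (\<Prod>i\<in>UNIV - {i} - {j}. ?P i (p i)))"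
      using j by (subst prod.remove[of _ i], simp, simp, subst prod.remove[of _ j]) auto
    also have "\<dots> = pCons 0 (pCons 0 (smult (H $ i $ p i * H $ j $ p j) (\<Prod>i\<in>UNIV - {i} - {j}. ?P i (p i))))"
      using i j by (simp add: mult.commute)
    finally have "(\<Prod>i\<in>UNIV. ?P i (p i)) = \<dots>" .
    moreover have "(of_int (sign p) :: real poly) = [:of_int (sign p):]" by (simp add: of_int_poly)
    ultimately show ?thesis by simp
  qed
  have "coeff (characteristic_det H) 1
      = (\<Sum>p\<in>{p. p permutes UNIV}. coeff (of_int (sign p) * (\<Prod>i\<in>UNIV. ?P i (p i))) 1)"
    by (simp add: characteristic_det_def det_def coeff_sum)
  also have "\<dots> = (\<Sum>p\<in>{id}. coeff (of_int (sign p) * (\<Prod>i\<in>UNIV. ?P i (p i))) 1)"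
    using other by (intro sum.mono_neutral_right) (auto simp: finite_permutations permutes_id)
  also have "\<dots> = trace H"
    using coeff_prod_one_plus[of UNIV "\<lambda>i. H $ i $ i"] by (simp add: trace_def sign_id)
  finally show ?thesis by (simp add: matrix_invariant_eq_coeff)
qed

text \<open>The coefficient of \<open>\<alpha>\<^sup>2\<close> in \<open>det (1 + \<alpha> H) det (1 - \<alpha> H) = det (1 - \<alpha>\<^sup>2 H\<^sup>2)\<close>.\<close>

lemma matrix_invariant_2:
  fixes H :: "real^'n::finite^'n"
  shows "2 * matrix_invariant 2 H = (trace H)\<^sup>2 - trace (H ** H)"
proof -
  let ?p = "characteristic_det H" and ?q = "characteristic_det (- (H ** H))"
  have "?p * pcompose ?p [:0, -1:] = pcompose ?q [:0, 0, 1:]"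
  proof -
    have "poly (?p * pcompose ?p [:0, -1:]) \<alpha> = poly (pcompose ?q [:0, 0, 1:]) \<alpha>" for \<alpha>
    proof -
      have "(mat 1 + \<alpha> *\<^sub>R H) ** (mat 1 + (- \<alpha>) *\<^sub>R H) = mat 1 + (\<alpha> * \<alpha>) *\<^sub>R (- (H ** H))"
        by (simp add: matrix_add_ldistrib matrix_add_rdistrib matrix_minus_left matrix_diff_ldistrib matrix_minus_right
            matrix_scalar_ac scaleR_add_right flip: scalar_matrix_assoc)
      then have "det (mat 1 + \<alpha> *\<^sub>R H) * det (mat 1 + (- \<alpha>) *\<^sub>R H) = det (mat 1 + (\<alpha> * \<alpha>) *\<^sub>R (- (H ** H)))"
        by (metis det_mul)
      then show ?thesis
        by (simp only: poly_mult poly_pcompose poly_characteristic_det) (simp add: mult_ac)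
    qed
    then show ?thesis by (intro poly_eq_poly_eq_iff[THEN iffD1] ext)
  qed
  then have "coeff (?p * pcompose ?p [:0, -1:]) 2 = coeff (pcompose ?q [:0, 0, 1:]) 2" by simp
  moreover obtain a b c r where p: "?p = pCons a (pCons b (pCons c r))" by (metis pCons_cases)
  moreover obtain a' b' r' where q: "?q = pCons a' (pCons b' r')" by (metis pCons_cases)
  ultimately have "2 * a * c - b * b = b'"
    by (simp add: pcompose_pCons numeral_2_eq_2 coeff_mult coeff_pCons algebra_simps)
  moreover have "a = 1" "b = trace H" "c = matrix_invariant 2 H"
    using matrix_invariant_0[of H] matrix_invariant_1[of H]
    by (auto simp: matrix_invariant_eq_coeff p numeral_2_eq_2)
  moreover have "b' = - trace (H ** H)"
    using matrix_invariant_1[of "- (H ** H)"]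
    by (simp add: matrix_invariant_eq_coeff q trace_def sum_negf)
  ultimately show ?thesis by (simp add: power2_eq_square)
qed

section \<open>The strong maximum principle\<close>

text \<open>There is no zeroth order term, so constants are annihilated: the maximal value may have
  any sign, and a barrier may be shifted by a constant.\<close>

definition elliptic_op ::
  "(real^'n \<Rightarrow> real^'n^'n) \<Rightarrow> (real^'n \<Rightarrow> real^'n) \<Rightarrow> (real^'n::finite \<Rightarrow> real) \<Rightarrow> real^'n \<Rightarrow> real" where
  "elliptic_op a b u x = (\<Sum>i\<in>UNIV. \<Sum>j\<in>UNIV. a x $ i $ j * partial_deriv i (partial_deriv j u) x)
     + (\<Sum>i\<in>UNIV. b x $ i * partial_deriv i u x)"

text \<open>Decomposing \<open>a x\<close> into rank one terms turns the second order part into a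
  sum of second directional derivatives, each nonpositive at a maximum; the first order part
  vanishes with the gradient.\<close>

lemma elliptic_op_nonpos_at_max:
  fixes u :: "real^'n::finite \<Rightarrow> real"
  assumes U: "open U" "x \<in> U" and u: "smooth_on U u" and max: "\<And>y. y \<in> U \<Longrightarrow> u y \<le> u x"
    and a: "positive_semidefinite (a x)"
  shows "elliptic_op a b u x \<le> 0"
proof -
  obtain r where r: "r > 0" "ball x r \<subseteq> U" using U open_contains_ball by metis
  have line: "\<exists>d>0. \<forall>s. \<bar>s\<bar> < d \<longrightarrow> x + s *\<^sub>R w \<in> U" for w
  proof (intro exI conjI allI impI)
    show "r / (norm w + 1) > 0" using r by (simp add: add_nonneg_pos)
    fix s assume "\<bar>s\<bar> < r / (norm w + 1)"
    then have "\<bar>s\<bar> * (norm w + 1) < r" by (simp add: pos_less_divide_eq add_nonneg_pos)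
    moreover have "\<bar>s\<bar> * norm w \<le> \<bar>s\<bar> * (norm w + 1)" by (simp add: mult_left_mono)
    ultimately have "norm (s *\<^sub>R w) < r" by simp
    then show "x + s *\<^sub>R w \<in> U" using r(2) by (auto simp: subset_iff dist_norm)
  qed
  have first: "(\<Sum>i\<in>UNIV. w $ i * partial_deriv i u x) = 0" for w
  proof -
    obtain d where d: "d > 0" "\<And>s. \<bar>s\<bar> < d \<Longrightarrow> x + s *\<^sub>R w \<in> U" using line by blast
    have "((\<lambda>s. u (x + s *\<^sub>R w)) has_real_derivative (\<Sum>i\<in>UNIV. w $ i * partial_deriv i u x)) (at 0)"
      using has_real_derivative_along_line[of u x 0 w] smooth_on_differentiable[OF u U(2)] by simp
    then show ?thesis
      by (rule DERIV_local_max[OF _ d(1)]) (use max d in \<open>auto simp: abs_minus_commute\<close>)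
  qed
  have second: "(\<Sum>i\<in>UNIV. \<Sum>j\<in>UNIV. w $ i * w $ j * partial_deriv i (partial_deriv j u) x) \<le> 0" (is "?S \<le> 0") for w
  proof (rule ccontr)
    assume pos: "\<not> ?thesis"
    obtain d where d: "d > 0" "\<And>s. \<bar>s\<bar> < d \<Longrightarrow> x + s *\<^sub>R w \<in> U" using line by blast
    \<comment> \<open>The derivative of \<open>u\<close> along the line, which is zero at the start.
      A positive slope there would make it positive just afterwards, and \<open>u\<close> would
      exceed its maximum.\<close>
    define \<psi> where "\<psi> s = (\<Sum>j\<in>UNIV. w $ j * partial_deriv j u (x + s *\<^sub>R w))" for s
    have "(\<psi> has_real_derivative (\<Sum>j\<in>UNIV. w $ j * (\<Sum>i\<in>UNIV. w $ i * partial_deriv i (partial_deriv j u) (x + 0 *\<^sub>R w)))) (at 0)"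
      unfolding \<psi>_def
      by (intro DERIV_sum DERIV_cmult has_real_derivative_along_line)
        (simp add: smooth_on_differentiable[OF smooth_on_partial_deriv[OF u] U(2)])
    also have "(\<Sum>j\<in>UNIV. w $ j * (\<Sum>i\<in>UNIV. w $ i * partial_deriv i (partial_deriv j u) (x + 0 *\<^sub>R w))) = ?S"
      by (subst sum.swap) (simp add: sum_distrib_left mult_ac)
    finally obtain e where e: "e > 0" "\<And>h. 0 < h \<Longrightarrow> h < e \<Longrightarrow> \<psi> 0 < \<psi> (0 + h)"
      using DERIV_pos_inc_right[of \<psi> ?S 0] pos by (meson not_le)
    define h where "h = min d e / 2"
    have h: "0 < h" "h < d" "h < e" using d e by (auto simp: h_def)
    have "\<exists>z>0. z < h \<and> u (x + h *\<^sub>R w) - u (x + 0 *\<^sub>R w) = (h - 0) * \<psi> z"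
      unfolding \<psi>_def using h d(2)
      by (intro MVT2 has_real_derivative_along_line smooth_on_differentiable[OF u]) auto
    then obtain z where z: "0 < z" "z < h" "u (x + h *\<^sub>R w) - u x = h * \<psi> z" by auto
    have "\<psi> z > 0" using e(2)[of z] z h first[of w] by (simp add: \<psi>_def)
    then have "u (x + h *\<^sub>R w) > u x" using z h by (metis diff_gt_0_iff_gt mult_pos_pos)
    moreover have "x + h *\<^sub>R w \<in> U" using d(2) h by simp
    ultimately show False using max by fastforce
  qed
  have grad: "partial_deriv i u x = 0" for i
    using first[of "axis i 1"] by (simp add: axis_def if_distrib[where f="\<lambda>t. t * _"] cong: if_cong)
  obtain m :: nat and w :: "nat \<Rightarrow> real^'n" where w: "\<And>i j. a x $ i $ j = (\<Sum>k<m. w k $ i * w k $ j)"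
    using positive_semidefinite_decomposition[OF a] by blast
  have "elliptic_op a b u x = (\<Sum>i\<in>UNIV. \<Sum>j\<in>UNIV. \<Sum>k<m. w k $ i * w k $ j * partial_deriv i (partial_deriv j u) x)"
    by (simp add: elliptic_op_def grad w sum_distrib_right)
  also have "\<dots> = (\<Sum>k<m. \<Sum>i\<in>UNIV. \<Sum>j\<in>UNIV. w k $ i * w k $ j * partial_deriv i (partial_deriv j u) x)"
    by (rule trans[OF sum.cong[OF refl sum.swap] sum.swap])
  also have "\<dots> \<le> 0" by (intro sum_nonpos second)
  finally show ?thesis .
qed

lemma partial_deriv_norm_square:
  "partial_deriv i (\<lambda>x::real^'n::finite. (x - y) \<bullet> (x - y)) x = 2 * (x $ i - y $ i)"
proof -
  have "((\<lambda>x. (x - y) \<bullet> (x - y)) has_derivative (\<lambda>v. (x - y) \<bullet> v + v \<bullet> (x - y))) (at x)"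
    by (auto intro!: derivative_eq_intros)
  from partial_deriv_eqI[OF this] show ?thesis
    by (simp add: inner_axis inner_axis')
qed

lemma smooth_on_norm_square: "open U \<Longrightarrow> smooth_on U (\<lambda>x::real^'n::finite. (x - y) \<bullet> (x - y))"
  unfolding inner_vec_def inner_real_def vector_minus_component
  by (intro smooth_on_sum smooth_on_mult smooth_on_diff smooth_on_nth smooth_on_const)

text \<open>The leading term in \<alpha> carries the form of \<open>a\<close> at
  \<open>x - y\<close>, positive away from \<open>y\<close> when \<open>a\<close> is positive
  definite. For large \<alpha> it dominates the trace and the drift; this is the source of Hopf's
  barrier.\<close>

lemma elliptic_op_gaussian:
  fixes y :: "real^'n::finite" and \<alpha> :: real
  defines "v \<equiv> \<lambda>x. exp (- \<alpha> * ((x - y) \<bullet> (x - y)))"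
  shows "smooth_on U v"
    "elliptic_op a b v x = v x * (4 * \<alpha> * \<alpha> * ((x - y) \<bullet> (a x *v (x - y))) - 2 * \<alpha> * (trace (a x) + b x \<bullet> (x - y)))"
proof -
  have smq: "smooth_on UNIV (\<lambda>x. - \<alpha> * ((x - y) \<bullet> (x - y)))"
    by (intro smooth_on_mult smooth_on_const smooth_on_norm_square) auto
  then have sm: "smooth_on UNIV v" unfolding v_def by (intro smooth_on_exp) auto
  then show "smooth_on U v" by (rule smooth_on_subset) simp
  have d1: "partial_deriv j v = (\<lambda>x. - 2 * \<alpha> * ((x $ j - y $ j) * v x))" for j
  proof
    fix x
    have "partial_deriv j v x = - \<alpha> * (2 * (x $ j - y $ j)) * v x"
      unfolding v_def
      by (subst partial_deriv_exp, rule smooth_on_differentiable[OF smq], simp, subst partial_deriv_cmult,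
          rule smooth_on_differentiable[OF smooth_on_norm_square[OF open_UNIV]], simp)
         (simp add: partial_deriv_norm_square)
    then show "partial_deriv j v x = - 2 * \<alpha> * ((x $ j - y $ j) * v x)" by simp
  qed
  have lin: "smooth_on UNIV (\<lambda>x::real^'n. x $ j - y $ j)" for j
    by (intro smooth_on_diff smooth_on_nth smooth_on_const) auto
  have d0: "partial_deriv i (\<lambda>x. x $ j - y $ j) x = (if i = j then 1 else 0)" for i j and x :: "real^'n"
    using smooth_on_differentiable[OF smooth_on_nth[of UNIV j], of x]
    by (subst partial_deriv_diff) (auto simp: partial_deriv_nth)
  have d2: "partial_deriv i (partial_deriv j v) x
      = - 2 * \<alpha> * ((x $ j - y $ j) * (- 2 * \<alpha> * ((x $ i - y $ i) * v x)) + (if i = j then 1 else 0) * v x)" for i j x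
  proof -
    note diff = smooth_on_differentiable[OF lin[of j] UNIV_I, of x] smooth_on_differentiable[OF sm UNIV_I, of x]
    have "partial_deriv i (\<lambda>x. (x $ j - y $ j) * v x) x
        = (x $ j - y $ j) * partial_deriv i v x + (if i = j then 1 else 0) * v x"
      using diff by (simp only: partial_deriv_mult d0 UNIV_I)
    then show ?thesis
      unfolding d1[of j] using diff
      by (subst partial_deriv_cmult) (auto simp only: d1[of i] intro: differentiable_mult)
  qed
  have "elliptic_op a b v x = (\<Sum>i\<in>UNIV. \<Sum>j\<in>UNIV. v x * (4 * \<alpha> * \<alpha> * ((x - y) $ i * (a x $ i $ j * (x - y) $ j))))
     - (\<Sum>i\<in>UNIV. \<Sum>j\<in>UNIV. v x * (2 * \<alpha> * (if i = j then a x $ i $ i else 0)))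
     - (\<Sum>i\<in>UNIV. v x * (2 * \<alpha> * (b x $ i * (x - y) $ i)))"
    unfolding elliptic_op_def d2 unfolding d1 sum_subtractf[symmetric]
    by (simp add: sum_subtractf[symmetric] sum.distrib[symmetric] algebra_simps cong: if_cong)
       (auto intro!: sum.cong simp: sum_subtractf[symmetric] sum.distrib[symmetric] algebra_simps)
  also have "\<dots> = v x * (4 * \<alpha> * \<alpha> * ((x - y) \<bullet> (a x *v (x - y))) - 2 * \<alpha> * (trace (a x) + b x \<bullet> (x - y)))"
    by (simp add: inner_vec_def matrix_vector_mult_def trace_def sum_distrib_left sum_distrib_right algebra_simps sum_subtractf sum.distrib
        if_distrib[where f="\<lambda>t. _ * t"] cong: if_cong)
  finally show "elliptic_op a b v x = \<dots>" .
qed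

lemma elliptic_op_add_cmult:
  assumes "smooth_on U u" "smooth_on U v" "open U" "x \<in> U"
  shows "elliptic_op a b (\<lambda>x. u x + c * (v x - e)) x = elliptic_op a b u x + c * elliptic_op a b v x"
proof -
  have d: "partial_deriv j (\<lambda>x. u x + c * (v x - e)) z = partial_deriv j u z + c * partial_deriv j v z" if "z \<in> U" for z j
    using assms that smooth_on_differentiable[of U _ z] smooth_on_diff[OF assms(3,2) smooth_on_const[of U e]]
      smooth_on_mult[OF assms(3) smooth_on_const[of U c] smooth_on_diff[OF assms(3,2) smooth_on_const[of U e]]]
    by (simp add: partial_deriv_add partial_deriv_cmult partial_deriv_diff)
  have d2: "partial_deriv i (partial_deriv j (\<lambda>x. u x + c * (v x - e))) x
      = partial_deriv i (partial_deriv j u) x + c * partial_deriv i (partial_deriv j v) x" for i j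
  proof -
    have d2: "partial_deriv i (partial_deriv j (\<lambda>x. u x + c * (v x - e))) x
       = partial_deriv i (\<lambda>z. partial_deriv j u z + c * partial_deriv j v z) x"
      by (rule partial_deriv_cong[OF assms(3,4) d])
    then show ?thesis
      using assms smooth_on_differentiable[of U _ x] smooth_on_partial_deriv[of U _ j]
        smooth_on_mult[OF assms(3) smooth_on_const[of U c] smooth_on_partial_deriv[OF assms(2)]]
      by (simp add: partial_deriv_add partial_deriv_cmult)
  qed
  show ?thesis
    unfolding elliptic_op_def d2 d[OF assms(4)]
    by (simp add: sum.distrib sum_distrib_left algebra_simps)
qed

text \<open>The barrier \<open>exp (- \<alpha> |x - y|\<^sup>2) - exp (- \<alpha> \<rho>\<^sup>2)\<close> is strictly subharmonic near \<open>z\<close> for large \<open>\<alpha>\<close>; a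
  small multiple of it moves the maximum of \<open>u\<close> over a ball around \<open>z\<close> into the interior.\<close>

lemma hopf_no_interior_touching:
  fixes u :: "real^'n::finite \<Rightarrow> real"
  assumes U: "open U" and u: "smooth_on U u"
    and a: "\<And>x. x \<in> U \<Longrightarrow> positive_semidefinite (a x)" "\<And>x v. x \<in> U \<Longrightarrow> v \<noteq> 0 \<Longrightarrow> 0 < v \<bullet> (a x *v v)"
    and conta: "\<And>i j. continuous_on U (\<lambda>x. a x $ i $ j)"
    and contb: "\<And>i. continuous_on U (\<lambda>x. b x $ i)"
    and sub: "\<And>x. x \<in> U \<Longrightarrow> 0 \<le> elliptic_op a b u x"
    and le: "\<And>x. x \<in> U \<Longrightarrow> u x \<le> M"
    and z: "z \<in> U" "u z = M" "dist y z = \<rho>" "\<rho> > 0"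
    and ball: "cball y \<rho> \<subseteq> U" and less: "\<And>x. x \<in> cball y \<rho> \<Longrightarrow> x \<noteq> z \<Longrightarrow> u x < M"
  shows False
proof -
  obtain r0 where r0: "r0 > 0" "cball z r0 \<subseteq> U" using U z(1) open_contains_cball by metis
  \<comment> \<open>A radius of at most half of \<rho> keeps this ball away from the centre
    \<open>y\<close>, where the leading coefficient \<open>?F\<close> of the barrier
    vanishes.\<close>
  define r where "r = min r0 (\<rho> / 2)"
  have r: "r > 0" "cball z r \<subseteq> U" "r \<le> \<rho> / 2"
    using r0 z(4) by (auto simp: r_def subset_iff)
  have ne: "x \<noteq> y" if "x \<in> cball z r" for x
    using that z r by (auto simp: dist_commute)
  let ?F = "\<lambda>x. (x - y) \<bullet> (a x *v (x - y))" and ?H = "\<lambda>x. trace (a x) + b x \<bullet> (x - y)"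
  have conta': "continuous_on (cball z r) (\<lambda>x. a x $ i $ j)" and contb': "continuous_on (cball z r) (\<lambda>x. b x $ i)" for i j
    by (rule continuous_on_subset[OF conta r(2)] continuous_on_subset[OF contb r(2)])+
  have contF: "continuous_on (cball z r) ?F"
    unfolding inner_vec_def matrix_vector_mult_def
    by (simp only: vec_lambda_beta inner_real_def vector_minus_component)
      (intro continuous_intros conta')
  have contH: "continuous_on (cball z r) ?H"
    unfolding inner_vec_def trace_def
    by (simp only: inner_real_def vector_minus_component) (intro continuous_intros conta' contb')
  obtain x1 where x1: "x1 \<in> cball z r" "\<And>x. x \<in> cball z r \<Longrightarrow> ?F x1 \<le> ?F x"
    using continuous_attains_inf[OF compact_cball _ contF] r(1) by auto
  obtain x2 where x2: "x2 \<in> cball z r" "\<And>x. x \<in> cball z r \<Longrightarrow> ?H x \<le> ?H x2"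
    using continuous_attains_sup[OF compact_cball _ contH] r(1) by auto
  define \<mu> where "\<mu> = ?F x1"
  define K where "K = \<bar>?H x2\<bar>"
  \<comment> \<open>Makes \<open>\<alpha> * ?F x\<close> at least \<open>K + 1\<close> on the ball,
    hence \<open>2 * (\<alpha> * ?F x) - ?H x\<close> at least \<open>K + 2\<close>.\<close>
  define \<alpha> where "\<alpha> = (K + 1) / \<mu>"
  have \<mu>: "\<mu> > 0" using a(2)[of x1 "x1 - y"] x1(1) ne[of x1] r(2) by (auto simp: \<mu>_def)
  have \<alpha>: "\<alpha> > 0" "\<alpha> * \<mu> = K + 1" using \<mu> by (auto simp: \<alpha>_def K_def)
  define v where "v = (\<lambda>x. exp (- \<alpha> * ((x - y) \<bullet> (x - y))))"
  define e where "e = exp (- \<alpha> * (\<rho> * \<rho>))"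
  have smv: "smooth_on U v" unfolding v_def by (rule elliptic_op_gaussian)
  have Lv: "elliptic_op a b v x > 0" if x: "x \<in> cball z r" for x
  proof -
    have "4 * \<alpha> * \<alpha> * ?F x - 2 * \<alpha> * ?H x = 2 * \<alpha> * (2 * (\<alpha> * ?F x) - ?H x)"
      by (simp add: algebra_simps)
    moreover have "\<alpha> * \<mu> \<le> \<alpha> * ?F x" using x1(2)[OF x] \<alpha>(1) unfolding \<mu>_def by (intro mult_left_mono) auto
    moreover have "?H x \<le> K" using x2(2)[OF x] by (simp add: K_def)
    moreover have "K \<ge> 0" by (simp add: K_def)
    ultimately have "4 * \<alpha> * \<alpha> * ?F x - 2 * \<alpha> * ?H x > 0" using \<alpha> by simp
    then show ?thesis unfolding v_def elliptic_op_gaussian(2) by simp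
  qed
  have v_out: "v x - e < 0" if "x \<notin> cball y \<rho>" for x
  proof -
    have "\<rho> * \<rho> < norm (x - y) * norm (x - y)"
      using that z(4) by (intro mult_strict_mono) (auto simp: dist_norm norm_minus_commute)
    then show ?thesis using \<alpha> by (simp add: v_def e_def flip: power2_norm_eq_inner power2_eq_square)
  qed
  have v_z: "v z = e" using z(3)
    by (simp add: v_def e_def dist_norm norm_minus_commute flip: power2_norm_eq_inner power2_eq_square)
  have v1: "v x - e \<le> 1" for x
  proof -
    have "v x \<le> 1" using \<alpha> by (simp add: v_def)
    moreover have "e > 0" by (simp add: e_def)
    ultimately show ?thesis by simp
  qed
  \<comment> \<open>This part of the small sphere misses \<open>z\<close>, so by compactness
    \<open>u\<close> stays below \<open>M\<close> there with a uniform gap \<delta>. On the rest of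
    the sphere the barrier is negative.\<close>
  let ?K = "sphere z r \<inter> cball y \<rho>"
  obtain \<delta> where \<delta>: "\<delta> > 0" "\<And>x. x \<in> ?K \<Longrightarrow> u x \<le> M - \<delta>"
  proof (cases "?K = {}")
    case True
    then show ?thesis using that[of 1] by auto
  next
    case False
    have "compact ?K" by (intro compact_Int compact_cball compact_sphere)
    moreover have "continuous_on ?K u"
      using ball by (intro continuous_on_subset[OF smooth_on_continuous_on[OF u]]) auto
    ultimately obtain x3 where x3: "x3 \<in> ?K" "\<And>x. x \<in> ?K \<Longrightarrow> u x \<le> u x3"
      using continuous_attains_sup False by metis
    have "u x3 < M" using x3(1) r(1) by (intro less) auto
    then show ?thesis using that[of "M - u x3"] x3(2) by auto
  qed
  \<comment> \<open>The barrier is at most 1, so half of \<delta> cannot close the gap, while at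
    \<open>z\<close> it vanishes and \<open>?W\<close> equals \<open>M\<close>. The maximum over the
    closed ball is therefore interior, where the positive value of the operator is absurd.\<close>
  let ?W = "\<lambda>x. u x + (\<delta>/2) * (v x - e)"
  have smW: "smooth_on U ?W"
    by (intro smooth_on_add smooth_on_mult smooth_on_diff smooth_on_const U u smv)
  obtain p where p: "p \<in> cball z r" "\<And>x. x \<in> cball z r \<Longrightarrow> ?W x \<le> ?W p"
    using continuous_attains_sup[OF compact_cball[of z r] _ continuous_on_subset[OF smooth_on_continuous_on[OF smW] r(2)]] r(1)
    by auto
  have pM: "?W p \<ge> M" using p(2)[of z] r(1) v_z z(2) by simp
  have "p \<notin> sphere z r"
  proof
    assume ps: "p \<in> sphere z r"
    show False
    proof (cases "p \<in> cball y \<rho>")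
      case True
      then have "u p \<le> M - \<delta>" using ps \<delta>(2) by auto
      moreover have "(\<delta>/2) * (v p - e) \<le> (\<delta>/2) * 1" using v1[of p] \<delta>(1) by (intro mult_left_mono) auto
      ultimately show False using pM \<delta>(1) by simp
    next
      case False
      then have "(\<delta>/2) * (v p - e) < 0" using v_out \<delta>(1) by (simp add: mult_pos_neg)
      moreover have "u p \<le> M" using p(1) r(2) le by auto
      ultimately show False using pM by simp
    qed
  qed
  then have pb: "p \<in> ball z r" using p(1) by auto
  have pU: "p \<in> U" using p(1) r(2) by auto
  have "elliptic_op a b ?W p \<le> 0"
    using pb p(2) r(2) a(1)[OF pU] by (intro elliptic_op_nonpos_at_max[of "ball z r"] smooth_on_subset[OF smW]) auto
  moreover have "elliptic_op a b ?W p = elliptic_op a b u p + (\<delta>/2) * elliptic_op a b v p"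
    using pU by (intro elliptic_op_add_cmult[OF u smv U])
  ultimately show False using sub[OF pU] Lv[OF p(1)] \<delta>(1) by (smt (verit) half_gt_zero mult_pos_pos)
qed

text \<open>Stated as openness of the contact set, so that connectedness can be used on the manifold
  rather than in a chart. If openness failed at \<open>p\<close>, a ball grown around a nearby point
  outside the set until it touches the set would contradict
  \<open>hopf_no_interior_touching\<close>.\<close>

lemma strong_maximum_principle_local:
  fixes u :: "real^'n::finite \<Rightarrow> real"
  assumes U: "open U" and u: "smooth_on U u"
    and a: "\<And>x. x \<in> U \<Longrightarrow> positive_semidefinite (a x)" "\<And>x v. x \<in> U \<Longrightarrow> v \<noteq> 0 \<Longrightarrow> 0 < v \<bullet> (a x *v v)"
    and conta: "\<And>i j. continuous_on U (\<lambda>x. a x $ i $ j)"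
    and contb: "\<And>i. continuous_on U (\<lambda>x. b x $ i)"
    and sub: "\<And>x. x \<in> U \<Longrightarrow> 0 \<le> elliptic_op a b u x"
    and le: "\<And>x. x \<in> U \<Longrightarrow> u x \<le> M"
  shows "open {x\<in>U. u x = M}"
  unfolding open_contains_ball
proof (rule ccontr)
  assume "\<not> (\<forall>x\<in>{x \<in> U. u x = M}. \<exists>e>0. ball x e \<subseteq> {x \<in> U. u x = M})"
  then obtain p where p: "p \<in> U" "u p = M" "\<And>e. e > 0 \<Longrightarrow> \<not> ball p e \<subseteq> {x \<in> U. u x = M}" by auto
  obtain R0 where R0: "R0 > 0" "cball p R0 \<subseteq> U" using U p(1) open_contains_cball by metis
  \<comment> \<open>A ball centred within \<open>R\<close> of \<open>p\<close> and touching the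
    contact set has radius below \<open>R\<close>, so it lies in the ball of radius
    \<open>2 * R\<close> around \<open>p\<close>.\<close>
  define R where "R = R0 / 2"
  have R: "R > 0" "cball p (2 * R) \<subseteq> U" using R0 by (auto simp: R_def)
  obtain y0 where y0: "dist p y0 < R" "u y0 \<noteq> M"
    using p(3)[OF R(1)] R(2) R(1) by (auto simp: subset_iff)
  define C where "C = {x \<in> cball p (2 * R). u x = M}"
  have "continuous_on (cball p (2 * R)) u"
    using smooth_on_continuous_on[OF u] R(2) by (rule continuous_on_subset)
  then have "closed C" unfolding C_def by (intro continuous_closed_preimage_constant) auto
  moreover have pC: "p \<in> C" using p R by (simp add: C_def)
  ultimately obtain z where z: "z \<in> C" "\<And>x. x \<in> C \<Longrightarrow> dist y0 z \<le> dist y0 x"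
    using distance_attains_inf[of C y0] by blast
  define \<rho> where "\<rho> = dist y0 z / 2"
  have zp: "dist y0 z < R" using z(2)[OF pC] y0(1) by (simp add: dist_commute)
  have \<rho>: "\<rho> > 0" using y0(2) z(1) by (auto simp: \<rho>_def C_def)
  \<comment> \<open>Halving the ball around \<open>y0\<close> leaves \<open>z\<close> as its only point where \<open>u = M\<close>.\<close>
  define y where "y = midpoint y0 z"
  have yz: "dist y z = \<rho>" "dist y0 y = \<rho>" by (simp_all add: y_def \<rho>_def dist_midpoint)
  have inC: "x \<in> cball p (2 * R)" if "x \<in> cball y \<rho>" for x
  proof -
    have "dist p x \<le> dist p y0 + dist y0 y + dist y x"
      by (meson add_right_mono dist_triangle dist_triangle_le order_trans)
    moreover have "dist y x \<le> \<rho>" using that by simp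
    ultimately show ?thesis using y0(1) yz zp \<rho> by (simp add: \<rho>_def)
  qed
  show False
  proof (rule hopf_no_interior_touching[OF U u a conta contb sub le, of z y \<rho>])
    show "z \<in> U" "u z = M" using z(1) R(2) by (auto simp: C_def)
    show "cball y \<rho> \<subseteq> U" using inC R(2) by blast
    fix x assume x: "x \<in> cball y \<rho>" "x \<noteq> z"
    have "u x \<noteq> M"
    proof
      assume "u x = M"
      then have "2 * \<rho> \<le> dist y0 x" using z(2) inC[OF x(1)] by (simp add: C_def \<rho>_def)
      \<comment> \<open>Equality case of the triangle inequality: two steps of length at most \<rho>
        with a sum of length at least \<open>2 * \<rho>\<close> coincide, by the parallelogram
        law.\<close>
      define e f where "e = y - y0" and "f = x - y"
      have e: "norm e = \<rho>" using yz by (simp add: e_def dist_norm norm_minus_commute)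
      have f: "norm f \<le> \<rho>" using x by (simp add: f_def dist_norm norm_minus_commute)
      have "2 * \<rho> \<le> norm (e + f)"
        using \<open>2 * \<rho> \<le> dist y0 x\<close> by (simp add: e_def f_def dist_norm norm_minus_commute)
      then have "(2 * \<rho>)\<^sup>2 \<le> (norm (e + f))\<^sup>2" using \<rho> by (intro power_mono) auto
      moreover have "(norm f)\<^sup>2 \<le> \<rho>\<^sup>2" using f by (intro power_mono) auto
      moreover have "(norm (e - f))\<^sup>2 = 2 * (norm e)\<^sup>2 + 2 * (norm f)\<^sup>2 - (norm (e + f))\<^sup>2"
        by (simp add: power2_norm_eq_inner inner_add_left inner_add_right inner_diff_left inner_diff_right)
      ultimately have "(norm (e - f))\<^sup>2 \<le> 0" using e by (simp add: power_mult_distrib)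
      then have "e = f" by simp
      then have "x = y + (y - y0)" by (simp add: e_def f_def algebra_simps)
      also have "\<dots> = z"
        by (simp add: y_def midpoint_def vec_eq_iff field_simps)
      finally show False using x by simp
    qed
    then show "u x < M" using le[of x] inC[OF x(1)] R(2) by force
  qed (use yz \<rho> in auto)
qed

section \<open>Levi-Civita connection and curvature in a chart\<close>

definition matrix_pd :: "'n \<Rightarrow> (real^'n::finite \<Rightarrow> real^'b^'a) \<Rightarrow> real^'n \<Rightarrow> real^'b^'a" where
  "matrix_pd i M x = (\<chi> a b. partial_deriv i (\<lambda>y. M y $ a $ b) x)"

definition smooth_matrix_on :: "(real^'n::finite) set \<Rightarrow> (real^'n \<Rightarrow> real^'b^'a) \<Rightarrow> bool" where
  "smooth_matrix_on U M \<longleftrightarrow> (\<forall>a b. smooth_on U (\<lambda>x. M x $ a $ b))"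

definition vector_pd :: "'n \<Rightarrow> (real^'n::finite \<Rightarrow> real^'a) \<Rightarrow> real^'n \<Rightarrow> real^'a" where
  "vector_pd i V x = (\<chi> a. partial_deriv i (\<lambda>y. V y $ a) x)"

definition smooth_vector_on :: "(real^'n::finite) set \<Rightarrow> (real^'n \<Rightarrow> real^'a) \<Rightarrow> bool" where
  "smooth_vector_on U V \<longleftrightarrow> (\<forall>a. smooth_on U (\<lambda>x. V x $ a))"

lemma smooth_matrix_on_differentiable:
  "smooth_matrix_on U M \<Longrightarrow> x \<in> U \<Longrightarrow> (\<lambda>y. M y $ a $ b) differentiable (at x)"
  unfolding smooth_matrix_on_def by (blast intro: smooth_on_differentiable)

lemma smooth_vector_on_differentiable:
  "smooth_vector_on U V \<Longrightarrow> x \<in> U \<Longrightarrow> (\<lambda>y. V y $ a) differentiable (at x)"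
  unfolding smooth_vector_on_def by (blast intro: smooth_on_differentiable)

lemma smooth_vector_on_pd: "smooth_vector_on U V \<Longrightarrow> smooth_vector_on U (vector_pd i V)"
  unfolding smooth_vector_on_def vector_pd_def by (simp add: smooth_on_partial_deriv)

lemma smooth_matrix_on_pd: "smooth_matrix_on U M \<Longrightarrow> smooth_matrix_on U (matrix_pd i M)"
  unfolding smooth_matrix_on_def matrix_pd_def by (simp add: smooth_on_partial_deriv)

lemma smooth_matrix_on_transpose: "smooth_matrix_on U M \<Longrightarrow> smooth_matrix_on U (\<lambda>x. transpose (M x))"
  unfolding smooth_matrix_on_def transpose_def by simp

lemma matrix_pd_transpose: "matrix_pd i (\<lambda>y. transpose (M y)) x = transpose (matrix_pd i M x)"
  by (simp add: matrix_pd_def transpose_def)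

context
  fixes U :: "(real^'n::finite) set"
  assumes U: "open U"
begin

lemma matrix_pd_cong: "x \<in> U \<Longrightarrow> (\<And>y. y \<in> U \<Longrightarrow> M y = N y) \<Longrightarrow> matrix_pd i M x = matrix_pd i N x"
  by (auto simp: matrix_pd_def vec_eq_iff intro!: partial_deriv_cong[OF U])

lemma vector_pd_cong: "x \<in> U \<Longrightarrow> (\<And>y. y \<in> U \<Longrightarrow> V y = W y) \<Longrightarrow> vector_pd i V x = vector_pd i W x"
  by (auto simp: vector_pd_def vec_eq_iff intro!: partial_deriv_cong[OF U])

lemma smooth_matrix_on_mult:
  "smooth_matrix_on U M \<Longrightarrow> smooth_matrix_on U N \<Longrightarrow> smooth_matrix_on U (\<lambda>x. M x ** N x)"
  unfolding smooth_matrix_on_def matrix_matrix_mult_def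
  by (auto intro!: smooth_on_sum smooth_on_mult U)

lemma smooth_matrix_on_add:
  "smooth_matrix_on U M \<Longrightarrow> smooth_matrix_on U N \<Longrightarrow> smooth_matrix_on U (\<lambda>x. M x + N x)"
  unfolding smooth_matrix_on_def by (auto intro!: smooth_on_add U)

lemma smooth_matrix_on_diff:
  "smooth_matrix_on U M \<Longrightarrow> smooth_matrix_on U N \<Longrightarrow> smooth_matrix_on U (\<lambda>x. M x - N x)"
  unfolding smooth_matrix_on_def by (auto intro!: smooth_on_diff U)

lemma smooth_vector_on_mult:
  "smooth_matrix_on U M \<Longrightarrow> smooth_vector_on U V \<Longrightarrow> smooth_vector_on U (\<lambda>x. M x *v V x)"
  unfolding smooth_matrix_on_def smooth_vector_on_def matrix_vector_mult_def
  by (auto intro!: smooth_on_sum smooth_on_mult U)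

lemma smooth_vector_on_add:
  "smooth_vector_on U V \<Longrightarrow> smooth_vector_on U W \<Longrightarrow> smooth_vector_on U (\<lambda>x. V x + W x)"
  unfolding smooth_vector_on_def by (auto intro!: smooth_on_add U)

context
  fixes x :: "real^'n"
  assumes x: "x \<in> U"
begin

lemma matrix_pd_mult:
  assumes "smooth_matrix_on U M" "smooth_matrix_on U N"
  shows "matrix_pd i (\<lambda>y. M y ** N y) x = M x ** matrix_pd i N x + matrix_pd i M x ** N x"
proof -
  have d: "(\<lambda>y. M y $ a $ b) differentiable (at x)" "(\<lambda>y. N y $ c $ d) differentiable (at x)" for a b c d
    using assms x by (blast intro: smooth_matrix_on_differentiable smooth_vector_on_differentiable)+
  then have "(\<lambda>y. M y $ a $ b * N y $ b $ d) differentiable (at x)" for a b d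
    by (intro differentiable_mult)
  with d show ?thesis
    by (simp add: matrix_pd_def vec_eq_iff matrix_matrix_mult_def partial_deriv_sum partial_deriv_mult sum.distrib)
qed

lemma vector_pd_mult:
  assumes "smooth_matrix_on U M" "smooth_vector_on U V"
  shows "vector_pd i (\<lambda>y. M y *v V y) x = M x *v vector_pd i V x + matrix_pd i M x *v V x"
proof -
  have d: "(\<lambda>y. M y $ a $ b) differentiable (at x)" "(\<lambda>y. V y $ c) differentiable (at x)" for a b c
    using assms x by (blast intro: smooth_matrix_on_differentiable smooth_vector_on_differentiable)+
  then have "(\<lambda>y. M y $ a $ b * V y $ b) differentiable (at x)" for a b
    by (intro differentiable_mult)
  with d show ?thesis
    by (simp add: matrix_pd_def vector_pd_def vec_eq_iff matrix_vector_mult_def partial_deriv_sum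
        partial_deriv_mult sum.distrib)
qed

lemma matrix_pd_add:
  assumes "smooth_matrix_on U M" "smooth_matrix_on U N"
  shows "matrix_pd i (\<lambda>y. M y + N y) x = matrix_pd i M x + matrix_pd i N x"
proof -
  have d: "(\<lambda>y. M y $ a $ b) differentiable (at x)" "(\<lambda>y. N y $ a $ b) differentiable (at x)" for a b
    using assms x by (blast intro: smooth_matrix_on_differentiable smooth_vector_on_differentiable)+
  then show ?thesis
    by (simp add: matrix_pd_def vec_eq_iff partial_deriv_add)
qed

lemma matrix_pd_diff:
  assumes "smooth_matrix_on U M" "smooth_matrix_on U N"
  shows "matrix_pd i (\<lambda>y. M y - N y) x = matrix_pd i M x - matrix_pd i N x"
proof -
  have d: "(\<lambda>y. M y $ a $ b) differentiable (at x)" "(\<lambda>y. N y $ a $ b) differentiable (at x)" for a b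
    using assms x by (blast intro: smooth_matrix_on_differentiable smooth_vector_on_differentiable)+
  then show ?thesis
    by (simp add: matrix_pd_def vec_eq_iff partial_deriv_diff)
qed

lemma matrix_pd_minus:
  assumes "smooth_matrix_on U M"
  shows "matrix_pd i (\<lambda>y. - M y) x = - matrix_pd i M x"
proof -
  have d: "(\<lambda>y. M y $ a $ b) differentiable (at x)" for a b
    using assms x by (blast intro: smooth_matrix_on_differentiable smooth_vector_on_differentiable)+
  then show ?thesis
    by (simp add: matrix_pd_def vec_eq_iff partial_deriv_minus)
qed

lemma vector_pd_add:
  assumes "smooth_vector_on U V" "smooth_vector_on U W"
  shows "vector_pd i (\<lambda>y. V y + W y) x = vector_pd i V x + vector_pd i W x"
proof -
  have d: "(\<lambda>y. V y $ a) differentiable (at x)" "(\<lambda>y. W y $ a) differentiable (at x)" for a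
    using assms x by (blast intro: smooth_matrix_on_differentiable smooth_vector_on_differentiable)+
  then show ?thesis
    by (simp add: vector_pd_def vec_eq_iff partial_deriv_add)
qed

lemma matrix_pd_commute:
  assumes "smooth_matrix_on U M"
  shows "matrix_pd i (matrix_pd j M) x = matrix_pd j (matrix_pd i M) x"
  using assms partial_deriv_commute[OF U x]
  by (simp add: smooth_matrix_on_def matrix_pd_def vec_eq_iff)

lemma vector_pd_commute:
  assumes "smooth_vector_on U V"
  shows "vector_pd i (vector_pd j V) x = vector_pd j (vector_pd i V) x"
  using assms partial_deriv_commute[OF U x]
  by (simp add: smooth_vector_on_def vector_pd_def vec_eq_iff)

end

end

text \<open>The connection matrices \<open>\<Gamma> i\<close> act on column vectors, so that \<open>\<partial> i + \<Gamma> i\<close> is the covariant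
  derivative of vector fields and the curvature matrices \<open>R i j\<close> are its commutators.\<close>

locale local_metric =
  fixes U :: "(real^'n::finite) set" and G :: "real^'n \<Rightarrow> real^'n^'n"
  assumes open_U: "open U"
    and smooth_G: "smooth_matrix_on U G"
    and sym_G: "x \<in> U \<Longrightarrow> transpose (G x) = G x"
    and pos_G: "x \<in> U \<Longrightarrow> v \<noteq> 0 \<Longrightarrow> 0 < v \<bullet> (G x *v v)"
begin

definition Q :: "real^'n \<Rightarrow> real^'n^'n" where "Q x = matrix_inv (G x)"

definition \<Gamma> :: "'n \<Rightarrow> real^'n \<Rightarrow> real^'n^'n" where "\<Gamma> i x = (\<chi> k j. christoffel G k i j x)"

definition R :: "'n \<Rightarrow> 'n \<Rightarrow> real^'n \<Rightarrow> real^'n^'n" where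
  "R i j x = matrix_pd i (\<Gamma> j) x - matrix_pd j (\<Gamma> i) x + \<Gamma> i x ** \<Gamma> j x - \<Gamma> j x ** \<Gamma> i x"

lemma Q_facts:
  assumes "x \<in> U"
  shows "G x ** Q x = mat 1" "Q x ** G x = mat 1" "transpose (Q x) = Q x" "positive_semidefinite (Q x)"
    "invertible (G x)" "v \<noteq> 0 \<Longrightarrow> 0 < v \<bullet> (Q x *v v)"
  using positive_semidefinite_matrix_inv[OF sym_G pos_G, OF assms assms] matrix_inv_inverse
  by (auto simp: Q_def)

lemma smooth_Q: "smooth_matrix_on U Q"
  using smooth_on_matrix_inv[OF open_U, of G] smooth_G Q_facts(5)
  by (auto simp: smooth_matrix_on_def Q_def)

lemma Q_sym: "x \<in> U \<Longrightarrow> Q x $ i $ j = Q x $ j $ i"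
  by (rule symmetric_matrix_nth[OF Q_facts(3)])

lemma G_sym: "x \<in> U \<Longrightarrow> G x $ i $ j = G x $ j $ i"
  by (rule symmetric_matrix_nth[OF sym_G])

lemma dG_sym: "x \<in> U \<Longrightarrow> partial_deriv k (\<lambda>y. G y $ i $ j) x = partial_deriv k (\<lambda>y. G y $ j $ i) x"
  by (rule partial_deriv_cong[OF open_U _ G_sym])

lemma smooth_\<Gamma>: "smooth_matrix_on U (\<Gamma> i)"
proof -
  have "smooth_on U (\<lambda>x. G x $ a $ b)" "smooth_on U (\<lambda>x. Q x $ a $ b)" for a b
    using smooth_G smooth_Q by (auto simp: smooth_matrix_on_def)
  then have "smooth_on U (\<lambda>x. (1/2) * (\<Sum>l\<in>UNIV. Q x $ k $ l *
        (partial_deriv i (\<lambda>y. G y $ j $ l) x + partial_deriv j (\<lambda>y. G y $ i $ l) x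
          - partial_deriv l (\<lambda>y. G y $ i $ j) x)))" for k j
    by (intro open_U smooth_on_mult smooth_on_sum smooth_on_diff smooth_on_add smooth_on_const
        smooth_on_partial_deriv)
  then show ?thesis
    by (simp add: smooth_matrix_on_def \<Gamma>_def christoffel_def Q_def)
qed

lemma \<Gamma>_sym: "x \<in> U \<Longrightarrow> \<Gamma> i x $ k $ j = \<Gamma> j x $ k $ i"
  unfolding \<Gamma>_def christoffel_def
  by (simp add: dG_sym[of x _ i j] add.commute)

lemma smooth_R: "smooth_matrix_on U (R i j)"
  unfolding R_def[abs_def]
  by (intro smooth_matrix_on_diff smooth_matrix_on_add smooth_matrix_on_mult smooth_matrix_on_pd smooth_\<Gamma> open_U)

lemma riemann_eq_R: "riemann G l k i j x = R i j x $ l $ k"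
  by (simp add: riemann_def R_def matrix_pd_def \<Gamma>_def matrix_matrix_mult_def)

text \<open>Metric compatibility. Lowering the index of the Christoffel symbols undoes
  \<open>Q\<close>, and in the sum with the transpose the two remaining derivative terms
  cancel.\<close>

lemma matrix_pd_G:
  assumes x: "x \<in> U"
  shows "matrix_pd i G x = G x ** \<Gamma> i x + transpose (\<Gamma> i x) ** G x"
proof -
  define T where "T b = (\<chi> l. partial_deriv i (\<lambda>y. G y $ b $ l) x + partial_deriv b (\<lambda>y. G y $ i $ l) x
          - partial_deriv l (\<lambda>y. G y $ i $ b) x)" for b
  have GT: "(G x ** \<Gamma> i x) $ a $ b = T b $ a / 2" for a b
  proof -
    have \<Gamma>T: "\<Gamma> i x $ k $ b = (Q x *v T b) $ k / 2" for k
      by (simp add: matrix_vector_mult_def \<Gamma>_def christoffel_def Q_def T_def)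
    have "(G x ** \<Gamma> i x) $ a $ b = (G x *v (Q x *v T b)) $ a / 2"
      by (simp add: \<Gamma>T matrix_matrix_mult_def matrix_vector_mult_def[of "G x"] sum_divide_distrib)
    moreover have "G x *v (Q x *v T b) = T b"
      using Q_facts[OF x] by (simp add: matrix_vector_mul_assoc)
    ultimately show ?thesis by simp
  qed
  have "transpose (\<Gamma> i x) ** G x = transpose (G x ** \<Gamma> i x)"
    using sym_G[OF x] by (simp add: matrix_transpose_mul)
  then show ?thesis
    by (simp add: vec_eq_iff GT transpose_def)
      (simp add: T_def matrix_pd_def dG_sym[OF x, of i] dG_sym[OF x, of _ i] field_simps)
qed

text \<open>Differentiate \<open>G ** Q = mat 1\<close>: the inverse metric is parallel too. This is
  the form of compatibility used from here on.\<close>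

lemma matrix_pd_Q:
  assumes x: "x \<in> U"
  shows "matrix_pd i Q x = - (\<Gamma> i x ** Q x + Q x ** transpose (\<Gamma> i x))"
proof -
  have "0 = matrix_pd i (\<lambda>y. mat 1) x" by (simp add: matrix_pd_def vec_eq_iff)
  also have "\<dots> = matrix_pd i (\<lambda>y. G y ** Q y) x"
    using Q_facts(1) by (intro matrix_pd_cong[OF open_U x]) simp
  also have "\<dots> = G x ** matrix_pd i Q x + matrix_pd i G x ** Q x"
    by (rule matrix_pd_mult[OF open_U x smooth_G smooth_Q])
  finally have "Q x ** (G x ** matrix_pd i Q x + matrix_pd i G x ** Q x) = 0" by simp
  then have "Q x ** (G x ** matrix_pd i Q x) + Q x ** ((G x ** \<Gamma> i x + transpose (\<Gamma> i x) ** G x) ** Q x) = 0"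
    by (simp add: matrix_add_ldistrib matrix_pd_G[OF x])
  then have "(Q x ** G x) ** matrix_pd i Q x + ((Q x ** G x) ** \<Gamma> i x ** Q x + Q x ** transpose (\<Gamma> i x) ** (G x ** Q x)) = 0"
    by (simp only: matrix_add_ldistrib matrix_add_rdistrib matrix_mul_assoc)
  then show ?thesis
    using Q_facts[OF x] by (simp add: eq_neg_iff_add_eq_0 del: minus_add_distrib)
qed

text \<open>The second partial derivatives of \<open>Q\<close> commute; expanding both orders with
  \<open>matrix_pd_Q\<close> leaves exactly the action of the curvature on \<open>Q\<close>, which
  must vanish.\<close>

lemma R_skew:
  assumes x: "x \<in> U"
  shows "R i j x ** Q x + Q x ** transpose (R i j x) = 0"
proof -
  have dd: "matrix_pd i (matrix_pd j Q) x
     = - (\<Gamma> j x ** matrix_pd i Q x + matrix_pd i (\<Gamma> j) x ** Q x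
        + (Q x ** transpose (matrix_pd i (\<Gamma> j) x) + matrix_pd i Q x ** transpose (\<Gamma> j x)))" for i j
  proof -
    note sm = smooth_matrix_on_mult[OF open_U smooth_\<Gamma>[of j] smooth_Q]
      smooth_matrix_on_mult[OF open_U smooth_Q smooth_matrix_on_transpose[OF smooth_\<Gamma>[of j]]]
    have "matrix_pd i (matrix_pd j Q) x = matrix_pd i (\<lambda>x. - (\<Gamma> j x ** Q x + Q x ** transpose (\<Gamma> j x))) x"
      by (rule matrix_pd_cong[OF open_U x matrix_pd_Q])
    also have "\<dots> = - (matrix_pd i (\<lambda>x. \<Gamma> j x ** Q x) x + matrix_pd i (\<lambda>x. Q x ** transpose (\<Gamma> j x)) x)"
      by (simp only: matrix_pd_minus[OF open_U x smooth_matrix_on_add[OF open_U sm]] matrix_pd_add[OF open_U x sm])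
    also have "\<dots> = - (\<Gamma> j x ** matrix_pd i Q x + matrix_pd i (\<Gamma> j) x ** Q x
        + (Q x ** transpose (matrix_pd i (\<Gamma> j) x) + matrix_pd i Q x ** transpose (\<Gamma> j x)))"
      by (simp only: matrix_pd_mult[OF open_U x smooth_\<Gamma> smooth_Q]
          matrix_pd_mult[OF open_U x smooth_Q smooth_matrix_on_transpose[OF smooth_\<Gamma>]] matrix_pd_transpose)
    finally show ?thesis .
  qed
  have tr: "transpose (R i j x) = transpose (matrix_pd i (\<Gamma> j) x) - transpose (matrix_pd j (\<Gamma> i) x)
     + transpose (\<Gamma> j x) ** transpose (\<Gamma> i x) - transpose (\<Gamma> i x) ** transpose (\<Gamma> j x)"
    unfolding R_def matrix_transpose_mul[symmetric] by (simp add: transpose_def vec_eq_iff)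
  have "matrix_pd j (matrix_pd i Q) x - matrix_pd i (matrix_pd j Q) x = 0"
    using matrix_pd_commute[OF open_U x smooth_Q] by simp
  then show ?thesis
    unfolding dd matrix_pd_Q[OF x] tr unfolding R_def
    by (simp add: matrix_add_ldistrib matrix_add_rdistrib matrix_diff_ldistrib matrix_diff_rdistrib
        matrix_minus_left matrix_minus_right matrix_mul_assoc algebra_simps)
qed

lemma matrix_pd_R:
  assumes x: "x \<in> U"
  shows "matrix_pd i (R j k) x = matrix_pd i (matrix_pd j (\<Gamma> k)) x - matrix_pd i (matrix_pd k (\<Gamma> j)) x
     + (\<Gamma> j x ** matrix_pd i (\<Gamma> k) x + matrix_pd i (\<Gamma> j) x ** \<Gamma> k x)
     - (\<Gamma> k x ** matrix_pd i (\<Gamma> j) x + matrix_pd i (\<Gamma> k) x ** \<Gamma> j x)"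
proof -
  note sp = smooth_matrix_on_pd[OF smooth_\<Gamma>]
  note sm = smooth_matrix_on_mult[OF open_U smooth_\<Gamma> smooth_\<Gamma>]
  note sd = smooth_matrix_on_diff[OF open_U sp sp]
  note sa = smooth_matrix_on_add[OF open_U sd sm]
  show ?thesis
    unfolding R_def[abs_def]
    by (simp only: matrix_pd_diff[OF open_U x sa sm] matrix_pd_add[OF open_U x sd sm]
        matrix_pd_diff[OF open_U x sp sp] matrix_pd_mult[OF open_U x smooth_\<Gamma> smooth_\<Gamma>])
qed

text \<open>The Jacobi identity for the operators \<open>\<partial> i + \<Gamma> i\<close>. The
  connection acts on the matrix indices only; corrections for the other indices would cancel in the
  cyclic sum, because \<Gamma> is symmetric.\<close>

lemma second_bianchi:
  assumes x: "x \<in> U"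
  shows "matrix_pd i (R j k) x + \<Gamma> i x ** R j k x - R j k x ** \<Gamma> i x
    + (matrix_pd j (R k i) x + \<Gamma> j x ** R k i x - R k i x ** \<Gamma> j x)
    + (matrix_pd k (R i j) x + \<Gamma> k x ** R i j x - R i j x ** \<Gamma> k x) = 0"
proof -
  note c = matrix_pd_commute[OF open_U x smooth_\<Gamma>]
  show ?thesis
    unfolding matrix_pd_R[OF x] c[of j i k] c[of k i j] c[of k j i] unfolding R_def
    by (simp add: matrix_add_ldistrib matrix_add_rdistrib matrix_diff_ldistrib matrix_diff_rdistrib
        matrix_mul_assoc)
qed

text \<open>The curvature with its second matrix index raised: skew in \<open>i j\<close> and in the
  matrix indices, so that contractions need no metric factor.\<close>

definition S :: "'n \<Rightarrow> 'n \<Rightarrow> real^'n \<Rightarrow> real^'n^'n" where "S i j x = R i j x ** Q x"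

lemma smooth_S: "smooth_matrix_on U (S i j)"
  unfolding S_def[abs_def] by (intro smooth_matrix_on_mult smooth_R smooth_Q open_U)

lemma S_skew: "x \<in> U \<Longrightarrow> S i j x $ k $ l = - S i j x $ l $ k"
proof -
  assume x: "x \<in> U"
  have "transpose (S i j x) = Q x ** transpose (R i j x)"
    using Q_facts[OF x] by (simp add: S_def matrix_transpose_mul)
  then have "S i j x + transpose (S i j x) = 0" using R_skew[OF x] by (simp add: S_def)
  then have "(S i j x + transpose (S i j x)) $ k $ l = 0" by simp
  then show ?thesis by (simp add: transpose_def)
qed

lemma S_antisym: "S i j x = - S j i x"
  by (simp add: S_def R_def matrix_diff_rdistrib matrix_add_rdistrib flip: matrix_minus_left)

text \<open>Since \<open>Q\<close> is parallel, multiplying \<open>second_bianchi\<close> by it on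
  the right replaces each commutator by the action on two upper indices.\<close>

lemma second_bianchi_S:
  assumes x: "x \<in> U"
  shows "matrix_pd i (S j k) x + \<Gamma> i x ** S j k x + S j k x ** transpose (\<Gamma> i x)
    + (matrix_pd j (S k i) x + \<Gamma> j x ** S k i x + S k i x ** transpose (\<Gamma> j x))
    + (matrix_pd k (S i j) x + \<Gamma> k x ** S i j x + S i j x ** transpose (\<Gamma> k x)) = 0"
proof -
  have "matrix_pd i (S j k) x + \<Gamma> i x ** S j k x + S j k x ** transpose (\<Gamma> i x)
     = (matrix_pd i (R j k) x + \<Gamma> i x ** R j k x - R j k x ** \<Gamma> i x) ** Q x" for i j k
    unfolding S_def[abs_def] matrix_pd_mult[OF open_U x smooth_R smooth_Q] matrix_pd_Q[OF x]
    by (simp add: matrix_add_ldistrib matrix_add_rdistrib matrix_diff_ldistrib matrix_diff_rdistrib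
        matrix_minus_left matrix_minus_right matrix_mul_assoc)
  then show ?thesis
    using second_bianchi[OF x, of i j k] by (simp only: matrix_add_rdistrib[symmetric]) simp
qed

definition mixed_ricci :: "real^'n \<Rightarrow> real^'n^'n" where
  "mixed_ricci x = (\<chi> m j. \<Sum>i\<in>UNIV. S i j x $ i $ m)"

text \<open>The covariant divergence of a tensor with one upper and one lower index. In the last sum
  the symmetry of \<Gamma> allows the correction for the lower index to be written with the single
  matrix \<open>\<Gamma> k\<close>.\<close>

definition div_mixed :: "(real^'n \<Rightarrow> real^'n^'n) \<Rightarrow> 'n \<Rightarrow> real^'n \<Rightarrow> real" where
  "div_mixed T k x = (\<Sum>i\<in>UNIV. partial_deriv i (\<lambda>y. T y $ i $ k) x)
     + (\<Sum>i\<in>UNIV. \<Sum>p\<in>UNIV. \<Gamma> i x $ i $ p * T x $ p $ k)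
     - (\<Sum>i\<in>UNIV. \<Sum>p\<in>UNIV. \<Gamma> k x $ i $ p * T x $ p $ i)"

end

lemma sum_skew_symmetric_eq_0:
  fixes s t :: "'n::finite \<Rightarrow> 'n \<Rightarrow> real"
  assumes "\<And>i p. s i p = - s p i" "\<And>i p. t i p = t p i"
  shows "(\<Sum>i\<in>UNIV. \<Sum>p\<in>UNIV. s i p * t i p) = 0"
proof -
  have "(\<Sum>i\<in>UNIV. \<Sum>p\<in>UNIV. s i p * t i p) = (\<Sum>i\<in>UNIV. \<Sum>p\<in>UNIV. s p i * t p i)"
    by (rule sum.swap)
  also have "\<dots> = - (\<Sum>i\<in>UNIV. \<Sum>p\<in>UNIV. s i p * t i p)"
    unfolding sum_negf[symmetric] by (intro sum.cong refl) (subst assms(1), subst assms(2), simp)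
  finally show ?thesis by simp
qed

context local_metric
begin

lemma partial_deriv_mixed_ricci:
  assumes x: "x \<in> U"
  shows "partial_deriv k (\<lambda>y. mixed_ricci y $ m $ j) x = (\<Sum>i\<in>UNIV. matrix_pd k (S i j) x $ i $ m)"
  using smooth_matrix_on_differentiable[OF smooth_S x]
  by (simp add: mixed_ricci_def matrix_pd_def partial_deriv_sum)

lemma matrix_pd_S_skew: "x \<in> U \<Longrightarrow> matrix_pd k (S i j) x $ a $ b = - matrix_pd k (S i j) x $ b $ a"
proof -
  assume x: "x \<in> U"
  have "partial_deriv k (\<lambda>y. S i j y $ a $ b) x = partial_deriv k (\<lambda>y. - S i j y $ b $ a) x"
    by (rule partial_deriv_cong[OF open_U x]) (rule S_skew)
  then show ?thesis
    by (simp add: matrix_pd_def partial_deriv_minus smooth_matrix_on_differentiable[OF smooth_S x])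
qed

lemma matrix_pd_S_antisym: "x \<in> U \<Longrightarrow> matrix_pd k (S i j) x $ a $ b = - matrix_pd k (S j i) x $ a $ b"
proof -
  assume x: "x \<in> U"
  have "partial_deriv k (\<lambda>y. S i j y $ a $ b) x = partial_deriv k (\<lambda>y. - S j i y $ a $ b) x"
    by (subst S_antisym[abs_def]) simp
  then show ?thesis
    by (simp add: matrix_pd_def partial_deriv_minus smooth_matrix_on_differentiable[OF smooth_S x])
qed

lemma smooth_mixed_ricci: "smooth_matrix_on U mixed_ricci"
  using smooth_S by (auto simp: smooth_matrix_on_def mixed_ricci_def intro!: smooth_on_sum open_U)

text \<open>The trace of \<open>second_bianchi_S\<close>. Two of the three cyclic groups give minus
  the derivative and first connection term of the divergence of Ricci; the third gives the
  derivative of the scalar curvature together with the two corrections by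
  \<open>\<Gamma> k\<close>.\<close>

lemma contracted_bianchi:
  assumes x: "x \<in> U"
  shows "partial_deriv k (\<lambda>y. trace (mixed_ricci y)) x = 2 * div_mixed mixed_ricci k x"
proof -
  let ?Ric = "mixed_ricci x"
  have ric: "(\<Sum>i\<in>UNIV. S i j x $ i $ m) = ?Ric $ m $ j" for m j
    by (simp add: mixed_ricci_def)
  note S_sk = S_skew[OF x]
  note \<Gamma>s = \<Gamma>_sym[OF x]
  have T1: "(\<Sum>i\<in>UNIV. \<Sum>j\<in>UNIV. matrix_pd i (S j k) x $ i $ j)
      = - (\<Sum>i\<in>UNIV. partial_deriv i (\<lambda>y. mixed_ricci y $ i $ k) x)"
    by (subst matrix_pd_S_skew[OF x]) (simp add: partial_deriv_mixed_ricci[OF x] sum_negf)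
  have T2: "(\<Sum>i\<in>UNIV. \<Sum>j\<in>UNIV. \<Sum>p\<in>UNIV. \<Gamma> i x $ i $ p * S j k x $ p $ j)
      = - (\<Sum>i\<in>UNIV. \<Sum>p\<in>UNIV. \<Gamma> i x $ i $ p * ?Ric $ p $ k)"
    by (subst S_sk, subst sum.swap)
      (simp add: sum_negf ric flip: sum_distrib_left)
  \<comment> \<open>\<Gamma> is symmetric in \<open>i p\<close> while \<open>S\<close> is skew in
    them; \<open>T5\<close> vanishes for the same reason.\<close>
  have T3: "(\<Sum>i\<in>UNIV. \<Sum>j\<in>UNIV. \<Sum>p\<in>UNIV. S j k x $ i $ p * \<Gamma> i x $ j $ p) = 0"
  proof (rule trans[OF sum.swap], rule sum.neutral, rule ballI)
    fix j
    show "(\<Sum>i\<in>UNIV. \<Sum>p\<in>UNIV. S j k x $ i $ p * \<Gamma> i x $ j $ p) = 0"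
      by (rule sum_skew_symmetric_eq_0) (rule S_sk, rule \<Gamma>s)
  qed
  have T4: "(\<Sum>i\<in>UNIV. \<Sum>j\<in>UNIV. matrix_pd j (S k i) x $ i $ j)
      = - (\<Sum>i\<in>UNIV. partial_deriv i (\<lambda>y. mixed_ricci y $ i $ k) x)"
    by (subst sum.swap, subst matrix_pd_S_antisym[OF x]) (simp add: partial_deriv_mixed_ricci[OF x] sum_negf)
  have T5: "(\<Sum>i\<in>UNIV. \<Sum>j\<in>UNIV. \<Sum>p\<in>UNIV. \<Gamma> j x $ i $ p * S k i x $ p $ j) = 0"
  proof (rule sum.neutral, rule ballI)
    fix i
    have "(\<Sum>j\<in>UNIV. \<Sum>p\<in>UNIV. S k i x $ p $ j * \<Gamma> j x $ i $ p) = 0"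
      by (rule sum_skew_symmetric_eq_0) (rule S_sk, rule \<Gamma>s)
    then show "(\<Sum>j\<in>UNIV. \<Sum>p\<in>UNIV. \<Gamma> j x $ i $ p * S k i x $ p $ j) = 0"
      by (simp add: mult.commute)
  qed
  have T6: "(\<Sum>i\<in>UNIV. \<Sum>j\<in>UNIV. \<Sum>p\<in>UNIV. S k i x $ i $ p * \<Gamma> j x $ j $ p)
      = - (\<Sum>i\<in>UNIV. \<Sum>p\<in>UNIV. \<Gamma> i x $ i $ p * ?Ric $ p $ k)"
  proof -
    have "(\<Sum>i\<in>UNIV. \<Sum>j\<in>UNIV. \<Sum>p\<in>UNIV. S k i x $ i $ p * \<Gamma> j x $ j $ p)
        = (\<Sum>j\<in>UNIV. \<Sum>p\<in>UNIV. \<Sum>i\<in>UNIV. - (\<Gamma> j x $ j $ p * S i k x $ i $ p))"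
      by (subst sum.swap, rule sum.cong[OF refl], subst sum.swap, intro sum.cong refl, subst S_antisym) simp
    then show ?thesis by (simp add: sum_negf ric flip: sum_distrib_left)
  qed
  have T7: "(\<Sum>i\<in>UNIV. \<Sum>j\<in>UNIV. matrix_pd k (S i j) x $ i $ j)
      = partial_deriv k (\<lambda>y. trace (mixed_ricci y)) x"
    using smooth_matrix_on_differentiable[OF smooth_mixed_ricci x]
    by (subst sum.swap) (simp add: trace_def partial_deriv_sum partial_deriv_mixed_ricci[OF x])
  have T8: "(\<Sum>i\<in>UNIV. \<Sum>j\<in>UNIV. \<Sum>p\<in>UNIV. \<Gamma> k x $ i $ p * S i j x $ p $ j)
      = (\<Sum>i\<in>UNIV. \<Sum>p\<in>UNIV. \<Gamma> k x $ i $ p * ?Ric $ p $ i)"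
  proof (rule sum.cong[OF refl])
    fix i
    have "S i j x $ p $ j = S j i x $ j $ p" for j p
      using S_antisym[of i j x] S_skew[OF x, of j i p j] by simp
    then show "(\<Sum>j\<in>UNIV. \<Sum>p\<in>UNIV. \<Gamma> k x $ i $ p * S i j x $ p $ j) = (\<Sum>p\<in>UNIV. \<Gamma> k x $ i $ p * ?Ric $ p $ i)"
      by (subst sum.swap) (simp add: ric flip: sum_distrib_left)
  qed
  have T9: "(\<Sum>i\<in>UNIV. \<Sum>j\<in>UNIV. \<Sum>p\<in>UNIV. S i j x $ i $ p * \<Gamma> k x $ j $ p)
      = (\<Sum>i\<in>UNIV. \<Sum>p\<in>UNIV. \<Gamma> k x $ i $ p * ?Ric $ p $ i)"
    by (subst sum.swap, rule sum.cong[OF refl], subst sum.swap)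
      (simp add: ric mult.commute flip: sum_distrib_left)
  have "(\<Sum>i\<in>UNIV. \<Sum>j\<in>UNIV. (matrix_pd i (S j k) x + \<Gamma> i x ** S j k x + S j k x ** transpose (\<Gamma> i x)
    + (matrix_pd j (S k i) x + \<Gamma> j x ** S k i x + S k i x ** transpose (\<Gamma> j x))
    + (matrix_pd k (S i j) x + \<Gamma> k x ** S i j x + S i j x ** transpose (\<Gamma> k x))) $ i $ j) = 0"
    by (simp only: second_bianchi_S[OF x] zero_index sum.neutral_const)
  then show ?thesis
    unfolding div_mixed_def
    by (simp add: matrix_matrix_mult_def transpose_def sum.distrib T1 T2 T3 T4 T5 T6 T7 T8 T9)
qed

section \<open>Covariant derivatives, Hessian and divergence in a chart\<close>

definition cov :: "'n \<Rightarrow> (real^'n \<Rightarrow> real^'n) \<Rightarrow> real^'n \<Rightarrow> real^'n" where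
  "cov i V x = vector_pd i V x + \<Gamma> i x *v V x"

lemma smooth_cov: "smooth_vector_on U V \<Longrightarrow> smooth_vector_on U (cov i V)"
  unfolding cov_def[abs_def]
  by (intro smooth_vector_on_add smooth_vector_on_mult smooth_vector_on_pd smooth_\<Gamma> open_U)

text \<open>\<open>cov\<close> acts on the vector index only; a correction for the index of
  differentiation would be symmetric in \<open>i k\<close> and drop out of the commutator.\<close>

lemma ricci_identity:
  assumes x: "x \<in> U" and V: "smooth_vector_on U V"
  shows "cov i (cov k V) x - cov k (cov i V) x = R i k x *v V x"
proof -
  note sm = smooth_vector_on_pd[OF V] smooth_vector_on_mult[OF open_U smooth_\<Gamma> V]
  have "vector_pd i (cov k V) x = vector_pd i (vector_pd k V) x
      + (\<Gamma> k x *v vector_pd i V x + matrix_pd i (\<Gamma> k) x *v V x)" for i k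
    unfolding cov_def[abs_def]
    by (simp only: vector_pd_add[OF open_U x sm] vector_pd_mult[OF open_U x smooth_\<Gamma> V])
  then show ?thesis
    using vector_pd_commute[OF open_U x V, of i k]
    unfolding cov_def[of i "cov k V"] cov_def[of k "cov i V"]
    by (simp add: cov_def R_def matrix_vector_mul_assoc algebra_simps)
qed

definition dform :: "(real^'n \<Rightarrow> real) \<Rightarrow> real^'n \<Rightarrow> real^'n" where
  "dform f x = (\<chi> l. partial_deriv l f x)"

definition grad :: "(real^'n \<Rightarrow> real) \<Rightarrow> real^'n \<Rightarrow> real^'n" where
  "grad f x = Q x *v dform f x"

definition hess :: "(real^'n \<Rightarrow> real) \<Rightarrow> real^'n \<Rightarrow> real^'n^'n" where
  "hess f x = (\<chi> i j. partial_deriv i (partial_deriv j f) x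
        - (\<Sum>k\<in>UNIV. christoffel G k i j x * partial_deriv k f x))"

definition mixed_hess :: "(real^'n \<Rightarrow> real) \<Rightarrow> real^'n \<Rightarrow> real^'n^'n" where
  "mixed_hess f x = Q x ** hess f x"

definition divergence :: "(real^'n \<Rightarrow> real^'n) \<Rightarrow> real^'n \<Rightarrow> real" where
  "divergence V x = (\<Sum>i\<in>UNIV. cov i V x $ i)"

lemma smooth_dform: "smooth_on U f \<Longrightarrow> smooth_vector_on U (dform f)"
  by (simp add: smooth_vector_on_def dform_def smooth_on_partial_deriv)

lemma smooth_grad: "smooth_on U f \<Longrightarrow> smooth_vector_on U (grad f)"
  unfolding grad_def[abs_def]
  by (intro smooth_vector_on_mult smooth_dform smooth_Q open_U)

lemma hess_sym: "x \<in> U \<Longrightarrow> smooth_on U f \<Longrightarrow> transpose (hess f x) = hess f x"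
  using partial_deriv_commute[OF open_U] \<Gamma>_sym
  by (simp add: hess_def transpose_def vec_eq_iff \<Gamma>_def)

text \<open>Because \<open>Q\<close> is parallel, covariant differentiation passes through the
  raising of the index and meets the differential, whose covariant derivative is the Hessian. So the
  endomorphism \<open>H\<close> is \<nabla> V.\<close>

lemma cov_grad:
  assumes x: "x \<in> U" and f: "smooth_on U f"
  shows "cov k (grad f) x $ a = mixed_hess f x $ a $ k"
proof -
  have "cov k (grad f) x = Q x *v (vector_pd k (dform f) x - transpose (\<Gamma> k x) *v dform f x)"
    unfolding cov_def grad_def[abs_def] vector_pd_mult[OF open_U x smooth_Q smooth_dform[OF f]] matrix_pd_Q[OF x]
    by (simp add: matrix_vector_mul_assoc matrix_minus_vector matrix_vector_mult_add_rdistrib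
        matrix_vector_mult_diff_distrib matrix_vector_mult_diff_rdistrib del: transpose_matrix_vector)
  also have "vector_pd k (dform f) x - transpose (\<Gamma> k x) *v dform f x = (\<chi> j. hess f x $ k $ j)"
    by (simp add: hess_def vector_pd_def dform_def matrix_vector_mult_def transpose_def \<Gamma>_def vec_eq_iff
        del: transpose_matrix_vector)
  also have "\<dots> = (\<chi> j. hess f x $ j $ k)"
    using symmetric_matrix_nth[OF hess_sym[OF x f], of k] by simp
  finally show ?thesis
    by (simp add: mixed_hess_def matrix_matrix_mult_def matrix_vector_mult_def)
qed

lemma trace_mixed_hess: "x \<in> U \<Longrightarrow> smooth_on U f \<Longrightarrow> trace (mixed_hess f x) = divergence (grad f) x"
  by (simp add: trace_def divergence_def cov_grad)

lemma smooth_mixed_hess: "smooth_on U f \<Longrightarrow> smooth_matrix_on U (mixed_hess f)"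
  unfolding smooth_matrix_on_def
proof (intro allI)
  fix a k assume f: "smooth_on U f"
  show "smooth_on U (\<lambda>x. mixed_hess f x $ a $ k)"
    using smooth_cov[OF smooth_grad[OF f], of k] unfolding smooth_vector_on_def
    by (intro smooth_on_cong[OF open_U cov_grad[OF _ f]]) auto
qed

lemma smooth_trace: "smooth_matrix_on U M \<Longrightarrow> smooth_on U (\<lambda>x. trace (M x))"
  unfolding trace_def smooth_matrix_on_def by (intro smooth_on_sum open_U) auto

text \<open>The traced Ricci identity for the gradient \<open>V\<close>: exchanging the two
  derivatives turns the divergence of \<nabla> V into the derivative of \<open>div V\<close>, at the
  cost of a curvature term.\<close>

lemma div_mixed_hess:
  assumes x: "x \<in> U" and f: "smooth_on U f"
  shows "div_mixed (mixed_hess f) k x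
    = partial_deriv k (\<lambda>y. trace (mixed_hess f y)) x + (\<Sum>i\<in>UNIV. (R i k x *v grad f x) $ i)"
proof -
  have H: "cov k (grad f) y $ a = mixed_hess f y $ a $ k" if "y \<in> U" for k a y
    using that by (rule cov_grad[OF _ f])
  have pd: "vector_pd i (cov k (grad f)) x $ a = partial_deriv i (\<lambda>y. mixed_hess f y $ a $ k) x" for i k a
    by (simp add: vector_pd_def) (rule partial_deriv_cong[OF open_U x H])
  have cc: "cov i (cov k (grad f)) x $ i = partial_deriv i (\<lambda>y. mixed_hess f y $ i $ k) x
      + (\<Sum>p\<in>UNIV. \<Gamma> i x $ i $ p * mixed_hess f x $ p $ k)" for i k
    unfolding cov_def[of i "cov k (grad f)"] by (simp add: pd matrix_vector_mult_def H[OF x])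
  have ck: "cov k (cov i (grad f)) x $ i = partial_deriv k (\<lambda>y. mixed_hess f y $ i $ i) x
      + (\<Sum>p\<in>UNIV. \<Gamma> k x $ i $ p * mixed_hess f x $ p $ i)" for i
    unfolding cov_def[of k "cov i (grad f)"] by (simp add: pd matrix_vector_mult_def H[OF x])
  have "(\<Sum>i\<in>UNIV. (R i k x *v grad f x) $ i)
      = (\<Sum>i\<in>UNIV. cov i (cov k (grad f)) x $ i) - (\<Sum>i\<in>UNIV. cov k (cov i (grad f)) x $ i)"
    unfolding ricci_identity[OF x smooth_grad[OF f], symmetric] by (simp add: sum_subtractf)
  moreover have "partial_deriv k (\<lambda>y. trace (mixed_hess f y)) x
      = (\<Sum>i\<in>UNIV. partial_deriv k (\<lambda>y. mixed_hess f y $ i $ i) x)"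
    using smooth_matrix_on_differentiable[OF smooth_mixed_hess[OF f] x]
    by (simp add: trace_def partial_deriv_sum)
  ultimately show ?thesis
    unfolding div_mixed_def by (simp add: cc ck sum.distrib)
qed

lemma divergence_scale:
  assumes x: "x \<in> U" and "smooth_on U \<phi>" "smooth_vector_on U V"
  shows "divergence (\<lambda>y. \<phi> y *\<^sub>R V y) x = \<phi> x * divergence V x + dform \<phi> x \<bullet> V x"
  using smooth_on_differentiable[OF assms(2) x] smooth_vector_on_differentiable[OF assms(3) x]
  by (simp add: divergence_def cov_def vector_pd_def partial_deriv_mult matrix_vector_mult_scaleR
      sum.distrib inner_vec_def dform_def sum_distrib_left algebra_simps)

lemma divergence_add:
  assumes x: "x \<in> U" and "smooth_vector_on U V" "smooth_vector_on U W"
  shows "divergence (\<lambda>y. V y + W y) x = divergence V x + divergence W x"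
  using assms
  by (simp add: divergence_def cov_def vector_pd_add[OF open_U x] matrix_vector_right_distrib sum.distrib)

text \<open>The Leibniz rule for a contraction, where the second term pairs \<open>H\<close> with
  \<nabla> V, which is \<open>H\<close> again. Replacing partial by covariant derivatives of
  \<open>V\<close> supplies the last \<Gamma> term of \<open>div_mixed\<close>.\<close>

lemma divergence_mixed_hess_grad:
  assumes x: "x \<in> U" and f: "smooth_on U f"
  shows "divergence (\<lambda>y. mixed_hess f y *v grad f y) x
    = (\<Sum>k\<in>UNIV. div_mixed (mixed_hess f) k x * grad f x $ k) + trace (mixed_hess f x ** mixed_hess f x)"
proof -
  let ?H = "mixed_hess f x" and ?V = "grad f x"
  have d: "(\<lambda>y. mixed_hess f y $ a $ b) differentiable (at x)" "(\<lambda>y. grad f y $ c) differentiable (at x)" for a b c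
    using smooth_matrix_on_differentiable[OF smooth_mixed_hess[OF f] x] smooth_vector_on_differentiable[OF smooth_grad[OF f] x]
    by auto
  then have d2: "(\<lambda>y. mixed_hess f y $ a $ b * grad f y $ b) differentiable (at x)" for a b
    by (intro differentiable_mult)
  have HV: "?H $ k $ i = partial_deriv i (\<lambda>y. grad f y $ k) x + (\<Sum>p\<in>UNIV. \<Gamma> i x $ k $ p * ?V $ p)" for k i
    using cov_grad[OF x f, of i k] by (simp add: cov_def vector_pd_def matrix_vector_mult_def)
  have "divergence (\<lambda>y. mixed_hess f y *v grad f y) x
      = (\<Sum>i\<in>UNIV. \<Sum>k\<in>UNIV. partial_deriv i (\<lambda>y. mixed_hess f y $ i $ k) x * ?V $ k)
      + (\<Sum>i\<in>UNIV. \<Sum>k\<in>UNIV. ?H $ i $ k * partial_deriv i (\<lambda>y. grad f y $ k) x)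
      + (\<Sum>i\<in>UNIV. \<Sum>p\<in>UNIV. \<Sum>k\<in>UNIV. \<Gamma> i x $ i $ p * ?H $ p $ k * ?V $ k)"
    using d d2
    by (simp add: divergence_def cov_def vector_pd_def matrix_vector_mult_def partial_deriv_sum
        partial_deriv_mult sum.distrib sum_distrib_left mult_ac)
  moreover have "(\<Sum>i\<in>UNIV. \<Sum>k\<in>UNIV. ?H $ i $ k * partial_deriv i (\<lambda>y. grad f y $ k) x)
      = trace (?H ** ?H) - (\<Sum>i\<in>UNIV. \<Sum>k\<in>UNIV. \<Sum>p\<in>UNIV. ?H $ i $ k * \<Gamma> i x $ k $ p * ?V $ p)"
  proof -
    have "partial_deriv i (\<lambda>y. grad f y $ k) x = ?H $ k $ i - (\<Sum>p\<in>UNIV. \<Gamma> i x $ k $ p * ?V $ p)" for i k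
      using HV[of k i] by simp
    then show ?thesis
      by (simp add: trace_def matrix_matrix_mult_def right_diff_distrib sum_subtractf sum_distrib_left mult.assoc)
  qed
  moreover have "(\<Sum>i\<in>UNIV. \<Sum>k\<in>UNIV. \<Sum>p\<in>UNIV. ?H $ i $ k * \<Gamma> i x $ k $ p * ?V $ p)
      = (\<Sum>k\<in>UNIV. \<Sum>i\<in>UNIV. \<Sum>p\<in>UNIV. \<Gamma> k x $ i $ p * ?H $ p $ i * ?V $ k)"
  proof -
    have "(\<Sum>i\<in>UNIV. \<Sum>k\<in>UNIV. \<Sum>p\<in>UNIV. ?H $ i $ k * \<Gamma> i x $ k $ p * ?V $ p)
        = (\<Sum>p\<in>UNIV. \<Sum>k\<in>UNIV. \<Sum>i\<in>UNIV. ?H $ i $ k * \<Gamma> i x $ k $ p * ?V $ p)"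
      by (subst sum.swap, rule trans[OF sum.cong[OF refl sum.swap] sum.swap])
    then show ?thesis by (simp add: \<Gamma>_sym[OF x] mult_ac)
  qed
  moreover have "(\<Sum>i\<in>UNIV. \<Sum>k\<in>UNIV. partial_deriv i (\<lambda>y. mixed_hess f y $ i $ k) x * ?V $ k)
      = (\<Sum>k\<in>UNIV. \<Sum>i\<in>UNIV. partial_deriv i (\<lambda>y. mixed_hess f y $ i $ k) x * ?V $ k)"
    by (rule sum.swap)
  moreover have "(\<Sum>i\<in>UNIV. \<Sum>p\<in>UNIV. \<Sum>k\<in>UNIV. \<Gamma> i x $ i $ p * ?H $ p $ k * ?V $ k)
      = (\<Sum>k\<in>UNIV. \<Sum>i\<in>UNIV. \<Sum>p\<in>UNIV. \<Gamma> i x $ i $ p * ?H $ p $ k * ?V $ k)"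
    by (rule trans[OF sum.cong[OF refl sum.swap] sum.swap])
  ultimately show ?thesis
    by (simp add: div_mixed_def sum.distrib sum_subtractf left_diff_distrib distrib_right sum_distrib_right)
qed

end

section \<open>Solitons in a chart\<close>

context local_metric
begin

definition ric :: "real^'n \<Rightarrow> real^'n^'n" where
  "ric x = (\<chi> j k. \<Sum>i\<in>UNIV. R i j x $ i $ k)"

lemma mixed_ricci_eq: "mixed_ricci x = transpose (ric x ** Q x)"
proof -
  have "mixed_ricci x $ m $ j = transpose (ric x ** Q x) $ m $ j" for m j
    by (simp add: mixed_ricci_def S_def transpose_def matrix_matrix_mult_def ric_def sum_distrib_right)
      (rule sum.swap)
  then show ?thesis by (simp add: vec_eq_iff)
qed

definition lap :: "(real^'n \<Rightarrow> real) \<Rightarrow> real^'n \<Rightarrow> real" where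
  "lap f x = trace (mixed_hess f x)"

lemma smooth_lap: "smooth_on U f \<Longrightarrow> smooth_on U (lap f)"
  unfolding lap_def by (intro smooth_trace smooth_mixed_hess)

lemma lap_eq_divergence: "x \<in> U \<Longrightarrow> smooth_on U f \<Longrightarrow> lap f x = divergence (grad f) x"
  by (simp add: lap_def trace_mixed_hess)

text \<open>The Christoffel part of the Hessian, traced with \<open>Q\<close>, is of first order and
  joins the drift. So the Euclidean maximum principle applies with the inverse metric as coefficient
  matrix.\<close>

lemma lap_eq_elliptic_op:
  assumes x: "x \<in> U"
  shows "lap u x + W x \<bullet> dform u x
    = elliptic_op Q (\<lambda>x. \<chi> k. W x $ k - (\<Sum>i\<in>UNIV. \<Sum>j\<in>UNIV. Q x $ i $ j * \<Gamma> i x $ k $ j)) u x"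
proof -
  have "lap u x = (\<Sum>i\<in>UNIV. \<Sum>j\<in>UNIV. Q x $ i $ j * hess u x $ i $ j)"
    unfolding lap_def mixed_hess_def trace_def matrix_matrix_mult_def vec_lambda_beta
    by (subst sum.swap, subst Q_sym[OF x], rule refl)
  also have "\<dots> = (\<Sum>i\<in>UNIV. \<Sum>j\<in>UNIV. Q x $ i $ j * partial_deriv i (partial_deriv j u) x)
      - (\<Sum>i\<in>UNIV. \<Sum>j\<in>UNIV. \<Sum>k\<in>UNIV. Q x $ i $ j * \<Gamma> i x $ k $ j * partial_deriv k u x)"
    by (simp add: hess_def \<Gamma>_def right_diff_distrib sum_subtractf sum_distrib_left mult.assoc)
  also have "(\<Sum>i\<in>UNIV. \<Sum>j\<in>UNIV. \<Sum>k\<in>UNIV. Q x $ i $ j * \<Gamma> i x $ k $ j * partial_deriv k u x)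
      = (\<Sum>k\<in>UNIV. \<Sum>i\<in>UNIV. \<Sum>j\<in>UNIV. Q x $ i $ j * \<Gamma> i x $ k $ j * partial_deriv k u x)"
    by (rule trans[OF sum.cong[OF refl sum.swap] sum.swap])
  finally show ?thesis
    by (simp add: elliptic_op_def inner_vec_def dform_def left_diff_distrib sum_subtractf sum_distrib_right)
qed

lemma continuous_elliptic_coeff:
  assumes "smooth_vector_on U W"
  shows "continuous_on U (\<lambda>x. (\<chi> k. W x $ k - (\<Sum>i\<in>UNIV. \<Sum>j\<in>UNIV. Q x $ i $ j * \<Gamma> i x $ k $ j)) $ k)"
  using assms smooth_Q smooth_\<Gamma> unfolding smooth_matrix_on_def smooth_vector_on_def vec_lambda_beta
  by (intro continuous_intros smooth_on_continuous_on) auto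

lemma local_strong_maximum_principle:
  assumes u: "smooth_on U u" and W: "smooth_vector_on U W"
    and sub: "\<And>x. x \<in> U \<Longrightarrow> 0 \<le> lap u x + W x \<bullet> dform u x"
    and le: "\<And>x. x \<in> U \<Longrightarrow> u x \<le> M"
  shows "open {x\<in>U. u x = M}"
proof (rule strong_maximum_principle_local[OF open_U u _ _ _ continuous_elliptic_coeff[OF W] _ le])
  show "continuous_on U (\<lambda>x. Q x $ i $ j)" for i j
    using smooth_Q by (auto simp: smooth_matrix_on_def intro: smooth_on_continuous_on)
qed (use sub lap_eq_elliptic_op Q_facts in auto)

context
  fixes f :: "real^'n \<Rightarrow> real" and lam :: real
  assumes f: "smooth_on U f"
    and soliton: "\<And>x. x \<in> U \<Longrightarrow> hess f x + ric x = lam *\<^sub>R G x"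
begin

lemma mixed_ricci_soliton: "x \<in> U \<Longrightarrow> mixed_ricci x = lam *\<^sub>R mat 1 - mixed_hess f x"
proof -
  assume x: "x \<in> U"
  have "ric x = lam *\<^sub>R G x - hess f x" using soliton[OF x] by (simp add: algebra_simps)
  then have "ric x ** Q x = lam *\<^sub>R mat 1 - hess f x ** Q x"
    using Q_facts[OF x] by (simp add: matrix_diff_rdistrib flip: scalar_matrix_assoc)
  then have "mixed_ricci x = transpose (lam *\<^sub>R mat 1) - transpose (hess f x ** Q x)"
    by (simp add: mixed_ricci_eq transpose_def vec_eq_iff)
  then show ?thesis
    using Q_facts(3)[OF x] hess_sym[OF x f]
    by (simp add: transpose_scalar matrix_transpose_mul mixed_hess_def)
qed

text \<open>By the soliton equation the scalar curvature plus \<open>h\<close> is constant, and the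
  divergences of Ricci and of \<open>H\<close> are opposite. The contracted Bianchi identity is
  thereby transferred to \<open>H\<close>.\<close>

lemma partial_deriv_lap:
  assumes x: "x \<in> U"
  shows "partial_deriv k (lap f) x = 2 * div_mixed (mixed_hess f) k x"
proof -
  have "smooth_matrix_on U (mixed_hess f)" by (rule smooth_mixed_hess[OF f])
  then have dH: "(\<lambda>y. mixed_hess f y $ a $ b) differentiable (at x)" for a b
    by (rule smooth_matrix_on_differentiable[OF _ x])
  have dl: "lap f differentiable (at x)" by (rule smooth_on_differentiable[OF smooth_lap[OF f] x])
  have "partial_deriv k (\<lambda>y. trace (mixed_ricci y)) x = partial_deriv k (\<lambda>y. lam * CARD('n) - lap f y) x"
    by (rule partial_deriv_cong[OF open_U x])
      (simp add: mixed_ricci_soliton lap_def trace_def mat_def sum_subtractf)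
  then have dtr: "partial_deriv k (\<lambda>y. trace (mixed_ricci y)) x = - partial_deriv k (lap f) x"
    using dl by (simp add: partial_deriv_diff)
  have dRic: "partial_deriv i (\<lambda>y. mixed_ricci y $ i $ k) x = - partial_deriv i (\<lambda>y. mixed_hess f y $ i $ k) x" for i
  proof -
    have "partial_deriv i (\<lambda>y. mixed_ricci y $ i $ k) x
        = partial_deriv i (\<lambda>y. lam * (mat 1 :: real^'n^'n) $ i $ k - mixed_hess f y $ i $ k) x"
      by (rule partial_deriv_cong[OF open_U x]) (simp add: mixed_ricci_soliton)
    then show ?thesis using dH by (simp add: partial_deriv_diff)
  qed
  have "div_mixed mixed_ricci k x = - div_mixed (mixed_hess f) k x"
  proof -
    have "(\<Sum>i\<in>UNIV. \<Sum>p\<in>UNIV. \<Gamma> i x $ i $ p * mixed_ricci x $ p $ k)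
        = lam * (\<Sum>i\<in>UNIV. \<Gamma> i x $ i $ k) - (\<Sum>i\<in>UNIV. \<Sum>p\<in>UNIV. \<Gamma> i x $ i $ p * mixed_hess f x $ p $ k)"
      by (simp add: mixed_ricci_soliton[OF x] mat_def right_diff_distrib sum_subtractf sum_distrib_left
          if_distrib[where f = "\<lambda>t. _ * t"] mult.commute[of lam] cong: if_cong)
    moreover have "(\<Sum>i\<in>UNIV. \<Sum>p\<in>UNIV. \<Gamma> k x $ i $ p * mixed_ricci x $ p $ i)
        = lam * (\<Sum>i\<in>UNIV. \<Gamma> k x $ i $ i) - (\<Sum>i\<in>UNIV. \<Sum>p\<in>UNIV. \<Gamma> k x $ i $ p * mixed_hess f x $ p $ i)"
      by (simp add: mixed_ricci_soliton[OF x] mat_def right_diff_distrib sum_subtractf sum_distrib_left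
          if_distrib[where f = "\<lambda>t. _ * t"] mult.commute[of lam] cong: if_cong)
    \<comment> \<open>The multiple of the identity contributes nothing: its divergence vanishes by
      the symmetry of \<Gamma>.\<close>
    moreover have "(\<Sum>i\<in>UNIV. \<Gamma> i x $ i $ k) = (\<Sum>i\<in>UNIV. \<Gamma> k x $ i $ i)"
      using \<Gamma>_sym[OF x] by (intro sum.cong) auto
    ultimately show ?thesis
      by (simp add: div_mixed_def dRic sum_negf)
  qed
  then show ?thesis using dtr contracted_bianchi[OF x, of k] by simp
qed

text \<open>Two expressions for the divergence of \<open>H\<close> are compared: half of
  \<open>dh\<close>, and \<open>dh\<close> plus Ricci applied to the gradient. So \<open>dh\<close>
  is minus twice the Ricci term, which the soliton equation eliminates.\<close>

lemma dform_lap: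
  assumes x: "x \<in> U"
  shows "dform (lap f) x = 2 *\<^sub>R (hess f x *v grad f x - lam *\<^sub>R dform f x)"
proof -
  have "(\<Sum>i\<in>UNIV. (R i k x *v grad f x) $ i) = (ric x *v grad f x) $ k" for k
    by (simp add: ric_def matrix_vector_mult_def sum_distrib_right) (rule sum.swap)
  then have "div_mixed (mixed_hess f) k x = partial_deriv k (lap f) x + (ric x *v grad f x) $ k" for k
    using div_mixed_hess[OF x f, of k] by (simp add: lap_def[abs_def])
  then have half: "partial_deriv k (lap f) x = - 2 * (ric x *v grad f x) $ k" for k
    using partial_deriv_lap[OF x, of k] by simp
  have "ric x = lam *\<^sub>R G x - hess f x" using soliton[OF x] by (simp add: algebra_simps)
  moreover have "G x *v grad f x = dform f x"
    using Q_facts[OF x] by (simp add: grad_def matrix_vector_mul_assoc)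
  ultimately have "ric x *v grad f x = lam *\<^sub>R dform f x - hess f x *v grad f x"
    by (simp add: matrix_vector_mult_diff_rdistrib flip: scaleR_matrix_vector_assoc)
  with half show ?thesis by (simp add: vec_eq_iff dform_def algebra_simps)
qed

lemma grad_lap:
  assumes x: "x \<in> U"
  shows "grad (lap f) x = 2 *\<^sub>R (mixed_hess f x *v grad f x) - (2 * lam) *\<^sub>R grad f x"
  unfolding grad_def[of "lap f"] dform_lap[OF x]
  by (simp add: mixed_hess_def grad_def matrix_vector_mul_assoc matrix_mul_assoc
      matrix_vector_mult_diff_distrib matrix_vector_mult_scaleR algebra_simps)

text \<open>The function \<open>(2 \<lambda> - \<Delta> f) exp (- f)\<close> satisfies an elliptic inequality: after division by
  \<open>- exp (- f)\<close> its gradient is \<open>2 H(\<nabla> f) - (\<Delta> f) \<nabla> f\<close>, with divergence \<open>2 |H|\<^sup>2 - (\<Delta> f)\<^sup>2\<close>.\<close>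

definition potential :: "real^'n \<Rightarrow> real" where
  "potential x = (2 * lam - lap f x) * exp (- f x)"

lemma smooth_potential: "smooth_on U potential"
  unfolding potential_def[abs_def]
  by (intro smooth_on_mult smooth_on_diff smooth_on_const smooth_on_exp smooth_on_minus smooth_lap f open_U)

text \<open>The coefficients make the derivatives of \<open>h\<close> cancel: one pairing of
  \<open>dh\<close> with the gradient comes from scaling by \<open>- h\<close>, the opposite one
  from twice the divergence of \<open>H\<close>, which is \<open>dh\<close>.\<close>

lemma divergence_flux:
  assumes x: "x \<in> U"
  shows "divergence (\<lambda>y. (- lap f y) *\<^sub>R grad f y + 2 *\<^sub>R (mixed_hess f y *v grad f y)) x
    = 2 * trace (mixed_hess f x ** mixed_hess f x) - (lap f x)\<^sup>2"
proof -
  note sm = smooth_grad[OF f] smooth_vector_on_mult[OF open_U smooth_mixed_hess[OF f] smooth_grad[OF f]]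
  have sc: "smooth_vector_on U (\<lambda>y. \<phi> y *\<^sub>R V y)" if "smooth_on U \<phi>" "smooth_vector_on U V" for \<phi> V
    using that by (auto simp: smooth_vector_on_def intro: smooth_on_mult open_U)
  note s1 = smooth_on_minus[OF open_U smooth_lap[OF f]]
  have d: "dform (\<lambda>y. - lap f y) x = - dform (lap f) x"
    using smooth_on_differentiable[OF smooth_lap[OF f] x]
    by (simp add: dform_def vec_eq_iff partial_deriv_minus)
  have d2: "dform (\<lambda>y. 2) x = 0" by (simp add: dform_def vec_eq_iff)
  have "(\<Sum>k\<in>UNIV. div_mixed (mixed_hess f) k x * grad f x $ k) = (dform (lap f) x \<bullet> grad f x) / 2"
    using partial_deriv_lap[OF x] by (simp add: inner_vec_def dform_def sum_divide_distrib)
  then show ?thesis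
    unfolding divergence_add[OF x sc[OF s1 sm(1)] sc[OF smooth_on_const sm(2)]]
      divergence_scale[OF x s1 sm(1)] divergence_scale[OF x smooth_on_const sm(2)]
      divergence_mixed_hess_grad[OF x f]
    by (simp add: d d2 power2_eq_square inner_minus_left
        lap_eq_divergence[OF x f, symmetric])
qed

text \<open>\<open>potential\<close> is minus the function \<open>E\<close>. Its gradient is
  \<open>- exp (- f)\<close> times the flux, so a drift along the gradient of \<open>f\<close>
  removes the derivative of the weight and leaves the divergence of the flux.\<close>

lemma potential_elliptic:
  assumes x: "x \<in> U"
  shows "lap potential x + grad f x \<bullet> dform potential x
    = exp (- f x) * ((lap f x)\<^sup>2 - 2 * trace (mixed_hess f x ** mixed_hess f x))"
proof -
  define X where "X = (\<lambda>y. (- lap f y) *\<^sub>R grad f y + 2 *\<^sub>R (mixed_hess f y *v grad f y))"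
  have sf: "smooth_on U (\<lambda>y. - f y)" by (rule smooth_on_minus[OF open_U f])
  have se: "smooth_on U (\<lambda>y. - exp (- f y))" by (intro smooth_on_minus smooth_on_exp open_U f)
  have sX: "smooth_vector_on U X"
    unfolding X_def using smooth_grad[OF f] smooth_vector_on_mult[OF open_U smooth_mixed_hess[OF f] smooth_grad[OF f]]
    by (auto simp: smooth_vector_on_def intro!: smooth_on_diff smooth_on_mult smooth_on_const smooth_lap f open_U)
  have gp: "grad potential y = (- exp (- f y)) *\<^sub>R X y" if y: "y \<in> U" for y
  proof -
    have df: "(\<lambda>y. - f y) differentiable (at y)" "f differentiable (at y)" "lap f differentiable (at y)"
      using smooth_on_differentiable[OF sf y] smooth_on_differentiable[OF f y] smooth_on_differentiable[OF smooth_lap[OF f] y]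
      by auto
    have d1: "(\<lambda>y. 2 * lam - lap f y) differentiable (at y)" using df by (intro differentiable_diff) auto
    have d2: "(\<lambda>y. exp (- f y)) differentiable (at y)"
      using smooth_on_differentiable[OF smooth_on_exp[OF open_U sf] y] .
    have "dform potential y = (- exp (- f y)) *\<^sub>R (dform (lap f) y + (2 * lam - lap f y) *\<^sub>R dform f y)"
      using df d1 d2
      by (simp add: dform_def vec_eq_iff potential_def[abs_def] partial_deriv_mult partial_deriv_diff
          partial_deriv_exp partial_deriv_minus algebra_simps)
    then have "grad potential y = (- exp (- f y)) *\<^sub>R (grad (lap f) y + (2 * lam - lap f y) *\<^sub>R grad f y)"
      by (simp only: grad_def matrix_vector_mult_scaleR matrix_vector_right_distrib)
    then show ?thesis unfolding grad_lap[OF y] by (simp add: X_def algebra_simps)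
  qed
  have "lap potential x = divergence (\<lambda>y. (- exp (- f y)) *\<^sub>R X y) x"
  proof -
    have "vector_pd i (grad potential) x = vector_pd i (\<lambda>y. (- exp (- f y)) *\<^sub>R X y) x" for i
      by (rule vector_pd_cong[OF open_U x gp])
    then show ?thesis
      using gp[OF x] by (simp add: lap_eq_divergence[OF x smooth_potential] divergence_def cov_def)
  qed
  also have "\<dots> = - exp (- f x) * divergence X x + dform (\<lambda>y. - exp (- f y)) x \<bullet> X x"
    by (rule divergence_scale[OF x se sX])
  also have "dform (\<lambda>y. - exp (- f y)) x = exp (- f x) *\<^sub>R dform f x"
    using smooth_on_differentiable[OF sf x] smooth_on_differentiable[OF f x]
      smooth_on_differentiable[OF smooth_on_exp[OF open_U sf] x]
    by (simp add: dform_def vec_eq_iff partial_deriv_minus partial_deriv_exp)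
  also have "divergence X x = 2 * trace (mixed_hess f x ** mixed_hess f x) - (lap f x)\<^sup>2"
    unfolding X_def by (rule divergence_flux[OF x])
  finally have "lap potential x = exp (- f x) * ((lap f x)\<^sup>2 - 2 * trace (mixed_hess f x ** mixed_hess f x))
      + exp (- f x) * (dform f x \<bullet> X x)"
    by (simp add: algebra_simps)
  moreover have "grad f x \<bullet> dform potential x = - exp (- f x) * (dform f x \<bullet> X x)"
  proof -
    have "grad f x \<bullet> dform potential x = dform f x \<bullet> grad potential x"
      unfolding grad_def using Q_facts(3)[OF x] by (metis inner_matrix_symmetric)
    then show ?thesis by (simp add: gp[OF x])
  qed
  ultimately show ?thesis by simp
qed

end

end

section \<open>Invariance of the Hessian under isometries\<close>

context local_metric
begin

lemma dform_cong: "x \<in> U \<Longrightarrow> (\<And>y. y \<in> U \<Longrightarrow> u y = v y) \<Longrightarrow> dform u x = dform v x"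
  by (auto simp: dform_def vec_eq_iff intro!: partial_deriv_cong[OF open_U])

lemma mixed_hess_cong:
  assumes x: "x \<in> U" and eq: "\<And>y. y \<in> U \<Longrightarrow> u y = v y"
  shows "mixed_hess u x = mixed_hess v x"
proof -
  have d: "partial_deriv j u y = partial_deriv j v y" if "y \<in> U" for j y
    by (rule partial_deriv_cong[OF open_U that eq])
  have "hess u x = hess v x"
    using partial_deriv_cong[OF open_U x d] d[OF x] by (simp add: hess_def vec_eq_iff)
  then show ?thesis by (simp add: mixed_hess_def)
qed

lemma lap_cong: "x \<in> U \<Longrightarrow> (\<And>y. y \<in> U \<Longrightarrow> u y = v y) \<Longrightarrow> lap u x = lap v x"
  unfolding lap_def by (simp only: mixed_hess_cong[of x u v])

lemma dform_minus: "x \<in> U \<Longrightarrow> smooth_on U u \<Longrightarrow> dform (\<lambda>y. - u y) x = - dform u x"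
  by (simp add: dform_def vec_eq_iff partial_deriv_minus[OF smooth_on_differentiable])

lemma lap_minus:
  assumes x: "x \<in> U" and u: "smooth_on U u"
  shows "lap (\<lambda>y. - u y) x = - lap u x"
proof -
  have d: "partial_deriv j (\<lambda>y. - u y) y = - partial_deriv j u y" if "y \<in> U" for j y
    by (rule partial_deriv_minus[OF smooth_on_differentiable[OF u that]])
  have "partial_deriv i (partial_deriv j (\<lambda>y. - u y)) x = - partial_deriv i (partial_deriv j u) x" for i j
    by (rule trans[OF partial_deriv_cong[OF open_U x d]
          partial_deriv_minus[OF smooth_on_differentiable[OF smooth_on_partial_deriv[OF u] x]]])
  then have "hess (\<lambda>y. - u y) x = - hess u x"
    using d[OF x] by (simp add: hess_def vec_eq_iff sum_negf)
  then show ?thesis by (simp add: lap_def mixed_hess_def matrix_minus_right trace_def sum_negf)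
qed

text \<open>The Hessian is determined by the brackets \<open>pair u v = \<langle>\<nabla> u, \<nabla> v\<rangle>\<close>, which only involve first
  derivatives; so its invariance needs no transformation law for the Christoffel symbols.\<close>

definition pair :: "(real^'n \<Rightarrow> real) \<Rightarrow> (real^'n \<Rightarrow> real) \<Rightarrow> real^'n \<Rightarrow> real" where
  "pair u v x = dform u x \<bullet> grad v x"

lemma smooth_pair: "smooth_on U u \<Longrightarrow> smooth_on U v \<Longrightarrow> smooth_on U (pair u v)"
  using smooth_dform[of u] smooth_grad[of v] unfolding pair_def[abs_def] inner_vec_def inner_real_def smooth_vector_on_def
  by (intro smooth_on_sum smooth_on_mult open_U) auto

text \<open>The Leibniz rule with metric compatibility: the Christoffel terms from the second
  derivatives of \<open>f\<close> and from the derivative of the gradient of \<open>v\<close>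
  cancel.\<close>

lemma dform_pair:
  assumes x: "x \<in> U" and f: "smooth_on U f" and v: "smooth_on U v"
  shows "dform (pair f v) x = hess f x *v grad v x + hess v x *v grad f x"
proof -
  have "partial_deriv k (pair f v) x = (hess f x *v grad v x) $ k + (hess v x *v grad f x) $ k" for k
  proof -
    have d: "partial_deriv l f differentiable (at x)" "(\<lambda>y. grad v y $ l) differentiable (at x)" for l
      using smooth_on_differentiable[OF smooth_on_partial_deriv[OF f] x]
        smooth_vector_on_differentiable[OF smooth_grad[OF v] x] by auto
    have dd: "(\<lambda>y. partial_deriv l f y * grad v y $ l) differentiable (at x)" for l
      using d by (intro differentiable_mult)
    have vk: "partial_deriv k (\<lambda>y. grad v y $ l) x
        = mixed_hess v x $ l $ k - (\<Sum>p\<in>UNIV. \<Gamma> k x $ l $ p * grad v x $ p)" for l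
      using cov_grad[OF x v, of k l] by (simp add: cov_def vector_pd_def matrix_vector_mult_def)
    have fk: "partial_deriv k (partial_deriv l f) x
        = hess f x $ k $ l + (\<Sum>p\<in>UNIV. \<Gamma> k x $ p $ l * partial_deriv p f x)" for l
      by (simp add: hess_def \<Gamma>_def)
    have "partial_deriv k (pair f v) x
        = (\<Sum>l\<in>UNIV. partial_deriv l f x * partial_deriv k (\<lambda>y. grad v y $ l) x
          + partial_deriv k (partial_deriv l f) x * grad v x $ l)"
      using d dd by (simp add: pair_def[abs_def] inner_vec_def dform_def partial_deriv_sum partial_deriv_mult)
    also have "\<dots> = (\<Sum>l\<in>UNIV. partial_deriv l f x * mixed_hess v x $ l $ k) + (\<Sum>l\<in>UNIV. hess f x $ k $ l * grad v x $ l)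
        + ((\<Sum>l\<in>UNIV. \<Sum>p\<in>UNIV. \<Gamma> k x $ p $ l * partial_deriv p f x * grad v x $ l)
          - (\<Sum>l\<in>UNIV. \<Sum>p\<in>UNIV. \<Gamma> k x $ l $ p * partial_deriv l f x * grad v x $ p))"
      by (simp add: vk fk algebra_simps sum.distrib sum_subtractf sum_distrib_left)
    also have "(\<Sum>l\<in>UNIV. \<Sum>p\<in>UNIV. \<Gamma> k x $ p $ l * partial_deriv p f x * grad v x $ l)
        = (\<Sum>l\<in>UNIV. \<Sum>p\<in>UNIV. \<Gamma> k x $ l $ p * partial_deriv l f x * grad v x $ p)"
      by (rule sum.swap)
    also have "(\<Sum>l\<in>UNIV. partial_deriv l f x * mixed_hess v x $ l $ k) = (hess v x *v grad f x) $ k"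
    proof -
      have "(\<Sum>l\<in>UNIV. partial_deriv l f x * mixed_hess v x $ l $ k) = (transpose (mixed_hess v x) *v dform f x) $ k"
        by (simp only: matrix_vector_mult_def transpose_def dform_def vec_lambda_beta mult.commute)
      also have "transpose (mixed_hess v x) = hess v x ** Q x"
        using Q_facts(3)[OF x] hess_sym[OF x v] by (simp add: mixed_hess_def matrix_transpose_mul)
      finally show ?thesis by (simp add: grad_def matrix_vector_mul_assoc)
    qed
    finally show ?thesis by (simp add: matrix_vector_mult_def)
  qed
  then show ?thesis by (simp add: dform_def vec_eq_iff)
qed

lemma pair_eq: "x \<in> U \<Longrightarrow> pair u v x = grad u x \<bullet> dform v x"
  using inner_matrix_symmetric[OF Q_facts(3)] by (simp add: pair_def grad_def)

text \<open>A polarisation as in the Koszul formula: each nested bracket contributes two Hessians by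
  \<open>dform_pair\<close>, and in this combination those of \<open>u\<close> and \<open>v\<close>
  cancel.\<close>

lemma hess_eq_pair:
  assumes x: "x \<in> U" and u: "smooth_on U u" and v: "smooth_on U v" and f: "smooth_on U f"
  shows "2 * (grad u x \<bullet> (hess f x *v grad v x)) = pair u (pair f v) x + pair v (pair f u) x - pair f (pair u v) x"
proof -
  note sym = hess_sym[OF x u] hess_sym[OF x v] hess_sym[OF x f]
  show ?thesis
    using sym[THEN inner_matrix_symmetric]
    by (simp add: pair_eq[OF x] dform_pair[OF x] u v f inner_add_right) (simp add: inner_commute)
qed

end

section \<open>Coordinate changes that preserve the metric\<close>

lemma jacobian_nth:
  fixes \<phi> :: "real^'n::finite \<Rightarrow> real^'n"
  assumes "\<And>a. (\<lambda>y. \<phi> y $ a) differentiable (at x)"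
  shows "jacobian \<phi> (at x) $ a $ i = partial_deriv i (\<lambda>y. \<phi> y $ a) x"
    and "\<phi> differentiable (at x)"
proof -
  have "((\<lambda>y. \<chi> a. \<phi> y $ a) has_derivative (\<lambda>v. \<chi> a. frechet_derivative (\<lambda>y. \<phi> y $ a) (at x) v)) (at x)"
    by (rule has_derivative_componentwise_within[THEN iffD2], intro ballI)
      (use assms in \<open>auto simp: Basis_vec_def inner_axis frechet_derivative_works\<close>)
  then have D: "(\<phi> has_derivative (\<lambda>v. \<chi> a. frechet_derivative (\<lambda>y. \<phi> y $ a) (at x) v)) (at x)" by simp
  then show "\<phi> differentiable (at x)" unfolding differentiable_def by blast
  have "frechet_derivative \<phi> (at x) = (\<lambda>v. \<chi> a. frechet_derivative (\<lambda>y. \<phi> y $ a) (at x) v)"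
    using frechet_derivative_at[OF D] by simp
  then show "jacobian \<phi> (at x) $ a $ i = partial_deriv i (\<lambda>y. \<phi> y $ a) x"
    by (simp add: jacobian_def matrix_def partial_deriv_def)
qed

lemma partial_deriv_compose:
  fixes \<phi> :: "real^'n::finite \<Rightarrow> real^'n" and w :: "real^'n \<Rightarrow> real"
  assumes \<phi>: "\<And>a. (\<lambda>y. \<phi> y $ a) differentiable (at x)" and w: "w differentiable (at (\<phi> x))"
  shows "partial_deriv i (\<lambda>y. w (\<phi> y)) x = (\<Sum>a\<in>UNIV. jacobian \<phi> (at x) $ a $ i * partial_deriv a w (\<phi> x))"
proof -
  have "(\<phi> has_derivative frechet_derivative \<phi> (at x)) (at x)"
    using jacobian_nth(2)[OF \<phi>] by (simp add: frechet_derivative_works)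
  from diff_chain_at[OF this has_derivative_partial_deriv[OF w]]
  have "partial_deriv i (\<lambda>y. w (\<phi> y)) x
      = (\<Sum>a\<in>UNIV. frechet_derivative \<phi> (at x) (axis i 1) $ a * partial_deriv a w (\<phi> x))"
    using partial_deriv_eqI by (fastforce simp: o_def)
  then show ?thesis by (simp add: jacobian_def matrix_def)
qed

locale isometric_coordinate_change =
  M: local_metric U G + N: local_metric U' G'
  for U :: "(real^'n::finite) set" and G and U' :: "(real^'n) set" and G' +
  fixes \<phi> :: "real^'n \<Rightarrow> real^'n"
  assumes maps: "x \<in> U \<Longrightarrow> \<phi> x \<in> U'"
    and smooth_\<phi>: "smooth_on U (\<lambda>x. \<phi> x $ a)"
    and pullback: "x \<in> U \<Longrightarrow> G x = transpose (jacobian \<phi> (at x)) ** G' (\<phi> x) ** jacobian \<phi> (at x)"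
begin

lemma dform_compose:
  assumes x: "x \<in> U" and w: "smooth_on U' w"
  shows "M.dform (\<lambda>y. w (\<phi> y)) x = transpose (jacobian \<phi> (at x)) *v N.dform w (\<phi> x)"
  using partial_deriv_compose[OF smooth_on_differentiable[OF smooth_\<phi> x] smooth_on_differentiable[OF w maps[OF x]]]
  by (simp add: M.dform_def N.dform_def vec_eq_iff matrix_vector_mult_def transpose_def del: transpose_matrix_vector)

text \<open>A vector killed by the Jacobian would be a null vector of the pulled back metric, which
  is positive definite.\<close>

lemma jacobian_inverse:
  assumes x: "x \<in> U"
  shows "jacobian \<phi> (at x) ** matrix_inv (jacobian \<phi> (at x)) = mat 1"
    "matrix_inv (jacobian \<phi> (at x)) ** jacobian \<phi> (at x) = mat 1"
proof -
  let ?J = "jacobian \<phi> (at x)"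
  have "v = 0" if "?J *v v = 0" for v
  proof (rule ccontr)
    assume "v \<noteq> 0"
    moreover have "G x *v v = 0"
      using that by (simp add: pullback[OF x] flip: matrix_vector_mul_assoc)
    ultimately show False using M.pos_G[OF x, of v] by simp
  qed
  then have "\<exists>B. B ** ?J = mat 1" by (simp add: matrix_left_invertible_ker)
  then have "invertible ?J" by (simp add: invertible_left_inverse)
  then show "?J ** matrix_inv ?J = mat 1" "matrix_inv ?J ** ?J = mat 1"
    by (rule matrix_inv_inverse)+
qed

text \<open>The metric is pulled back and its inverse is pushed forward; this follows by inverting
  \<open>pullback\<close>.\<close>

lemma Q_transform:
  assumes x: "x \<in> U"
  shows "jacobian \<phi> (at x) ** M.Q x ** transpose (jacobian \<phi> (at x)) = N.Q (\<phi> x)"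
proof -
  let ?J = "jacobian \<phi> (at x)" and ?K = "matrix_inv (jacobian \<phi> (at x))" and ?G' = "G' (\<phi> x)"
  note JK = jacobian_inverse[OF x]
  have "?J ** M.Q x ** transpose ?J ** ?G' = ?J ** M.Q x ** transpose ?J ** ?G' ** (?J ** ?K)"
    using JK by simp
  also have "\<dots> = ?J ** (M.Q x ** G x) ** ?K"
    unfolding pullback[OF x] by (simp only: matrix_mul_assoc)
  also have "\<dots> = mat 1" using JK M.Q_facts[OF x] by simp
  finally have "?J ** M.Q x ** transpose ?J ** (?G' ** N.Q (\<phi> x)) = N.Q (\<phi> x)"
    by (simp add: matrix_mul_assoc)
  then show ?thesis using N.Q_facts[OF maps[OF x]] by simp
qed

lemma pair_compose:
  assumes x: "x \<in> U" and "smooth_on U' u" "smooth_on U' v"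
  shows "M.pair (\<lambda>y. u (\<phi> y)) (\<lambda>y. v (\<phi> y)) x = N.pair u v (\<phi> x)"
proof -
  let ?J = "jacobian \<phi> (at x)"
  have "M.pair (\<lambda>y. u (\<phi> y)) (\<lambda>y. v (\<phi> y)) x
      = N.dform u (\<phi> x) \<bullet> ((?J ** M.Q x ** transpose ?J) *v N.dform v (\<phi> x))"
    using dot_lmul_matrix[of "N.dform u (\<phi> x)" ?J]
    by (simp add: M.pair_def M.grad_def dform_compose assms flip: matrix_vector_mul_assoc)
  then show ?thesis by (simp add: Q_transform[OF x] N.pair_def N.grad_def)
qed

text \<open>\<open>pair_compose\<close> holds on the whole open set \<open>U\<close>, so it can be
  differentiated once more. Two nested brackets are all that \<open>hess_eq_pair\<close>
  needs.\<close>

lemma pair_pair_compose: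
  assumes x: "x \<in> U" and u: "smooth_on U' u" and v: "smooth_on U' v" and w: "smooth_on U' w"
  shows "M.pair (\<lambda>y. u (\<phi> y)) (M.pair (\<lambda>y. v (\<phi> y)) (\<lambda>y. w (\<phi> y))) x = N.pair u (N.pair v w) (\<phi> x)"
proof -
  have "M.dform (M.pair (\<lambda>y. v (\<phi> y)) (\<lambda>y. w (\<phi> y))) x = M.dform (\<lambda>y. N.pair v w (\<phi> y)) x"
    by (rule M.dform_cong[OF x]) (simp add: pair_compose v w)
  then have "M.pair (\<lambda>y. u (\<phi> y)) (M.pair (\<lambda>y. v (\<phi> y)) (\<lambda>y. w (\<phi> y))) x
      = M.pair (\<lambda>y. u (\<phi> y)) (\<lambda>y. N.pair v w (\<phi> y)) x"
    by (simp add: M.pair_def M.grad_def)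
  then show ?thesis by (simp add: pair_compose[OF x u N.smooth_pair[OF v w]])
qed

text \<open>Coordinate functions have gradients in all directions, so the bracket formula tested on
  them and on their pullbacks determines every entry of the Hessian. The outcome is that the two
  endomorphisms are conjugate.\<close>

lemma mixed_hess_compose:
  assumes x: "x \<in> U" and f': "smooth_on U' f'" and f: "smooth_on U (\<lambda>y. f' (\<phi> y))"
  shows "M.mixed_hess (\<lambda>y. f' (\<phi> y)) x
    = matrix_inv (jacobian \<phi> (at x)) ** N.mixed_hess f' (\<phi> x) ** jacobian \<phi> (at x)"
proof -
  let ?J = "jacobian \<phi> (at x)" and ?K = "matrix_inv (jacobian \<phi> (at x))"
  let ?H = "M.mixed_hess (\<lambda>y. f' (\<phi> y)) x" and ?H' = "N.mixed_hess f' (\<phi> x)"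
  note JK = jacobian_inverse[OF x]
  note c = smooth_on_nth[of U']
  have gN: "N.grad (\<lambda>y. y $ a) z = N.Q z *v axis a 1" for a z
    by (simp add: N.grad_def N.dform_def partial_deriv_nth axis_def)
  have gM: "M.grad (\<lambda>y. \<phi> y $ a) x = M.Q x *v (transpose ?J *v axis a 1)" for a
    using dform_compose[OF x c, of a] by (simp add: M.grad_def N.dform_def partial_deriv_nth axis_def)
  have "axis a 1 \<bullet> ((?J ** ?H ** M.Q x ** transpose ?J) *v axis b 1) = axis a 1 \<bullet> ((?H' ** N.Q (\<phi> x)) *v axis b 1)" for a b
  proof -
    have "axis a 1 \<bullet> ((?J ** ?H ** M.Q x ** transpose ?J) *v axis b 1)
        = M.grad (\<lambda>y. \<phi> y $ a) x \<bullet> (M.hess (\<lambda>y. f' (\<phi> y)) x *v M.grad (\<lambda>y. \<phi> y $ b) x)"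
      using dot_lmul_matrix[of "axis a 1" ?J, symmetric] inner_matrix_symmetric[OF M.Q_facts(3)[OF x]]
      by (simp add: gM M.mixed_hess_def flip: matrix_vector_mul_assoc)
    also have "2 * \<dots> = 2 * (N.grad (\<lambda>y. y $ a) (\<phi> x) \<bullet> (N.hess f' (\<phi> x) *v N.grad (\<lambda>y. y $ b) (\<phi> x)))"
      unfolding M.hess_eq_pair[OF x smooth_\<phi> smooth_\<phi> f] N.hess_eq_pair[OF maps[OF x] c c f']
      using pair_pair_compose[OF x c f' c] pair_pair_compose[OF x f' c c] by simp
    also have "N.grad (\<lambda>y. y $ a) (\<phi> x) \<bullet> (N.hess f' (\<phi> x) *v N.grad (\<lambda>y. y $ b) (\<phi> x))
        = axis a 1 \<bullet> ((?H' ** N.Q (\<phi> x)) *v axis b 1)"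
      using inner_matrix_symmetric[OF N.Q_facts(3)[OF maps[OF x]]]
      by (simp add: gN N.mixed_hess_def flip: matrix_vector_mul_assoc)
    finally show ?thesis by simp
  qed
  then have "?J ** ?H ** M.Q x ** transpose ?J = ?H' ** N.Q (\<phi> x)"
    by (simp add: inner_axis_matrix_axis vec_eq_iff)
  also have "\<dots> = ?H' ** ?J ** M.Q x ** transpose ?J"
    by (simp add: matrix_mul_assoc flip: Q_transform[OF x])
  \<comment> \<open>The transposed Jacobian and then \<open>Q\<close> are cancelled on the right, by
    their inverses.\<close>
  finally have "?J ** ?H ** M.Q x ** (transpose ?J ** transpose ?K) = ?H' ** ?J ** M.Q x ** (transpose ?J ** transpose ?K)"
    by (simp add: matrix_mul_assoc)
  moreover have "transpose ?J ** transpose ?K = mat 1"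
    using JK by (metis matrix_transpose_mul transpose_mat)
  ultimately have "?J ** ?H ** (M.Q x ** G x) = ?H' ** ?J ** (M.Q x ** G x)"
    by (simp add: matrix_mul_assoc)
  then have "?J ** ?H = ?H' ** ?J" using M.Q_facts[OF x] by simp
  then have "?K ** ?J ** ?H = ?K ** ?H' ** ?J" by (simp add: matrix_mul_assoc[symmetric])
  then show ?thesis using JK by simp
qed

end


section \<open>Compact solitons\<close>

lemma chart_facts:
  assumes "is_chart c"
  shows "open (chart_dom c)" "open (chart_img c)" "continuous_on (chart_dom c) (chart_map c)"
    "continuous_on (chart_img c) (chart_inv c)"
    "\<And>p. p \<in> chart_dom c \<Longrightarrow> chart_map c p \<in> chart_img c"
    "\<And>p. p \<in> chart_dom c \<Longrightarrow> chart_inv c (chart_map c p) = p"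
    "\<And>x. x \<in> chart_img c \<Longrightarrow> chart_inv c x \<in> chart_dom c"
    "\<And>x. x \<in> chart_img c \<Longrightarrow> chart_map c (chart_inv c x) = x"
  using assms unfolding is_chart_def homeomorphism_def by auto

text \<open>Written as a preimage under a continuous map, the overlap is seen to be open.\<close>

lemma overlap_eq:
  assumes "is_chart c"
  shows "overlap c d = chart_img c \<inter> chart_inv c -` chart_dom d"
proof (intro equalityI subsetI)
  fix x assume "x \<in> overlap c d"
  then show "x \<in> chart_img c \<inter> chart_inv c -` chart_dom d"
    using chart_facts(5,6)[OF assms] by (auto simp: overlap_def)
next
  fix x assume x: "x \<in> chart_img c \<inter> chart_inv c -` chart_dom d"
  then have "x = chart_map c (chart_inv c x)" "chart_inv c x \<in> chart_dom c \<inter> chart_dom d"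
    using chart_facts(7,8)[OF assms] by auto
  then show "x \<in> overlap c d" unfolding overlap_def by (rule image_eqI)
qed

lemma open_overlap:
  assumes "is_chart c" "is_chart d"
  shows "open (overlap c d)"
  unfolding overlap_eq[OF assms(1)]
  using chart_facts[OF assms(1)] chart_facts[OF assms(2)] by (intro continuous_open_preimage) auto

context
  fixes A :: "('m::t2_space, 'n::finite) chart set" and g :: "('m, 'n) tensor2"
  assumes rm: "riemannian_manifold A g"
begin

lemma is_chart_atlas: "c \<in> A \<Longrightarrow> is_chart c"
  using rm by (simp add: riemannian_manifold_def smooth_atlas_def)

lemma chart_at: "\<exists>c\<in>A. p \<in> chart_dom c"
  using rm unfolding riemannian_manifold_def smooth_atlas_def by blast

lemma local_metric_restrict:
  assumes c: "c \<in> A" and V: "open V" "V \<subseteq> chart_img c"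
  shows "local_metric V (g c)"
proof
  show "smooth_matrix_on V (g c)"
    using rm c smooth_on_subset[OF _ V(2)]
    unfolding riemannian_manifold_def riemannian_metric_def smooth_matrix_on_def by simp
qed (use rm c V in \<open>auto simp: riemannian_manifold_def riemannian_metric_def\<close>)

lemma local_metric_chart: "c \<in> A \<Longrightarrow> local_metric (chart_img c) (g c)"
  by (rule local_metric_restrict) (auto intro: chart_facts(2) is_chart_atlas)

lemma hessian_endo_eq: "c \<in> A \<Longrightarrow> hessian_endo g f c x = local_metric.mixed_hess (g c) (local_rep f c) x"
proof -
  assume "c \<in> A"
  then interpret local_metric "chart_img c" "g c" by (rule local_metric_chart)
  show ?thesis by (simp add: hessian_endo_def mixed_hess_def Q_def hessian_def hess_def)
qed

lemma isometric_transition: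
  assumes c: "c \<in> A" and d: "d \<in> A"
  shows "isometric_coordinate_change (overlap c d) (g c) (overlap d c) (g d) (transition c d)"
proof -
  note oc = open_overlap[OF is_chart_atlas[OF c] is_chart_atlas[OF d]]
    and od = open_overlap[OF is_chart_atlas[OF d] is_chart_atlas[OF c]]
  interpret M: local_metric "overlap c d" "g c"
    by (rule local_metric_restrict[OF c oc]) (simp add: overlap_eq[OF is_chart_atlas[OF c]])
  interpret N: local_metric "overlap d c" "g d"
    by (rule local_metric_restrict[OF d od]) (simp add: overlap_eq[OF is_chart_atlas[OF d]])
  show ?thesis
  proof
    fix x assume x: "x \<in> overlap c d"
    then show "transition c d x \<in> overlap d c"
      using chart_facts[OF is_chart_atlas[OF c]] by (auto simp: overlap_def transition_def)
    show "g c x = transpose (jacobian (transition c d) (at x)) ** g d (transition c d x) ** jacobian (transition c d) (at x)"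
      using rm c d x by (auto simp: riemannian_manifold_def riemannian_metric_def Let_def)
  next
    show "smooth_on (overlap c d) (\<lambda>x. transition c d x $ a)" for a
      using rm c d by (auto simp: riemannian_manifold_def smooth_atlas_def)
  qed
qed

text \<open>The Hessian endomorphisms in two charts are conjugate by the Jacobian of the transition
  map, and the invariants do not see conjugation.\<close>

lemma matrix_invariant_hessian_chart_independent:
  assumes f: "smooth_function A f" and c: "c \<in> A" "p \<in> chart_dom c" and d: "d \<in> A" "p \<in> chart_dom d"
  shows "matrix_invariant m (hessian_endo g f c (chart_map c p)) = matrix_invariant m (hessian_endo g f d (chart_map d p))"
proof -
  interpret isometric_coordinate_change "overlap c d" "g c" "overlap d c" "g d" "transition c d"
    by (rule isometric_transition[OF c(1) d(1)])
  note cf = chart_facts[OF is_chart_atlas[OF c(1)]] and df = chart_facts[OF is_chart_atlas[OF d(1)]]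
  define x where "x = chart_map c p"
  have x: "x \<in> overlap c d" using c d by (auto simp: overlap_def x_def)
  have tx: "transition c d x = chart_map d p" using cf(6) c by (simp add: transition_def x_def)
  have fc: "smooth_on (overlap c d) (local_rep f c)"
    using f c by (auto simp: smooth_function_def overlap_eq[OF is_chart_atlas[OF c(1)]] intro: smooth_on_subset)
  have fd: "smooth_on (overlap d c) (local_rep f d)"
    using f d by (auto simp: smooth_function_def overlap_eq[OF is_chart_atlas[OF d(1)]] intro: smooth_on_subset)
  have eq: "local_rep f c y = local_rep f d (transition c d y)" if "y \<in> overlap c d" for y
    using that cf(6) df(6) by (auto simp: overlap_def local_rep_def transition_def)
  have "M.mixed_hess (local_rep f c) x = M.mixed_hess (\<lambda>y. local_rep f d (transition c d y)) x"
    by (rule M.mixed_hess_cong[OF x eq])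
  also have "\<dots> = matrix_inv (jacobian (transition c d) (at x)) ** N.mixed_hess (local_rep f d) (transition c d x)
      ** jacobian (transition c d) (at x)"
    by (rule mixed_hess_compose[OF x fd smooth_on_cong[OF M.open_U eq fc]])
  finally show ?thesis
    using matrix_invariant_similar[OF jacobian_inverse(2)[OF x]]
    by (simp add: hessian_endo_eq c d tx flip: x_def)
qed

text \<open>Frees the invariants from the chart selected by \<open>SOME\<close>; this is the only
  access to \<open>S_inv\<close> below.\<close>

lemma S_inv_eq:
  assumes f: "smooth_function A f" and c: "c \<in> A" "p \<in> chart_dom c"
  shows "S_inv A g f m p = matrix_invariant m (hessian_endo g f c (chart_map c p))"
proof -
  define d where "d = (SOME d. d \<in> A \<and> p \<in> chart_dom d)"
  have "d \<in> A \<and> p \<in> chart_dom d" unfolding d_def by (rule someI[of _ c]) (use c in blast)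
  then show ?thesis
    using matrix_invariant_hessian_chart_independent[OF f _ _ c] by (simp add: S_inv_def Let_def flip: d_def)
qed

lemma continuous_smooth_function:
  assumes u: "smooth_function A u"
  shows "continuous_on UNIV u"
proof -
  have "isCont u p" for p
  proof -
    obtain c where c: "c \<in> A" "p \<in> chart_dom c" using chart_at by blast
    note cf = chart_facts[OF is_chart_atlas[OF c(1)]]
    have "continuous_on (chart_img c) (local_rep u c)"
      using u c(1) by (simp add: smooth_function_def smooth_on_continuous_on)
    then have "continuous_on (chart_dom c) (\<lambda>q. local_rep u c (chart_map c q))"
      by (rule continuous_on_compose2[OF _ cf(3)]) (use cf(5) in blast)
    then have "continuous_on (chart_dom c) u"
      by (rule continuous_on_eq) (simp add: local_rep_def cf(6))
    then show ?thesis using cf(1) c(2) continuous_on_eq_continuous_at by blast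
  qed
  then show ?thesis by (simp add: continuous_at_imp_continuous_on)
qed

text \<open>Compactness provides a maximum. The set where it is attained is closed by continuity
  and, read in charts, open by the local principle; connectedness does the rest. The inequality is a
  condition in each chart separately, so no global operator has to be constructed.\<close>

lemma strong_maximum_principle:
  assumes u: "smooth_function A u"
    and conn: "connected (UNIV :: 'm set)" and comp: "compact (UNIV :: 'm set)"
    and W: "\<And>c. c \<in> A \<Longrightarrow> smooth_vector_on (chart_img c) (W c)"
    and sub: "\<And>c x. c \<in> A \<Longrightarrow> x \<in> chart_img c \<Longrightarrow>
      0 \<le> local_metric.lap (g c) (local_rep u c) x + W c x \<bullet> local_metric.dform (local_rep u c) x"
  shows "u constant_on UNIV"
proof -
  have cont: "continuous_on UNIV u" by (rule continuous_smooth_function[OF u])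
  obtain p0 where p0: "\<And>p. u p \<le> u p0"
    using continuous_attains_sup[OF comp _ cont] by auto
  define Z where "Z = {p. u p = u p0}"
  have "closed Z"
    using continuous_closed_preimage_constant[OF cont closed_UNIV, of "u p0"] by (simp add: Z_def)
  moreover have "open Z"
    unfolding open_subopen[of Z]
  proof
    fix p assume p: "p \<in> Z"
    obtain c where c: "c \<in> A" "p \<in> chart_dom c" using chart_at by blast
    note cf = chart_facts[OF is_chart_atlas[OF c(1)]]
    interpret local_metric "chart_img c" "g c" by (rule local_metric_chart[OF c(1)])
    have "open {x \<in> chart_img c. local_rep u c x = u p0}"
    proof (rule local_strong_maximum_principle[of _ "W c"])
      show "smooth_on (chart_img c) (local_rep u c)" using u c(1) by (simp add: smooth_function_def)
      show "local_rep u c x \<le> u p0" for x by (simp add: local_rep_def p0)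
    qed (use W sub c(1) in blast)+
    then have "open (chart_dom c \<inter> chart_map c -` {x \<in> chart_img c. local_rep u c x = u p0})" (is "open ?T")
      using cf(1,3) by (intro continuous_open_preimage)
    moreover have "p \<in> ?T" "?T \<subseteq> Z"
      using p c(2) cf(5,6) by (auto simp: Z_def local_rep_def)
    ultimately show "\<exists>T. open T \<and> p \<in> T \<and> T \<subseteq> Z" by blast
  qed
  moreover have "Z \<noteq> {}" by (auto simp: Z_def)
  ultimately have "Z = UNIV" using conn connected_clopen[of "UNIV :: 'm set"] by auto
  then show ?thesis by (auto simp: Z_def constant_on_def)
qed

end

theorem theorem1p2:
  fixes A :: "('m::{t2_space, second_countable_topology}, 'n::finite) chart set"
    and g :: "('m, 'n) tensor2"
    and f :: "'m \<Rightarrow> real"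
  assumes "riemannian_manifold A g"
    and "connected (UNIV :: 'm set)"
    and "orientable_manifold A"
    and "geodesically_complete A g"
    and "compact (UNIV :: 'm set)"
    and "gradient_ricci_soliton A g f"
    and "S_inv A g f 2 constant_on UNIV"
  shows "trivial_soliton A g f"
proof -
  note rm = assms(1) and conn = assms(2) and comp = assms(5)
  obtain lam where f: "smooth_function A f"
    and sol: "\<And>c x. c \<in> A \<Longrightarrow> x \<in> chart_img c \<Longrightarrow> hessian g f c x + ricci g c x = lam *\<^sub>R g c x"
    using assms(6) by (auto simp: gradient_ricci_soliton_def)
  obtain s where s: "\<And>p. S_inv A g f 2 p = s" using assms(7) by (auto simp: constant_on_def)
  \<comment> \<open>The Laplacian of \<open>f\<close> as a function on the manifold: the first
    invariant is a trace, and by chart independence it agrees with \<open>lap\<close> in every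
    chart.\<close>
  define h where "h = S_inv A g f 1"
  define E where "E p = (h p - 2 * lam) * exp (- f p)" for p
  have fc: "smooth_on (chart_img c) (local_rep f c)" if "c \<in> A" for c
    using f that by (simp add: smooth_function_def)
  have cf: "chart_inv c x \<in> chart_dom c" "chart_map c (chart_inv c x) = x" if "c \<in> A" "x \<in> chart_img c" for c x
    using chart_facts[OF is_chart_atlas[OF rm that(1)]] that(2) by auto
  have h_lap: "local_metric.lap (g c) (local_rep f c) x = h (chart_inv c x)"
    and tr: "2 * s = (h (chart_inv c x))\<^sup>2 - trace (local_metric.mixed_hess (g c) (local_rep f c) x ** local_metric.mixed_hess (g c) (local_rep f c) x)"
    and tr_nonneg: "0 \<le> trace (local_metric.mixed_hess (g c) (local_rep f c) x ** local_metric.mixed_hess (g c) (local_rep f c) x)"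
    if c: "c \<in> A" and x: "x \<in> chart_img c" for c x
  proof -
    interpret local_metric "chart_img c" "g c" by (rule local_metric_chart[OF rm c])
    have inv: "S_inv A g f m (chart_inv c x) = matrix_invariant m (mixed_hess (local_rep f c) x)" for m
      using S_inv_eq[OF rm f c cf(1)[OF c x]] cf(2)[OF c x] by (simp add: hessian_endo_eq[OF rm c])
    show l: "lap (local_rep f c) x = h (chart_inv c x)"
      using inv[of 1] matrix_invariant_1[of "mixed_hess (local_rep f c) x"] by (simp add: h_def lap_def)
    show "2 * s = (h (chart_inv c x))\<^sup>2 - trace (mixed_hess (local_rep f c) x ** mixed_hess (local_rep f c) x)"
      using inv[of 2] s l matrix_invariant_2[of "mixed_hess (local_rep f c) x"] by (simp add: lap_def)
    show "0 \<le> trace (mixed_hess (local_rep f c) x ** mixed_hess (local_rep f c) x)"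
      unfolding mixed_hess_def using Q_facts(4)[OF x] hess_sym[OF x fc[OF c]] by (rule trace_square_nonneg)
  qed
  have subharmonic: "f constant_on UNIV" if "\<And>p. 0 \<le> h p"
  proof (rule strong_maximum_principle[OF rm f conn comp, where W = "\<lambda>c x. 0"])
    show "0 \<le> local_metric.lap (g c) (local_rep f c) x + 0 \<bullet> local_metric.dform (local_rep f c) x"
      if "c \<in> A" "x \<in> chart_img c" for c x
      using \<open>\<And>p. 0 \<le> h p\<close> h_lap[OF that] by simp
  qed (simp add: smooth_vector_on_def smooth_on_const)
  have superharmonic: "f constant_on UNIV" if "\<And>p. h p \<le> 0"
  proof -
    have rep: "local_rep (\<lambda>p. - f p) c = (\<lambda>x. - local_rep f c x)" for c :: "('m, 'n) chart"
      by (simp add: local_rep_def fun_eq_iff)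
    have "(\<lambda>p. - f p) constant_on UNIV"
    proof (rule strong_maximum_principle[OF rm _ conn comp, where W = "\<lambda>c x. 0"])
      show "smooth_function A (\<lambda>p. - f p)"
        using fc chart_facts(2)[OF is_chart_atlas[OF rm]]
        by (auto simp: smooth_function_def rep intro!: smooth_on_minus)
      show "0 \<le> local_metric.lap (g c) (local_rep (\<lambda>p. - f p) c) x + 0 \<bullet> local_metric.dform (local_rep (\<lambda>p. - f p) c) x"
        if "c \<in> A" "x \<in> chart_img c" for c x
        using \<open>\<And>p. h p \<le> 0\<close> h_lap[OF that] local_metric.lap_minus[OF local_metric_chart[OF rm that(1)] that(2) fc[OF that(1)]]
        by (simp add: rep)
    qed (simp add: smooth_vector_on_def smooth_on_const)
    then show ?thesis by (auto simp: constant_on_def) (metis minus_equation_iff)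
  qed
  have h_smooth: "smooth_function A h"
    unfolding smooth_function_def
  proof
    fix c assume c: "c \<in> A"
    interpret local_metric "chart_img c" "g c" by (rule local_metric_chart[OF rm c])
    show "smooth_on (chart_img c) (local_rep h c)"
      by (rule smooth_on_cong[OF open_U _ smooth_lap[OF fc[OF c]]]) (simp add: h_lap[OF c] local_rep_def[of h])
  qed
  have "f constant_on UNIV"
  proof (cases "s \<le> 0")
    case False
    \<comment> \<open>\<open>tr\<close> and \<open>tr_nonneg\<close> give
      \<open>(h p)\<^sup>2 \<ge> 2 * s > 0\<close>.\<close>
    have nz: "h p \<noteq> 0" for p
    proof -
      obtain c where c: "c \<in> A" "p \<in> chart_dom c" using chart_at[OF rm] by blast
      note cp = chart_facts[OF is_chart_atlas[OF rm c(1)]]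
      show ?thesis
        using tr[OF c(1), of "chart_map c p"] tr_nonneg[OF c(1), of "chart_map c p"] cp(5,6)[OF c(2)] False by auto
    qed
    \<comment> \<open>A continuous function without zeros on a connected space keeps its
      sign.\<close>
    have "connected (range h)"
      by (rule connected_continuous_image[OF continuous_smooth_function[OF rm h_smooth] conn])
    have "(\<forall>p. 0 \<le> h p) \<or> (\<forall>p. h p \<le> 0)"
    proof (rule ccontr)
      assume "\<not> ?thesis"
      then obtain p q where "h p \<le> 0" "0 \<le> h q" by (meson linear)
      then have "0 \<in> range h"
        using connectedD_interval[OF \<open>connected (range h)\<close> rangeI rangeI] by blast
      then show False using nz by (metis rangeE)
    qed
    then show ?thesis using subharmonic superharmonic by blast
  next
    case True
    have sol': "local_metric.hess (g c) (local_rep f c) y + local_metric.ric (g c) y = lam *\<^sub>R g c y"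
      if c: "c \<in> A" and y: "y \<in> chart_img c" for c y
    proof -
      interpret local_metric "chart_img c" "g c" by (rule local_metric_chart[OF rm c])
      show ?thesis
        using sol[OF c y] by (simp add: hessian_def hess_def ricci_def ric_def riemann_eq_R)
    qed
    have E_rep: "local_rep E c x = - local_metric.potential (g c) (local_rep f c) lam x"
      if c: "c \<in> A" and x: "x \<in> chart_img c" for c x
    proof -
      interpret local_metric "chart_img c" "g c" by (rule local_metric_chart[OF rm c])
      have "local_rep E c x = (lap (local_rep f c) x - 2 * lam) * exp (- local_rep f c x)"
        unfolding h_lap[OF c x] by (simp add: local_rep_def E_def)
      then show ?thesis
        by (simp add: potential_def[OF fc[OF c] sol'[OF c]] algebra_simps)
    qed
    have E_smooth: "smooth_function A E"
      unfolding smooth_function_def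
    proof
      fix c assume c: "c \<in> A"
      interpret local_metric "chart_img c" "g c" by (rule local_metric_chart[OF rm c])
      note sp = smooth_potential[OF fc[OF c] sol'[OF c]]
      show "smooth_on (chart_img c) (local_rep E c)"
        by (rule smooth_on_cong[OF open_U _ smooth_on_minus[OF open_U sp]]) (simp_all add: E_rep[OF c])
    qed
    have E_elliptic: "local_metric.lap (g c) (local_rep E c) x
        + local_metric.grad (g c) (local_rep f c) x \<bullet> local_metric.dform (local_rep E c) x
        = exp (- local_rep f c x) * ((h (chart_inv c x))\<^sup>2 - 4 * s)"
      if c: "c \<in> A" and x: "x \<in> chart_img c" for c x
    proof -
      interpret local_metric "chart_img c" "g c" by (rule local_metric_chart[OF rm c])
      note sp = smooth_potential[OF fc[OF c] sol'[OF c]]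
      note E' = E_rep[OF c]
      have norm_H: "trace (mixed_hess (local_rep f c) x ** mixed_hess (local_rep f c) x) = (h (chart_inv c x))\<^sup>2 - 2 * s"
        using tr[OF c x] by simp
      show "lap (local_rep E c) x + grad (local_rep f c) x \<bullet> dform (local_rep E c) x
        = exp (- local_rep f c x) * ((h (chart_inv c x))\<^sup>2 - 4 * s)"
        using potential_elliptic[OF fc[OF c] sol'[OF c] x] h_lap[OF c x]
        by (simp add: norm_H lap_cong[OF x E'] dform_cong[OF x E'] lap_minus[OF x sp] dform_minus[OF x sp] algebra_simps)
    qed
    \<comment> \<open>With the gradient of \<open>f\<close> as drift, the left side is that of
      \<open>E_elliptic\<close>; as \<open>s\<close> is at most 0, the right side is a positive
      weight times a sum of nonnegative terms.\<close>
    have "E constant_on UNIV"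
    proof (rule strong_maximum_principle[OF rm E_smooth conn comp, where W = "\<lambda>c. local_metric.grad (g c) (local_rep f c)"])
      show "smooth_vector_on (chart_img c) (local_metric.grad (g c) (local_rep f c))" if "c \<in> A" for c
        using local_metric.smooth_grad[OF local_metric_chart[OF rm that] fc[OF that]] .
      show "0 \<le> local_metric.lap (g c) (local_rep E c) x
        + local_metric.grad (g c) (local_rep f c) x \<bullet> local_metric.dform (local_rep E c) x"
        if "c \<in> A" "x \<in> chart_img c" for c x
        unfolding E_elliptic[OF that] using True order_trans[of "4 * s" 0 "(h (chart_inv c x))\<^sup>2"]
        by (intro mult_nonneg_nonneg) auto
    qed
    then obtain e where e: "\<And>p. E p = e" by (auto simp: constant_on_def)
    have "h p = 0" for p
    proof -
      obtain c where c: "c \<in> A" "p \<in> chart_dom c" using chart_at[OF rm] by blast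
      note cp = chart_facts[OF is_chart_atlas[OF rm c(1)]]
      interpret local_metric "chart_img c" "g c" by (rule local_metric_chart[OF rm c(1)])
      have x: "chart_map c p \<in> chart_img c" using cp(5)[OF c(2)] .
      \<comment> \<open>For a constant function both terms on the left of \<open>E_elliptic\<close>
        vanish, so its right side does too.\<close>
      have "local_rep E c = (\<lambda>x. e)" by (simp add: local_rep_def e fun_eq_iff)
      then have "exp (- local_rep f c (chart_map c p)) * ((h p)\<^sup>2 - 4 * s) = 0"
        using E_elliptic[OF c(1) x] cp(6)[OF c(2)]
        by (simp add: lap_def mixed_hess_def hess_def dform_def matrix_matrix_mult_def trace_def inner_vec_def)
      then have "(h p)\<^sup>2 = 4 * s" by simp
      then show "h p = 0" using True by (metis mult_nonneg_nonpos zero_le_numeral power2_less_eq_zero_iff)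
    qed
    then show ?thesis using subharmonic by simp
  qed
  then show ?thesis by (simp add: trivial_soliton_def)
qed

end
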